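(* Let $\pi$ be a quasigraph in a $3$-hypergraph $H$ (with a fixed linear order $\leq_E$ on $E(H)$). If $\mathcal P^\pi_{\infty,\infty}$ is not $\pi$-skeletal or $\pi$ is not acyclic, then there is a quasigraph $\rho$ in $H$ such that either $\rho\sqsupset\pi$, or $\rho\equiv\pi$ and $\|\rho\|<\|\pi\|$.
   Context: A $3$-hypergraph $H$ is a finite hypergraph (multiple hyperedges allowed) all of whose hyperedges have size $2$ or $3$. A quasigraph $\pi$ in $H$ assigns to each hyperedge $e$ either a $2$-subset of $e$ or $\emptyset$; $e$ is used if $\pi(e)\ne\emptyset$; $\|\pi\|$ is the number of used hyperedges. $\pi^*$ is the multigraph on $V(H)$ with an edge $\pi(e)$ for each used $e$. $\pi$ is acyclic if $\pi^*$ is a forest; a quasicycle if $\pi^*$ is one cycle plus isolated vertices; a $3$-hypergraph is acyclic if it admits no quasicycle. $\pi-e$ has value $\emptyset$ on $e$ and equals $\pi$ elsewhere. For a partition $\mathcal P$ of $V(H)$, a hyperedge (or pair) is $\mathcal P$-crossing if it meets at least two classes; $e/\mathcal P$ is the set of classes met by $e$. $H/\mathcal P$ is the $3$-hypergraph on vertex set $\mathcal P$ with one hyperedge $e/\mathcal P$ for each $\mathcal P$-crossing hyperedge $e$ of $H$; $\pi/\mathcal P$ is the quasigraph in it with $(\pi/\mathcal P)(e/\mathcal P)=\pi(e)/\mathcal P$ if $\pi(e)$ is $\mathcal P$-crossing and $\emptyset$ otherwise. $\overline{\pi/\mathcal P}$ is the subhypergraph of $H/\mathcal P$ consisting of hyperedges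 not used by $\pi/\mathcal P$. For $X\subseteq V(H)$: $\pi$ is connected on $X$ if $\pi^*[X]$ is connected; components of $\pi$ on $X$ are vertex sets of components of $\pi^*[X]$. $\pi$ is anticonnected on $X$ (in $H$) if for every partition $\mathcal R$ of $X$ with $\ge2$ classes some hyperedge $f$ of $H$ meets $\ge2$ classes of $\mathcal R$ while $\pi(f)$ lies in one class (possibly $\pi(f)=\emptyset$); the maximal subsets of $X$ on which $\pi$ is anticonnected partition $X$ and are the anticomponents of $\pi$ on $X$. A partition is $\pi$-solid if $\pi$ is connected and anticonnected on each class; it is $\pi$-skeletal if it is $\pi$-solid and $\overline{\pi/\mathcal P}$ is acyclic. If $\pi$ is connected and anticonnected on $X$ and $|e\cap X|=2$: $e$ is an $X$-bridge if $e$ is used, $\pi(e)\subseteq X$ and $\pi-e$ is not connected on $X$; $e$ is an $X$-antibridge if $e$ is unused and $\pi$ is not anticonnected on $X$ in $H-e$. For a $\pi$-solid $\mathcal R$, $e$ is an $\mathcal R$-(anti)bridge if it is an $X$-(anti)bridge for some $X\in\mathcal R$. A $\mathcal R$-crossing hyperedge is redundant if it is unused and not an $\mathcal R$-antibridge; weakly redundant if it is redundant, or used and not an $\mathcal R$-bridge. Plane sequence: $\mathbb T=\{(i,j):0\le i<\infty,0\le j\le\infty\}\cup\{(\infty,\infty)\}$, ordered lexicographically. Set $\mathcal P_{0,0}=\{V(H)\}$. For $1\le j<\infty$, $\mathcal P_{i,j}$ consists of the components (if $j$ odd) or anticomponents (if $j$ even, $j>0$) of $\pi$ on the classes of $\mathcal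 P_{i,j-1}$; $\mathcal P_{i,\infty}$ is the eventual constant value of $\mathcal P_{i,j}$. For $i\ge1$ let $\mathcal P=\mathcal P_{i-1,\infty}$. The exposure step of two distinct classes $A,B$ of $\mathcal P$ is the least $(s,t)\in\mathbb T$ with $A,B$ in different classes of $\mathcal P_{s,t}$; the exposure step of a quasicycle $\gamma$ in $\overline{\pi/\mathcal P}$ is the least exposure step of $\gamma(e/\mathcal P)$ over hyperedges $e$ with $e/\mathcal P$ used by $\gamma$; such $e$ is a leading hyperedge of $\gamma$ if the exposure step of $\gamma(e/\mathcal P)$ equals that of $\gamma$. If $\overline{\pi/\mathcal P}$ has no quasicycle: $\mathcal P_{i,0}=\mathcal P$, $d_{i-1}=\mathrm{TERMINATE}$. Otherwise let $L$ be the set of hyperedges of $H$ that are leading hyperedges of some quasicycle in $\overline{\pi/\mathcal P}$; if $L$ contains a hyperedge weakly redundant w.r.t. $\pi,\mathcal P$: $\mathcal P_{i,0}=\mathcal P$, $d_{i-1}=\mathrm{STOP}$. Otherwise let $e$ be the $\leq_E$-maximum of $L$, $d_{i-1}=e$; if $e$ is a $\mathcal P$-antibridge, $\mathcal P_{i,0}$ consists of the anticomponents of $\pi$ in $H-e$ on the classes of $\mathcal P$; if $e$ is a $\mathcal P$-bridge, of the components of $\pi-e$ on the classes of $\mathcal P$. $\mathcal P_{\infty,\infty}$ is the eventual constant value of $\mathcal P_{i,\infty}$. We write $\mathcal P^\pi_{i,j}$, $d^\pi_i$. Signature: $\mathrm{sig}(\pi)=(\mathcal P_{0,0},\mathcal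 P_{0,1},\dots,\mathcal P_{0,\infty},d_0,\mathcal P_{1,0},\dots,\mathcal P_{1,\infty},d_1,\dots,\mathcal P_{\ell,\infty},d_\ell)$ with $\ell$ least such that $d_\ell\in\{\mathrm{TERMINATE},\mathrm{STOP}\}$. Partitions are compared by refinement ($\mathcal P\le\mathcal P'$ iff every class of $\mathcal P$ lies in a class of $\mathcal P'$); the values $d$ are compared by a fixed linear order on $E(H)\cup\{\mathrm{STOP},\mathrm{TERMINATE}\}$ extending $\leq_E$ in which STOP exceeds every hyperedge. $\mathrm{sig}(\pi)\le\mathrm{sig}(\rho)$ lexicographically if they are equal or at the first differing position the entry for $\pi$ is strictly smaller. $\pi\sqsubseteq\rho$ iff $\mathrm{sig}(\pi)\le\mathrm{sig}(\rho)$; $\pi\equiv\rho$ iff $\pi\sqsubseteq\rho$ and $\rho\sqsubseteq\pi$; $\rho\sqsupset\pi$ iff $\pi\sqsubseteq\rho$ and $\pi\not\equiv\rho$. *)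

theory Defs
  imports Main "HOL-Library.Disjoint_Sets" "HOL-Library.Extended_Nat" "HOL-Library.Product_Lexorder"
begin

section \<open>3-hypergraphs and quasigraphs\<close>

text \<open>Parallel hyperedges are distinct members of \<open>hedges\<close> with the same value of \<open>ends\<close>. Multigraphs
  are the hypergraphs all of whose hyperedges have size 2.\<close>

record ('v, 'e) hypergraph =
  verts :: "'v set"
  hedges :: "'e set"
  ends :: "'e \<Rightarrow> 'v set"

definition three_hypergraph :: "('v, 'e) hypergraph \<Rightarrow> bool" where
  "three_hypergraph H \<longleftrightarrow> finite (verts H) \<and> finite (hedges H) \<and>
     (\<forall>e\<in>hedges H. ends H e \<subseteq> verts H \<and> card (ends H e) \<in> {2, 3})"

definition delete_hedge :: "('v, 'e) hypergraph \<Rightarrow> 'e \<Rightarrow> ('v, 'e) hypergraph" where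
  "delete_hedge H e = H\<lparr>hedges := hedges H - {e}\<rparr>"

text \<open>A quasigraph is a function on \<open>hedges H\<close>; its values elsewhere are irrelevant, and every notion
  below only inspects values on \<open>hedges H\<close>.\<close>

definition quasigraph :: "('v, 'e) hypergraph \<Rightarrow> ('e \<Rightarrow> 'v set) \<Rightarrow> bool" where
  "quasigraph H \<pi> \<longleftrightarrow> (\<forall>e\<in>hedges H. \<pi> e = {} \<or> \<pi> e \<subseteq> ends H e \<and> card (\<pi> e) = 2)"

definition used_hedges :: "('v, 'e) hypergraph \<Rightarrow> ('e \<Rightarrow> 'v set) \<Rightarrow> 'e set" where
  "used_hedges H \<pi> = {e \<in> hedges H. \<pi> e \<noteq> {}}"

definition qsize :: "('v, 'e) hypergraph \<Rightarrow> ('e \<Rightarrow> 'v set) \<Rightarrow> nat" where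
  "qsize H \<pi> = card (used_hedges H \<pi>)"

text \<open>The multigraph \<open>\<pi>\<^sup>*\<close>.\<close>

definition multigraph_of :: "('v, 'e) hypergraph \<Rightarrow> ('e \<Rightarrow> 'v set) \<Rightarrow> ('v, 'e) hypergraph" where
  "multigraph_of H \<pi> = \<lparr>verts = verts H, hedges = used_hedges H \<pi>, ends = \<pi>\<rparr>"

text \<open>The cycle with vertices \<open>vs\<close> and edges \<open>es\<close>, both in cyclic order. Two parallel edges form a
  cycle of length 2.\<close>

definition is_cycle :: "('v, 'e) hypergraph \<Rightarrow> 'v list \<Rightarrow> 'e list \<Rightarrow> bool" where
  "is_cycle G vs es \<longleftrightarrow> 2 \<le> length vs \<and> length es = length vs \<and> distinct vs \<and> distinct es \<and>
     set vs \<subseteq> verts G \<and> set es \<subseteq> hedges G \<and>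
     (\<forall>i<length vs. ends G (es ! i) = {vs ! i, vs ! (Suc i mod length vs)})"

definition forest :: "('v, 'e) hypergraph \<Rightarrow> bool" where
  "forest G \<longleftrightarrow> \<not> (\<exists>vs es. is_cycle G vs es)"

definition acyclic_quasigraph :: "('v, 'e) hypergraph \<Rightarrow> ('e \<Rightarrow> 'v set) \<Rightarrow> bool" where
  "acyclic_quasigraph H \<pi> \<longleftrightarrow> forest (multigraph_of H \<pi>)"

definition quasicycle :: "('v, 'e) hypergraph \<Rightarrow> ('e \<Rightarrow> 'v set) \<Rightarrow> bool" where
  "quasicycle H \<gamma> \<longleftrightarrow> quasigraph H \<gamma> \<and>
     (\<exists>vs es. is_cycle (multigraph_of H \<gamma>) vs es \<and> set es = hedges (multigraph_of H \<gamma>))"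

definition acyclic_hypergraph :: "('v, 'e) hypergraph \<Rightarrow> bool" where
  "acyclic_hypergraph H \<longleftrightarrow> \<not> (\<exists>\<gamma>. quasicycle H \<gamma>)"


section \<open>Contraction of a partition\<close>

text \<open>\<open>quot P S\<close> is \<open>S/P\<close>, for \<open>S\<close> a hyperedge or a pair of vertices.\<close>

definition quot :: "'v set set \<Rightarrow> 'v set \<Rightarrow> 'v set set" where
  "quot P S = {C \<in> P. C \<inter> S \<noteq> {}}"

definition crossing :: "'v set set \<Rightarrow> 'v set \<Rightarrow> bool" where
  "crossing P S \<longleftrightarrow> 2 \<le> card (quot P S)"

text \<open>The hyperedge \<open>e/P\<close> of \<open>H/P\<close> keeps the name \<open>e\<close>, so that distinct crossing hyperedges give
  distinct (possibly parallel) hyperedges of \<open>H/P\<close>.\<close>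

definition quot_hypergraph :: "('v, 'e) hypergraph \<Rightarrow> 'v set set \<Rightarrow> ('v set, 'e) hypergraph" where
  "quot_hypergraph H P =
     \<lparr>verts = P, hedges = {e \<in> hedges H. crossing P (ends H e)}, ends = (\<lambda>e. quot P (ends H e))\<rparr>"

definition quot_quasigraph :: "('e \<Rightarrow> 'v set) \<Rightarrow> 'v set set \<Rightarrow> 'e \<Rightarrow> 'v set set" where
  "quot_quasigraph \<pi> P e = (if crossing P (\<pi> e) then quot P (\<pi> e) else {})"

definition unused_part :: "('v, 'e) hypergraph \<Rightarrow> ('e \<Rightarrow> 'v set) \<Rightarrow> ('v, 'e) hypergraph" where
  "unused_part H \<pi> = H\<lparr>hedges := hedges H - used_hedges H \<pi>\<rparr>"

definition unused_quot ::
  "('v, 'e) hypergraph \<Rightarrow> ('e \<Rightarrow> 'v set) \<Rightarrow> 'v set set \<Rightarrow> ('v set, 'e) hypergraph" where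
  "unused_quot H \<pi> P = unused_part (quot_hypergraph H P) (quot_quasigraph \<pi> P)"


section \<open>Connectedness and anticonnectedness\<close>

definition induced :: "('v, 'e) hypergraph \<Rightarrow> 'v set \<Rightarrow> ('v, 'e) hypergraph" where
  "induced G X = \<lparr>verts = X, hedges = {e \<in> hedges G. ends G e \<subseteq> X}, ends = ends G\<rparr>"

definition adjacency :: "('v, 'e) hypergraph \<Rightarrow> 'v rel" where
  "adjacency G = {(u, v). \<exists>e\<in>hedges G. ends G e = {u, v}}"

definition connected_multigraph :: "('v, 'e) hypergraph \<Rightarrow> bool" where
  "connected_multigraph G \<longleftrightarrow> (\<forall>u\<in>verts G. \<forall>v\<in>verts G. (u, v) \<in> (adjacency G)\<^sup>*)"

definition multigraph_components :: "('v, 'e) hypergraph \<Rightarrow> 'v set set" where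
  "multigraph_components G = {{v \<in> verts G. (u, v) \<in> (adjacency G)\<^sup>*} | u. u \<in> verts G}"

definition connected_on :: "('v, 'e) hypergraph \<Rightarrow> ('e \<Rightarrow> 'v set) \<Rightarrow> 'v set \<Rightarrow> bool" where
  "connected_on H \<pi> X \<longleftrightarrow> connected_multigraph (induced (multigraph_of H \<pi>) X)"

definition components_on :: "('v, 'e) hypergraph \<Rightarrow> ('e \<Rightarrow> 'v set) \<Rightarrow> 'v set \<Rightarrow> 'v set set" where
  "components_on H \<pi> X = multigraph_components (induced (multigraph_of H \<pi>) X)"

text \<open>The empty value of \<open>\<pi>\<close> lies in every class.\<close>

definition anticonnected_on :: "('v, 'e) hypergraph \<Rightarrow> ('e \<Rightarrow> 'v set) \<Rightarrow> 'v set \<Rightarrow> bool" where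
  "anticonnected_on H \<pi> X \<longleftrightarrow>
     (\<forall>R. partition_on X R \<and> 2 \<le> card R \<longrightarrow>
        (\<exists>f\<in>hedges H. crossing R (ends H f) \<and> (\<exists>C\<in>R. \<pi> f \<subseteq> C)))"

definition anticomponents_on :: "('v, 'e) hypergraph \<Rightarrow> ('e \<Rightarrow> 'v set) \<Rightarrow> 'v set \<Rightarrow> 'v set set" where
  "anticomponents_on H \<pi> X =
     {Y. Y \<subseteq> X \<and> Y \<noteq> {} \<and> anticonnected_on H \<pi> Y \<and>
         (\<forall>Z. Y \<subseteq> Z \<and> Z \<subseteq> X \<and> anticonnected_on H \<pi> Z \<longrightarrow> Z = Y)}"

definition solid :: "('v, 'e) hypergraph \<Rightarrow> ('e \<Rightarrow> 'v set) \<Rightarrow> 'v set set \<Rightarrow> bool" where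
  "solid H \<pi> P \<longleftrightarrow> partition_on (verts H) P \<and>
     (\<forall>X\<in>P. connected_on H \<pi> X \<and> anticonnected_on H \<pi> X)"

definition skeletal :: "('v, 'e) hypergraph \<Rightarrow> ('e \<Rightarrow> 'v set) \<Rightarrow> 'v set set \<Rightarrow> bool" where
  "skeletal H \<pi> P \<longleftrightarrow> solid H \<pi> P \<and> acyclic_hypergraph (unused_quot H \<pi> P)"


section \<open>Bridges, antibridges and redundancy\<close>

text \<open>\<open>\<pi> - e\<close> is written \<open>\<pi>(e := {})\<close>.\<close>

definition set_bridge :: "('v, 'e) hypergraph \<Rightarrow> ('e \<Rightarrow> 'v set) \<Rightarrow> 'v set \<Rightarrow> 'e \<Rightarrow> bool" where
  "set_bridge H \<pi> X e \<longleftrightarrow> connected_on H \<pi> X \<and> anticonnected_on H \<pi> X \<and>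
     e \<in> hedges H \<and> card (ends H e \<inter> X) = 2 \<and>
     \<pi> e \<noteq> {} \<and> \<pi> e \<subseteq> X \<and> \<not> connected_on H (\<pi>(e := {})) X"

definition set_antibridge :: "('v, 'e) hypergraph \<Rightarrow> ('e \<Rightarrow> 'v set) \<Rightarrow> 'v set \<Rightarrow> 'e \<Rightarrow> bool" where
  "set_antibridge H \<pi> X e \<longleftrightarrow> connected_on H \<pi> X \<and> anticonnected_on H \<pi> X \<and>
     e \<in> hedges H \<and> card (ends H e \<inter> X) = 2 \<and>
     \<pi> e = {} \<and> \<not> anticonnected_on (delete_hedge H e) \<pi> X"

definition bridge :: "('v, 'e) hypergraph \<Rightarrow> ('e \<Rightarrow> 'v set) \<Rightarrow> 'v set set \<Rightarrow> 'e \<Rightarrow> bool" where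
  "bridge H \<pi> R e \<longleftrightarrow> (\<exists>X\<in>R. set_bridge H \<pi> X e)"

definition antibridge :: "('v, 'e) hypergraph \<Rightarrow> ('e \<Rightarrow> 'v set) \<Rightarrow> 'v set set \<Rightarrow> 'e \<Rightarrow> bool" where
  "antibridge H \<pi> R e \<longleftrightarrow> (\<exists>X\<in>R. set_antibridge H \<pi> X e)"

definition redundant :: "('v, 'e) hypergraph \<Rightarrow> ('e \<Rightarrow> 'v set) \<Rightarrow> 'v set set \<Rightarrow> 'e \<Rightarrow> bool" where
  "redundant H \<pi> R e \<longleftrightarrow> e \<in> hedges H \<and> crossing R (ends H e) \<and>
     \<pi> e = {} \<and> \<not> antibridge H \<pi> R e"

definition weakly_redundant :: "('v, 'e) hypergraph \<Rightarrow> ('e \<Rightarrow> 'v set) \<Rightarrow> 'v set set \<Rightarrow> 'e \<Rightarrow> bool" where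
  "weakly_redundant H \<pi> R e \<longleftrightarrow> redundant H \<pi> R e \<or>
     e \<in> hedges H \<and> crossing R (ends H e) \<and> \<pi> e \<noteq> {} \<and> \<not> bridge H \<pi> R e"


section \<open>The plane sequence\<close>

definition eventual_value :: "(nat \<Rightarrow> 'a) \<Rightarrow> 'a" where
  "eventual_value f = (THE x. \<exists>N. \<forall>n\<ge>N. f n = x)"

text \<open>One row of the plane sequence, started from its entry with second index 0.\<close>

primrec row_fin :: "('v, 'e) hypergraph \<Rightarrow> ('e \<Rightarrow> 'v set) \<Rightarrow> 'v set set \<Rightarrow> nat \<Rightarrow> 'v set set" where
  "row_fin H \<pi> P0 0 = P0"
| "row_fin H \<pi> P0 (Suc j) =
     (\<Union>X \<in> row_fin H \<pi> P0 j. if odd (Suc j) then components_on H \<pi> X else anticomponents_on H \<pi> X)"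

definition row :: "('v, 'e) hypergraph \<Rightarrow> ('e \<Rightarrow> 'v set) \<Rightarrow> 'v set set \<Rightarrow> enat \<Rightarrow> 'v set set" where
  "row H \<pi> P0 j = (case j of enat n \<Rightarrow> row_fin H \<pi> P0 n | \<infinity> \<Rightarrow> eventual_value (row_fin H \<pi> P0))"

definition in_different_classes :: "'v set set \<Rightarrow> 'v set \<Rightarrow> 'v set \<Rightarrow> bool" where
  "in_different_classes Q A B \<longleftrightarrow> (\<exists>C\<in>Q. \<exists>D\<in>Q. C \<noteq> D \<and> A \<subseteq> C \<and> B \<subseteq> D)"

text \<open>The exposure step of a pair \<open>S\<close> of sets with respect to a plane of partitions \<open>Q\<close>; index pairs
  are ordered lexicographically. The index \<open>(\<infinity>, \<infinity>)\<close> can be left out: two distinct classes of the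
  partition with index \<open>(i, \<infinity>)\<close> are in different classes already there.\<close>

definition exposure_step :: "(nat \<Rightarrow> enat \<Rightarrow> 'v set set) \<Rightarrow> 'v set set \<Rightarrow> nat \<times> enat" where
  "exposure_step Q S = (LEAST p. \<exists>A B. S = {A, B} \<and> in_different_classes (Q (fst p) (snd p)) A B)"

definition quasicycle_exposure_step ::
  "(nat \<Rightarrow> enat \<Rightarrow> 'v set set) \<Rightarrow> ('v set, 'e) hypergraph \<Rightarrow> ('e \<Rightarrow> 'v set set) \<Rightarrow> nat \<times> enat" where
  "quasicycle_exposure_step Q K \<gamma> = Min ((\<lambda>e. exposure_step Q (\<gamma> e)) ` used_hedges K \<gamma>)"

definition leading_hedges ::
  "('v, 'e) hypergraph \<Rightarrow> ('e \<Rightarrow> 'v set) \<Rightarrow> (nat \<Rightarrow> enat \<Rightarrow> 'v set set) \<Rightarrow> 'v set set \<Rightarrow> 'e set" where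
  "leading_hedges H \<pi> Q P =
     {e. \<exists>\<gamma>. quasicycle (unused_quot H \<pi> P) \<gamma> \<and> e \<in> used_hedges (unused_quot H \<pi> P) \<gamma> \<and>
          exposure_step Q (\<gamma> e) = quasicycle_exposure_step Q (unused_quot H \<pi> P) \<gamma>}"

datatype 'e decision = Hyperedge 'e | STOP | TERMINATE

definition order_max :: "'e rel \<Rightarrow> 'e set \<Rightarrow> 'e" where
  "order_max r L = (THE e. e \<in> L \<and> (\<forall>f\<in>L. (f, e) \<in> r))"

definition decide ::
  "('v, 'e) hypergraph \<Rightarrow> 'e rel \<Rightarrow> ('e \<Rightarrow> 'v set) \<Rightarrow> (nat \<Rightarrow> enat \<Rightarrow> 'v set set) \<Rightarrow> 'v set set \<Rightarrow> 'e decision" where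
  "decide H leE \<pi> Q P =
     (if acyclic_hypergraph (unused_quot H \<pi> P) then TERMINATE
      else if \<exists>e \<in> leading_hedges H \<pi> Q P. weakly_redundant H \<pi> P e then STOP
      else Hyperedge (order_max leE (leading_hedges H \<pi> Q P)))"

text \<open>In the last case below \<open>e\<close> is a bridge when \<open>d = decide H leE \<pi> Q P\<close>, since it is not weakly
  redundant.\<close>

definition next_start ::
  "('v, 'e) hypergraph \<Rightarrow> ('e \<Rightarrow> 'v set) \<Rightarrow> 'v set set \<Rightarrow> 'e decision \<Rightarrow> 'v set set" where
  "next_start H \<pi> P d = (case d of
       TERMINATE \<Rightarrow> P
     | STOP \<Rightarrow> P
     | Hyperedge e \<Rightarrow>
         if antibridge H \<pi> P e then \<Union>X\<in>P. anticomponents_on (delete_hedge H e) \<pi> X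
         else \<Union>X\<in>P. components_on H (\<pi>(e := {})) X)"

text \<open>Row \<open>i + 1\<close> depends on all earlier rows through the exposure steps. The function
  \<open>history H leE \<pi> i\<close> agrees with the plane sequence on the rows up to \<open>i\<close> (and repeats row \<open>i\<close>
  beyond), see \<open>history_eq_plane\<close> and \<open>exposure_step_history\<close> below.\<close>

primrec history ::
  "('v, 'e) hypergraph \<Rightarrow> 'e rel \<Rightarrow> ('e \<Rightarrow> 'v set) \<Rightarrow> nat \<Rightarrow> nat \<Rightarrow> enat \<Rightarrow> 'v set set" where
  "history H leE \<pi> 0 = (\<lambda>s. row H \<pi> {verts H})"
| "history H leE \<pi> (Suc i) = (\<lambda>s.
     if s \<le> i then history H leE \<pi> i s
     else let P = history H leE \<pi> i i \<infinity>
          in row H \<pi> (next_start H \<pi> P (decide H leE \<pi> (history H leE \<pi> i) P)))"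

definition plane :: "('v, 'e) hypergraph \<Rightarrow> 'e rel \<Rightarrow> ('e \<Rightarrow> 'v set) \<Rightarrow> nat \<Rightarrow> enat \<Rightarrow> 'v set set" where
  "plane H leE \<pi> i j = history H leE \<pi> i i j"

definition decision_at :: "('v, 'e) hypergraph \<Rightarrow> 'e rel \<Rightarrow> ('e \<Rightarrow> 'v set) \<Rightarrow> nat \<Rightarrow> 'e decision" where
  "decision_at H leE \<pi> i = decide H leE \<pi> (history H leE \<pi> i) (plane H leE \<pi> i \<infinity>)"

definition plane_limit :: "('v, 'e) hypergraph \<Rightarrow> 'e rel \<Rightarrow> ('e \<Rightarrow> 'v set) \<Rightarrow> 'v set set" where
  "plane_limit H leE \<pi> = eventual_value (\<lambda>i. plane H leE \<pi> i \<infinity>)"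

lemma history_eq_plane: "s \<le> i \<Longrightarrow> history H leE \<pi> i s = plane H leE \<pi> s"
proof (induction i)
  case (Suc i)
  then show ?case
    by (cases "s = Suc i") (auto simp: plane_def fun_eq_iff)
qed (auto simp: plane_def fun_eq_iff)

lemma plane_0: "plane H leE \<pi> 0 = row H \<pi> {verts H}"
  by (simp add: plane_def fun_eq_iff)

lemma plane_Suc:
  "plane H leE \<pi> (Suc i) = row H \<pi> (next_start H \<pi> (plane H leE \<pi> i \<infinity>) (decision_at H leE \<pi> i))"
  by (simp add: plane_def decision_at_def fun_eq_iff Let_def)

lemma exposure_step_history:
  assumes "A \<in> plane H leE \<pi> i \<infinity>" "B \<in> plane H leE \<pi> i \<infinity>" "A \<noteq> B"
  shows "exposure_step (history H leE \<pi> i) {A, B} = exposure_step (plane H leE \<pi>) {A, B}"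
proof -
  define sep where "sep Q p \<longleftrightarrow>
    (\<exists>A' B'. {A, B} = {A', B'} \<and> in_different_classes (Q (fst p) (snd p)) A' B')"
    for Q :: "nat \<Rightarrow> enat \<Rightarrow> 'a set set" and p
  have agree: "sep (history H leE \<pi> i) p = sep (plane H leE \<pi>) p" if "p \<le> (i, \<infinity>)" for p
  proof -
    from that have "fst p \<le> i" by (cases p) auto
    then show ?thesis by (simp add: sep_def history_eq_plane)
  qed
  have sep: "sep (plane H leE \<pi>) (i, \<infinity>)"
    unfolding sep_def in_different_classes_def using assms by fastforce
  define l where "l = (LEAST p. sep (plane H leE \<pi>) p)"
  have l: "sep (plane H leE \<pi>) l" "l \<le> (i, \<infinity>)"
    using sep unfolding l_def by (auto intro: LeastI Least_le)
  have "(LEAST p. sep (history H leE \<pi> i) p) = l"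
  proof (rule Least_equality)
    show "sep (history H leE \<pi> i) l" using l agree by blast
    fix q assume q: "sep (history H leE \<pi> i) q"
    show "l \<le> q"
    proof (rule ccontr)
      assume "\<not> l \<le> q"
      with l(2) have "q \<le> (i, \<infinity>)" by (meson le_cases order_trans)
      with q agree have "sep (plane H leE \<pi>) q" by blast
      then have "l \<le> q" unfolding l_def by (rule Least_le)
      with \<open>\<not> l \<le> q\<close> show False by blast
    qed
  qed
  then show ?thesis by (simp add: exposure_step_def sep_def l_def)
qed


section \<open>Signatures\<close>

datatype ('v, 'e) sig_entry = Partition "'v set set" | Decision "'e decision"

definition sig_length :: "('v, 'e) hypergraph \<Rightarrow> 'e rel \<Rightarrow> ('e \<Rightarrow> 'v set) \<Rightarrow> nat" where
  "sig_length H leE \<pi> = (LEAST i. decision_at H leE \<pi> i \<in> {TERMINATE, STOP})"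

text \<open>Positions in a signature are triples: \<open>(i, False, j)\<close> is the place of the partition with index
  \<open>(i, j)\<close>, and \<open>(i, True, 0)\<close> is the place of the decision with index \<open>i\<close>. The lexicographic order on
  triples is the order in which the signature is listed. Unoccupied positions carry \<open>None\<close>.\<close>

definition sig ::
  "('v, 'e) hypergraph \<Rightarrow> 'e rel \<Rightarrow> ('e \<Rightarrow> 'v set) \<Rightarrow> nat \<times> bool \<times> enat \<Rightarrow> ('v, 'e) sig_entry option" where
  "sig H leE \<pi> = (\<lambda>(i, b, j).
     if i \<le> sig_length H leE \<pi> then
       (if \<not> b then Some (Partition (plane H leE \<pi> i j))
        else if j = 0 then Some (Decision (decision_at H leE \<pi> i)) else None)
     else None)"

fun entry_less ::
  "'v set \<Rightarrow> 'e decision rel \<Rightarrow> ('v, 'e) sig_entry option \<Rightarrow> ('v, 'e) sig_entry option \<Rightarrow> bool" where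
  "entry_less V leD (Some (Partition P)) (Some (Partition Q)) \<longleftrightarrow> refines V P Q \<and> P \<noteq> Q"
| "entry_less V leD (Some (Decision c)) (Some (Decision d)) \<longleftrightarrow> (c, d) \<in> leD \<and> c \<noteq> d"
| "entry_less V leD _ _ \<longleftrightarrow> False"

text \<open>A linear order on \<open>E(H) \<union> {STOP, TERMINATE}\<close> extending \<open>leE\<close> in which \<open>STOP\<close> exceeds every
  hyperedge; the place of \<open>TERMINATE\<close> is arbitrary.\<close>

definition decision_order :: "('v, 'e) hypergraph \<Rightarrow> 'e rel \<Rightarrow> 'e decision rel \<Rightarrow> bool" where
  "decision_order H leE leD \<longleftrightarrow>
     linear_order_on (Hyperedge ` hedges H \<union> {STOP, TERMINATE}) leD \<and>
     (\<forall>(e, f)\<in>leE. (Hyperedge e, Hyperedge f) \<in> leD) \<and>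
     (\<forall>e\<in>hedges H. (Hyperedge e, STOP) \<in> leD)"

definition sig_le ::
  "('v, 'e) hypergraph \<Rightarrow> 'e rel \<Rightarrow> 'e decision rel \<Rightarrow> ('e \<Rightarrow> 'v set) \<Rightarrow> ('e \<Rightarrow> 'v set) \<Rightarrow> bool" where
  "sig_le H leE leD \<pi> \<rho> \<longleftrightarrow> sig H leE \<pi> = sig H leE \<rho> \<or>
     (\<exists>p. (\<forall>q<p. sig H leE \<pi> q = sig H leE \<rho> q) \<and>
          entry_less (verts H) leD (sig H leE \<pi> p) (sig H leE \<rho> p))"

definition sig_equiv ::
  "('v, 'e) hypergraph \<Rightarrow> 'e rel \<Rightarrow> 'e decision rel \<Rightarrow> ('e \<Rightarrow> 'v set) \<Rightarrow> ('e \<Rightarrow> 'v set) \<Rightarrow> bool" where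
  "sig_equiv H leE leD \<pi> \<rho> \<longleftrightarrow> sig_le H leE leD \<pi> \<rho> \<and> sig_le H leE leD \<rho> \<pi>"

definition sig_less ::
  "('v, 'e) hypergraph \<Rightarrow> 'e rel \<Rightarrow> 'e decision rel \<Rightarrow> ('e \<Rightarrow> 'v set) \<Rightarrow> ('e \<Rightarrow> 'v set) \<Rightarrow> bool" where
  "sig_less H leE leD \<pi> \<rho> \<longleftrightarrow> sig_le H leE leD \<pi> \<rho> \<and> \<not> sig_equiv H leE leD \<pi> \<rho>"

end

theory Submission
  imports Defs
begin

text \<open>If the plane sequence of \<open>\<pi>\<close> ends with \<open>STOP\<close> at the partition \<open>P\<close>, some quasicycle \<open>\<gamma>\<close> in the
  unused part of \<open>\<pi>/P\<close> has a weakly redundant leading hyperedge \<open>e\<close>. Redefine \<open>\<pi>\<close> at \<open>e\<close> to be a pair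
  joining the two classes in \<open>\<gamma>(e)\<close>. Let \<open>U\<close> be the union of the classes on \<open>\<gamma>\<close>. The remaining
  hyperedges of \<open>\<gamma>\<close> keep \<open>U\<close> anticonnected, so \<open>U\<close> can only be separated by a step that takes
  components, and before that step nothing gets finer (a decision can only change to \<open>STOP\<close>). At the
  exposure step of \<open>e\<close> the new pair joins two components, so the signature increases.

  If the sequence ends with \<open>TERMINATE\<close>, the limit is skeletal, so \<open>\<pi>\<^sup>*\<close> contains a cycle. A cycle minus an
  edge stays connected, so its vertex set \<open>U\<close> can only be separated by a step that takes anticomponents.
  Making an edge \<open>e\<close> of the cycle unused never makes a partition finer; if \<open>U\<close> is
  separated at all and \<open>e\<close> is an edge separated first, the released hyperedge joins two anticomponents at
  that step. Otherwise the signature does not decrease and fewer hyperedges are used.\<close>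

section \<open>Colourings and clusters\<close>

text \<open>The difficulty is that one changed value influences every later partition and, through
  the quasicycles of the quotient, every later decision. This is controlled while \<open>U\<close>
  lies in one class of the current partition \<open>P\<close>. Whatever \<open>e\<close> contributed
  to holding a set together is replaced by a detour inside \<open>U\<close> or still supplied by
  \<open>e\<close>. Detours exist because a hyperedge removed by a decision never lies on the cycle
  or quasicycle while \<open>U\<close> is unseparated. The bound 3 on hyperedge sizes enters through
  one count: a hyperedge cannot have two vertices in each of two disjoint sets. This puts a used
  pair of a quasicycle hyperedge into one of the two classes being joined, and it makes an
  anticomponent that relies on \<open>e\<close> meet \<open>U\<close>.\<close>

text \<open>Both kinds of connectedness are tested by vertex colourings: for connectedness some used pair
  must be non-monochromatic, for anticonnectedness some hyperedge must be non-monochromatic although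
  its pair is monochromatic. The set \<open>F\<close> of admitted hyperedges covers both \<open>\<pi> - e\<close> and \<open>H - e\<close>.\<close>

definition splits :: "('v \<Rightarrow> 'v set) \<Rightarrow> 'v set \<Rightarrow> bool" where
  "splits c S \<longleftrightarrow> (\<exists>x\<in>S. \<exists>y\<in>S. c x \<noteq> c y)"

definition con :: "'e set \<Rightarrow> ('e \<Rightarrow> 'v set) \<Rightarrow> 'v set \<Rightarrow> bool" where
  "con F \<pi> Y \<longleftrightarrow> (\<forall>c. splits c Y \<longrightarrow> (\<exists>f\<in>F. \<pi> f \<subseteq> Y \<and> splits c (\<pi> f)))"

definition acon :: "('e \<Rightarrow> 'v set) \<Rightarrow> 'e set \<Rightarrow> ('e \<Rightarrow> 'v set) \<Rightarrow> 'v set \<Rightarrow> bool" where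
  "acon N F \<pi> Y \<longleftrightarrow>
     (\<forall>c. splits c Y \<longrightarrow> (\<exists>f\<in>F. \<pi> f \<subseteq> Y \<and> \<not> splits c (\<pi> f) \<and> splits c (N f \<inter> Y)))"

lemma splits_empty [simp]: "\<not> splits c {}"
  by (simp add: splits_def)

lemma splits_mono: "splits c S \<Longrightarrow> S \<subseteq> T \<Longrightarrow> splits c T"
  by (auto simp: splits_def)

text \<open>The shared vertex forces the same colour on both sets once each of them is
  monochromatic.\<close>

lemma splits_Un: "splits c (S \<union> T) \<Longrightarrow> S \<inter> T \<noteq> {} \<Longrightarrow> splits c S \<or> splits c T"
  unfolding splits_def by (metis Un_iff disjoint_iff)

lemma splits_card_ge_2:
  assumes "splits c S" "finite S"
  shows "2 \<le> card S"
proof (rule ccontr)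
  assume "\<not> 2 \<le> card S"
  then have "card S \<le> Suc 0" by simp
  with assms show False by (auto simp: splits_def card_le_Suc0_iff_eq)
qed

lemma con_mono: "con F \<pi> Y \<Longrightarrow> F \<subseteq> F' \<Longrightarrow> con F' \<pi> Y"
  unfolding con_def by (meson subsetD)

lemma acon_mono: "acon N F \<pi> Y \<Longrightarrow> F \<subseteq> F' \<Longrightarrow> acon N F' \<pi> Y"
  unfolding acon_def by (meson subsetD)

section \<open>Families of sets closed under overlapping unions\<close>

definition cluster :: "('v set \<Rightarrow> bool) \<Rightarrow> bool" where
  "cluster C \<longleftrightarrow> (\<forall>x. C {x}) \<and> (\<forall>Y Z. C Y \<longrightarrow> C Z \<longrightarrow> Y \<inter> Z \<noteq> {} \<longrightarrow> C (Y \<union> Z))"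

lemma cluster_con: "cluster (con F \<pi>)"
  unfolding cluster_def
proof (intro conjI allI impI)
  fix Y Z
  assume YZ: "con F \<pi> Y" "con F \<pi> Z" "Y \<inter> Z \<noteq> {}"
  show "con F \<pi> (Y \<union> Z)"
    unfolding con_def
  proof (intro allI impI)
    fix c assume "splits c (Y \<union> Z)"
    with YZ(3) have "splits c Y \<or> splits c Z" by (rule splits_Un[rotated])
    with YZ(1,2) show "\<exists>f\<in>F. \<pi> f \<subseteq> Y \<union> Z \<and> splits c (\<pi> f)"
      unfolding con_def by (meson le_supI1 le_supI2)
  qed
qed (auto simp: con_def splits_def)

lemma cluster_acon: "cluster (acon N F \<pi>)"
  unfolding cluster_def
proof (intro conjI allI impI)
  fix Y Z
  assume YZ: "acon N F \<pi> Y" "acon N F \<pi> Z" "Y \<inter> Z \<noteq> {}"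
  show "acon N F \<pi> (Y \<union> Z)"
    unfolding acon_def
  proof (intro allI impI)
    fix c assume "splits c (Y \<union> Z)"
    with YZ(3) have "splits c Y \<or> splits c Z" by (rule splits_Un[rotated])
    then obtain W where W: "W = Y \<or> W = Z" "splits c W" by blast
    with YZ(1,2) obtain f where "f \<in> F" "\<pi> f \<subseteq> W" "\<not> splits c (\<pi> f)" "splits c (N f \<inter> W)"
      unfolding acon_def by metis
    with W(1) show "\<exists>f\<in>F. \<pi> f \<subseteq> Y \<union> Z \<and> \<not> splits c (\<pi> f) \<and> splits c (N f \<inter> (Y \<union> Z))"
      by (metis (no_types, lifting) Int_mono order_refl le_supI1 le_supI2 splits_mono sup_ge1 sup_ge2)
  qed
qed (auto simp: acon_def splits_def)

definition clusters :: "('v set \<Rightarrow> bool) \<Rightarrow> 'v set \<Rightarrow> 'v set set" where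
  "clusters C X = {Y. Y \<subseteq> X \<and> Y \<noteq> {} \<and> C Y \<and> (\<forall>Z. Y \<subseteq> Z \<and> Z \<subseteq> X \<and> C Z \<longrightarrow> Z = Y)}"

lemma clusters_cong: "(\<And>Y. Y \<subseteq> X \<Longrightarrow> C Y = D Y) \<Longrightarrow> clusters C X = clusters D X"
  unfolding clusters_def by blast

lemma clustersD: "Y \<in> clusters C X \<Longrightarrow> Y \<subseteq> X \<and> Y \<noteq> {} \<and> C Y"
  by (auto simp: clusters_def)

text \<open>The union of \<open>Y\<close> and \<open>S\<close> is again a cluster inside
  \<open>X\<close>, and \<open>Y\<close> is maximal.\<close>

lemma clusters_absorb:
  assumes "cluster C" "Y \<in> clusters C X" "C S" "S \<subseteq> X" "S \<inter> Y \<noteq> {}"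
  shows "S \<subseteq> Y"
proof -
  have "C (Y \<union> S)"
    using assms clustersD[OF assms(2)] unfolding cluster_def by blast
  with assms(2,4) have "Y \<union> S = Y"
    unfolding clusters_def by blast
  then show ?thesis by blast
qed

lemma clusters_disjoint: "cluster C \<Longrightarrow> Y \<in> clusters C X \<Longrightarrow> Z \<in> clusters C X \<Longrightarrow> Y \<inter> Z \<noteq> {} \<Longrightarrow> Y = Z"
  using clusters_absorb[of C Y X Z] clusters_absorb[of C Z X Y] clustersD[of Y C X] clustersD[of Z C X] by blast

lemma clusters_above:
  assumes "finite X" "C S" "S \<subseteq> X" "S \<noteq> {}"
  shows "\<exists>Y\<in>clusters C X. S \<subseteq> Y"
proof -
  define A where "A = {Z. S \<subseteq> Z \<and> Z \<subseteq> X \<and> C Z}"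
  have "A \<subseteq> Pow X" by (auto simp: A_def)
  then have "finite A" using assms(1) by (meson finite_Pow_iff finite_subset)
  moreover have "S \<in> A" using assms(2,3) by (simp add: A_def)
  ultimately obtain M where M: "M \<in> A" "S \<subseteq> M" and max: "\<forall>b\<in>A. M \<subseteq> b \<longrightarrow> M = b"
    by (metis (no_types) finite_has_maximal2)
  have "Z = M" if "M \<subseteq> Z" "Z \<subseteq> X" "C Z" for Z
  proof -
    have "Z \<in> A" using that M(2) by (simp add: A_def)
    with max that(1) show ?thesis by blast
  qed
  moreover have "M \<noteq> {}" using M(2) assms(4) by blast
  ultimately have "M \<in> clusters C X" using M unfolding clusters_def A_def by simp
  with M(2) show ?thesis by (rule rev_bexI[rotated])
qed

text \<open>Singletons being clusters gives the covering, closure under overlapping unions gives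
  disjointness.\<close>

lemma clusters_partition:
  assumes "cluster C" "finite X"
  shows "partition_on X (clusters C X)"
proof (rule partition_onI)
  have "\<exists>Y\<in>clusters C X. x \<in> Y" if x: "x \<in> X" for x
  proof -
    have "C {x}" using assms(1) by (simp add: cluster_def)
    with clusters_above[of X C "{x}"] assms(2) x show ?thesis by simp
  qed
  then show "\<Union> (clusters C X) = X" by (auto dest: clustersD)
  show "disjnt Y Z" if "Y \<in> clusters C X" "Z \<in> clusters C X" "Y \<noteq> Z" for Y Z
    using that clusters_disjoint[OF assms(1)] by (auto simp: disjnt_def)
qed (auto dest: clustersD)

lemma clusters_eq_singleton:
  assumes "C X" "X \<noteq> {}"
  shows "clusters C X = {X}"
  using assms by (auto simp: clusters_def)

section \<open>Refining a partition by the maximal clusters of its classes\<close>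

definition step :: "('v set \<Rightarrow> bool) \<Rightarrow> 'v set set \<Rightarrow> 'v set set" where
  "step C P = (\<Union>X\<in>P. clusters C X)"

definition in_class :: "'v set set \<Rightarrow> 'v set \<Rightarrow> bool" where
  "in_class P S \<longleftrightarrow> (\<exists>X\<in>P. S \<subseteq> X)"

lemma in_class_mono: "in_class P T \<Longrightarrow> S \<subseteq> T \<Longrightarrow> in_class P S"
  by (auto simp: in_class_def)

lemma partition_on_unique:
  "partition_on V P \<Longrightarrow> X \<in> P \<Longrightarrow> Y \<in> P \<Longrightarrow> X \<inter> Y \<noteq> {} \<Longrightarrow> X = Y"
  by (auto simp: partition_on_def disjoint_def)

lemma partition_on_subset: "partition_on V P \<Longrightarrow> X \<in> P \<Longrightarrow> X \<subseteq> V"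
  by (auto simp: partition_on_def)

lemma stepD: "Y \<in> step C P \<Longrightarrow> Y \<noteq> {} \<and> C Y"
  unfolding step_def using clustersD by blast

lemma step_partition:
  assumes "cluster C" "finite V" "partition_on V P"
  shows "partition_on V (step C P)"
proof (rule partition_onI)
  have part: "partition_on X (clusters C X)" if "X \<in> P" for X
    by (rule clusters_partition[OF assms(1)], rule finite_subset[OF _ assms(2)])
      (rule partition_on_subset[OF assms(3) that])
  show "\<Union> (step C P) = V"
  proof -
    have "\<Union> (step C P) = (\<Union>X\<in>P. \<Union> (clusters C X))" unfolding step_def by blast
    also have "\<dots> = (\<Union>X\<in>P. X)" using part by (simp add: partition_on_def)
    finally show ?thesis using assms(3) by (simp add: partition_on_def)
  qed
  show "disjnt Y Z" if "Y \<in> step C P" "Z \<in> step C P" "Y \<noteq> Z" for Y Z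
  proof (rule ccontr)
    assume "\<not> disjnt Y Z"
    then have ne: "Y \<inter> Z \<noteq> {}" by (simp add: disjnt_def)
    from that obtain X X' where X: "X \<in> P" "Y \<in> clusters C X" "X' \<in> P" "Z \<in> clusters C X'"
      unfolding step_def by blast
    with ne have "X \<inter> X' \<noteq> {}" by (blast dest: clustersD)
    with X assms(3) have "X = X'" using partition_on_unique by blast
    with X ne have "Y = Z" using clusters_disjoint[OF assms(1)] by blast
    with that show False by blast
  qed
  show "{} \<notin> step C P" using stepD by blast
qed

lemma step_refines:
  assumes "cluster C" "finite V" "partition_on V P"
  shows "refines V (step C P) P"
  unfolding refines_def using step_partition[OF assms] assms(3)
  by (auto simp: step_def dest: clustersD)

lemma step_absorb:
  assumes "cluster C" "partition_on V P" "Y \<in> step C P" "C S" "in_class P S" "S \<inter> Y \<noteq> {}"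
  shows "S \<subseteq> Y"
proof -
  from assms(3) obtain X where X: "X \<in> P" "Y \<in> clusters C X" unfolding step_def by blast
  from assms(5) obtain X' where X': "X' \<in> P" "S \<subseteq> X'" unfolding in_class_def by blast
  from X X' assms(6) have "X \<inter> X' \<noteq> {}" by (blast dest: clustersD)
  with X X' assms(2) have "X = X'" using partition_on_unique by blast
  with X X' assms show ?thesis using clusters_absorb[of C Y X S] by blast
qed

lemma step_in_class:
  assumes "finite V" "partition_on V P" "C S" "in_class P S"
  shows "S = {} \<or> in_class (step C P) S"
proof -
  from assms(4) obtain X where X: "X \<in> P" "S \<subseteq> X" unfolding in_class_def by blast
  then have "finite X" using assms(1) partition_on_subset[OF assms(2)] by (meson finite_subset)
  with X assms(3) have "S = {} \<or> (\<exists>Y\<in>clusters C X. S \<subseteq> Y)" using clusters_above by blast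
  with X(1) show ?thesis
    unfolding in_class_def step_def by blast
qed

text \<open>The monotonicity behind the comparison of two quasigraphs. Only the sets that
  \<open>step C\<close> actually produces are tested for \<open>D\<close>; \<open>C\<close> may fail
  to imply \<open>D\<close> elsewhere.\<close>

lemma step_coarser:
  assumes "cluster C" "cluster D" "finite V" "partition_on V P" "\<And>Y. Y \<in> step C P \<Longrightarrow> D Y"
  shows "refines V (step C P) (step D P)"
  unfolding refines_def
proof (intro conjI ballI)
  fix Y assume Y: "Y \<in> step C P"
  then have "in_class P Y" unfolding step_def in_class_def by (blast dest: clustersD)
  moreover have "Y \<noteq> {}" "D Y" using Y assms(5) stepD by blast+
  ultimately have "in_class (step D P) Y" using step_in_class[OF assms(3,4)] by blast
  then show "\<exists>X\<in>step D P. Y \<subseteq> X" by (simp add: in_class_def)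
qed (use assms step_partition in blast)+

lemma step_eq_self:
  assumes "partition_on V P" "\<And>X. X \<in> P \<Longrightarrow> C X"
  shows "step C P = P"
proof -
  have "clusters C X = {X}" if "X \<in> P" for X
    using assms that by (metis clusters_eq_singleton partition_onD3)
  then show ?thesis by (auto simp: step_def)
qed

section \<open>Connectedness and components in terms of colourings\<close>

lemma two_le_card_iff: "finite S \<Longrightarrow> 2 \<le> card S \<longleftrightarrow> (\<exists>a\<in>S. \<exists>b\<in>S. a \<noteq> b)"
proof -
  assume "finite S"
  then have "\<not> card S \<le> Suc 0 \<longleftrightarrow> (\<exists>a\<in>S. \<exists>b\<in>S. a \<noteq> b)"
    by (subst card_le_Suc0_iff_eq) blast+
  moreover have "2 \<le> card S \<longleftrightarrow> \<not> card S \<le> Suc 0" by linarith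
  ultimately show ?thesis by simp
qed

lemma crossing_iff:
  assumes "finite R"
  shows "crossing R S \<longleftrightarrow> (\<exists>A\<in>R. \<exists>B\<in>R. A \<noteq> B \<and> A \<inter> S \<noteq> {} \<and> B \<inter> S \<noteq> {})"
proof -
  have "finite (quot R S)" using assms by (simp add: quot_def)
  then have "crossing R S \<longleftrightarrow> (\<exists>A\<in>quot R S. \<exists>B\<in>quot R S. A \<noteq> B)"
    unfolding crossing_def by (rule two_le_card_iff)
  then show ?thesis unfolding quot_def by blast
qed

text \<open>The colour classes on \<open>Y\<close> form a partition, with at least two members when
  \<open>Y\<close> is split; anticonnectedness is applied to it.\<close>

lemma anticonnected_imp_acon:
  assumes fin: "finite Y" and anti: "anticonnected_on H \<pi> Y"
  shows "acon (ends H) (hedges H) \<pi> Y"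
  unfolding acon_def
proof (intro allI impI)
  fix c assume c: "splits c Y"
  define R where "R = (\<lambda>x. {y \<in> Y. c y = c x}) ` Y"
  have memR: "\<exists>x\<in>Y. A = {y \<in> Y. c y = c x}" if "A \<in> R" for A
    using that unfolding R_def by blast
  have part: "partition_on Y R"
  proof (rule partition_onI)
    show "\<Union> R = Y" unfolding R_def by blast
    show "{} \<notin> R" unfolding R_def by blast
    fix A B assume AB: "A \<in> R" "B \<in> R" "A \<noteq> B"
    obtain a b where ab: "A = {y \<in> Y. c y = c a}" "B = {y \<in> Y. c y = c b}"
      using memR[OF AB(1)] memR[OF AB(2)] by blast
    with AB(3) have "c a \<noteq> c b" by auto
    with ab show "disjnt A B" by (auto simp: disjnt_def)
  qed
  have finR: "finite R" using fin by (simp add: R_def)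
  from c obtain x y where xy: "x \<in> Y" "y \<in> Y" "c x \<noteq> c y" unfolding splits_def by blast
  then have "{z \<in> Y. c z = c x} \<in> R" "{z \<in> Y. c z = c y} \<in> R"
    unfolding R_def by (auto intro!: imageI)
  moreover have "{z \<in> Y. c z = c x} \<noteq> {z \<in> Y. c z = c y}"
    using xy by auto
  ultimately have "\<exists>A\<in>R. \<exists>B\<in>R. A \<noteq> B" by (meson bexI)
  then have "2 \<le> card R" unfolding two_le_card_iff[OF finR] .
  with anti part obtain f C where f: "f \<in> hedges H" "crossing R (ends H f)" "C \<in> R" "\<pi> f \<subseteq> C"
    unfolding anticonnected_on_def by blast
  from f(2) obtain A B where AB: "A \<in> R" "B \<in> R" "A \<noteq> B" "A \<inter> ends H f \<noteq> {}" "B \<inter> ends H f \<noteq> {}"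
    unfolding crossing_iff[OF finR] by blast
  obtain a b where ab: "A = {y \<in> Y. c y = c a}" "B = {y \<in> Y. c y = c b}"
    using memR[OF AB(1)] memR[OF AB(2)] by blast
  from AB(4,5) obtain p q where pq: "p \<in> A" "p \<in> ends H f" "q \<in> B" "q \<in> ends H f" by blast
  have "c a \<noteq> c b" using AB(3) ab by auto
  moreover have "p \<in> Y" "c p = c a" using pq(1) unfolding ab(1) by simp_all
  moreover have "q \<in> Y" "c q = c b" using pq(3) unfolding ab(2) by simp_all
  ultimately have "splits c (ends H f \<inter> Y)"
    unfolding splits_def using pq(2,4) by (metis IntI)
  moreover obtain d where "C = {y \<in> Y. c y = c d}" using memR[OF f(3)] by blast
  with f(4) have "\<pi> f \<subseteq> Y" "\<not> splits c (\<pi> f)"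
    by (auto simp: splits_def)
  ultimately show "\<exists>f\<in>hedges H. \<pi> f \<subseteq> Y \<and> \<not> splits c (\<pi> f) \<and> splits c (ends H f \<inter> Y)"
    using f(1) by blast
qed

lemma acon_imp_anticonnected:
  assumes fin: "finite Y" and ac: "acon (ends H) (hedges H) \<pi> Y"
  shows "anticonnected_on H \<pi> Y"
  unfolding anticonnected_on_def
proof (intro allI impI, elim conjE)
  fix R assume R: "partition_on Y R" "2 \<le> card R"
  have finR: "finite R" using R fin finite_elements by blast
  \<comment> \<open>Each vertex is coloured by its class, which is why colours are sets of vertices.
    The union picks out the single class containing \<open>x\<close>.\<close>
  define c where "c x = \<Union> {C \<in> R. x \<in> C}" for x
  have cC: "c x = C" if "C \<in> R" "x \<in> C" for x C
  proof -
    have "D = C" if "D \<in> R" "x \<in> D" for D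
      using partition_on_unique[OF R(1) that(1) \<open>C \<in> R\<close>] that(2) \<open>x \<in> C\<close> by blast
    then have "{D \<in> R. x \<in> D} = {C}" using that by blast
    then show ?thesis by (simp add: c_def)
  qed
  have cR: "c x \<in> R \<and> x \<in> c x" if x: "x \<in> Y" for x
  proof -
    from x R(1) obtain C where C: "C \<in> R" "x \<in> C" by (auto simp: partition_on_def)
    then show ?thesis using cC[OF C] by simp
  qed
  have "splits c Y"
  proof -
    from R(2) obtain A B where AB: "A \<in> R" "B \<in> R" "A \<noteq> B"
      unfolding two_le_card_iff[OF finR] by blast
    have "A \<noteq> {}" "B \<noteq> {}" using AB partition_onD3[OF R(1)] by auto
    then obtain a b where ab: "a \<in> A" "b \<in> B" by blast
    have "c a \<noteq> c b" using AB ab cC[of A a] cC[of B b] by simp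
    then show ?thesis
      unfolding splits_def using ab AB partition_on_subset[OF R(1)] by blast
  qed
  with ac obtain f where f: "f \<in> hedges H" "\<pi> f \<subseteq> Y" "\<not> splits c (\<pi> f)" "splits c (ends H f \<inter> Y)"
    unfolding acon_def by blast
  from f(4) obtain x y where xy: "x \<in> ends H f" "x \<in> Y" "y \<in> ends H f" "y \<in> Y" "c x \<noteq> c y"
    unfolding splits_def by blast
  have cr: "crossing R (ends H f)"
    unfolding crossing_iff[OF finR] using xy cR[OF xy(2)] cR[OF xy(4)] by blast
  have "\<exists>C\<in>R. \<pi> f \<subseteq> C"
  proof (cases "\<pi> f = {}")
    case True
    from R(2) have "R \<noteq> {}" by auto
    with True show ?thesis by blast
  next
    case False
    then obtain x where x: "x \<in> \<pi> f" by blast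
    have "z \<in> c x" if z: "z \<in> \<pi> f" for z
    proof -
      have "c z = c x" using f(3) x z unfolding splits_def by blast
      moreover have "z \<in> c z" using cR f(2) z by blast
      ultimately show ?thesis by simp
    qed
    moreover have "c x \<in> R" using cR f(2) x by blast
    ultimately show ?thesis by blast
  qed
  with f(1) cr show "\<exists>f\<in>hedges H. crossing R (ends H f) \<and> (\<exists>C\<in>R. \<pi> f \<subseteq> C)" by blast
qed

lemma anticonnected_on_iff:
  "finite Y \<Longrightarrow> anticonnected_on H \<pi> Y \<longleftrightarrow> acon (ends H) (hedges H) \<pi> Y"
  using anticonnected_imp_acon acon_imp_anticonnected by blast

definition component :: "('v, 'e) hypergraph \<Rightarrow> ('e \<Rightarrow> 'v set) \<Rightarrow> 'v set \<Rightarrow> 'v \<Rightarrow> 'v set" where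
  "component H \<pi> X u = {v \<in> X. (u, v) \<in> (adjacency (induced (multigraph_of H \<pi>) X))\<^sup>*}"

lemma adjacency_induced:
  assumes "quasigraph H \<pi>"
  shows "(u, v) \<in> adjacency (induced (multigraph_of H \<pi>) X) \<longleftrightarrow>
    (\<exists>f\<in>hedges H. \<pi> f = {u, v} \<and> u \<noteq> v \<and> u \<in> X \<and> v \<in> X)"
  using assms unfolding adjacency_def induced_def multigraph_of_def used_hedges_def quasigraph_def
  by (fastforce simp: card_2_iff doubleton_eq_iff)

lemma quasigraph_pair:
  assumes "quasigraph H \<pi>" "f \<in> hedges H" "x \<in> \<pi> f" "y \<in> \<pi> f" "x \<noteq> y"
  shows "\<pi> f = {x, y}"
proof -
  from assms(1-3) have "card (\<pi> f) = 2" unfolding quasigraph_def by blast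
  then obtain a b where "\<pi> f = {a, b}" by (auto simp: card_2_iff)
  with assms(3-5) show ?thesis by auto
qed

lemma component_in_clusters:
  assumes qg: "quasigraph H \<pi>" and u: "u \<in> X"
  shows "component H \<pi> X u \<in> clusters (con (hedges H) \<pi>) X"
proof -
  let ?A = "adjacency (induced (multigraph_of H \<pi>) X)"
  let ?Y = "component H \<pi> X u"
  have uY: "u \<in> ?Y" using u by (simp add: component_def)
  have con: "con (hedges H) \<pi> ?Y"
    unfolding con_def
  proof (intro allI impI, rule ccontr)
    fix c assume c: "splits c ?Y" and neg: "\<not> (\<exists>f\<in>hedges H. \<pi> f \<subseteq> ?Y \<and> splits c (\<pi> f))"
    \<comment> \<open>The colour of \<open>u\<close> spreads along every walk, since each edge on it
      lies inside the component and so is monochromatic.\<close>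
    have "c v = c u" if "(u, v) \<in> ?A\<^sup>*" for v
      using that
    proof (induction rule: rtrancl_induct)
      case (step y z)
      from step(2) obtain f where f: "f \<in> hedges H" "\<pi> f = {y, z}" "y \<in> X" "z \<in> X"
        unfolding adjacency_induced[OF qg] by blast
      from step(1,2) f have "\<pi> f \<subseteq> ?Y"
        by (auto simp: component_def)
      with neg f have "c y = c z" by (auto simp: splits_def)
      with step show ?case by simp
    qed simp
    with c show False unfolding splits_def component_def by (metis (mono_tags, lifting) mem_Collect_eq)
  qed
  have max: "Z = ?Y" if Z: "?Y \<subseteq> Z" "Z \<subseteq> X" "con (hedges H) \<pi> Z" for Z
  proof (rule ccontr)
    assume "Z \<noteq> ?Y"
    with Z obtain z where z: "z \<in> Z" "z \<notin> ?Y" by blast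
    \<comment> \<open>Two colours tell the component from the rest; a pair showing both would be an
      edge leaving the component.\<close>
    define c :: "'a \<Rightarrow> 'a set" where "c v = (if v \<in> ?Y then {} else UNIV)" for v
    have "splits c Z" using z uY Z(1) unfolding splits_def c_def by auto
    with Z(3) obtain f where f: "f \<in> hedges H" "\<pi> f \<subseteq> Z" "splits c (\<pi> f)"
      unfolding con_def by blast
    from f(3) obtain x y where xy: "x \<in> \<pi> f" "y \<in> \<pi> f" "x \<in> ?Y" "y \<notin> ?Y"
      unfolding splits_def c_def by (auto split: if_splits)
    then have "\<pi> f = {x, y}"
      by (intro quasigraph_pair[OF qg f(1)]) auto
    with f xy Z(2) have "(x, y) \<in> ?A" unfolding adjacency_induced[OF qg] by blast
    with xy f Z(2) show False unfolding component_def by (auto intro: rtrancl_into_rtrancl)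
  qed
  show ?thesis
    unfolding clusters_def using con max uY by (auto simp: component_def)
qed

lemma components_on_eq_clusters:
  assumes qg: "quasigraph H \<pi>"
  shows "components_on H \<pi> X = clusters (con (hedges H) \<pi>) X"
proof -
  have eq: "components_on H \<pi> X = component H \<pi> X ` X"
    unfolding components_on_def multigraph_components_def component_def
    by (auto simp: induced_def)
  show ?thesis
  proof
    show "components_on H \<pi> X \<subseteq> clusters (con (hedges H) \<pi>) X"
      unfolding eq using component_in_clusters[OF qg] by blast
    show "clusters (con (hedges H) \<pi>) X \<subseteq> components_on H \<pi> X"
    proof
      fix Y assume Y: "Y \<in> clusters (con (hedges H) \<pi>) X"
      then obtain u where u: "u \<in> Y" "u \<in> X" by (auto dest: clustersD)
      then have "u \<in> component H \<pi> X u" by (simp add: component_def)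
      with u Y component_in_clusters[OF qg u(2)] have "Y = component H \<pi> X u"
        using clusters_disjoint[OF cluster_con] by (metis IntI empty_iff)
      with u eq show "Y \<in> components_on H \<pi> X" by blast
    qed
  qed
qed

lemma connected_on_iff:
  assumes qg: "quasigraph H \<pi>"
  shows "connected_on H \<pi> X \<longleftrightarrow> con (hedges H) \<pi> X"
proof -
  have "connected_on H \<pi> X \<longleftrightarrow> (\<forall>u\<in>X. component H \<pi> X u = X)"
    unfolding connected_on_def connected_multigraph_def component_def
    by (auto simp: induced_def)
  also have "\<dots> \<longleftrightarrow> con (hedges H) \<pi> X"
  proof
    assume "con (hedges H) \<pi> X"
    then show "\<forall>u\<in>X. component H \<pi> X u = X"
      using component_in_clusters[OF qg] clusters_eq_singleton by (metis empty_iff singletonD)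
  next
    assume *: "\<forall>u\<in>X. component H \<pi> X u = X"
    have "X = {} \<or> X \<in> clusters (con (hedges H) \<pi>) X"
    proof (cases "X = {}")
      case False
      then obtain u where u: "u \<in> X" by blast
      with * component_in_clusters[OF qg u] show ?thesis by simp
    qed simp
    then show "con (hedges H) \<pi> X"
      by (auto simp: con_def dest: clustersD)
  qed
  finally show ?thesis .
qed

lemma con_delete: "con F (\<pi>(f := {})) Y \<longleftrightarrow> con (F - {f}) \<pi> Y"
  unfolding con_def by (metis DiffE DiffI empty_iff fun_upd_other fun_upd_same insertE insertI1 splits_empty)

lemma quasigraph_delete: "quasigraph H \<pi> \<Longrightarrow> quasigraph H (\<pi>(f := {}))"
  by (auto simp: quasigraph_def)

lemma anticomponents_on_eq_clusters:
  assumes "finite X"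
  shows "anticomponents_on H \<pi> X = clusters (acon (ends H) (hedges H) \<pi>) X"
proof -
  have "anticomponents_on H \<pi> X = clusters (anticonnected_on H \<pi>) X"
    by (simp add: anticomponents_on_def clusters_def)
  also have "\<dots> = clusters (acon (ends H) (hedges H) \<pi>) X"
    by (rule clusters_cong) (metis assms anticonnected_on_iff finite_subset)
  finally show ?thesis .
qed

lemma delete_hedge_simps [simp]:
  "hedges (delete_hedge H e) = hedges H - {e}" "ends (delete_hedge H e) = ends H"
  by (simp_all add: delete_hedge_def)

text \<open>Without one edge the cycle is still a path through all its vertices, so a colouring
  constant on the remaining edges is constant. When \<open>e\<close> is not on the cycle, an
  arbitrary edge is left out instead.\<close>

lemma cycle_con:
  assumes cyc: "is_cycle G vs es"
  shows "con (set es - {e}) (ends G) (set vs)"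
  unfolding con_def
proof (intro allI impI, rule ccontr)
  fix c assume c: "splits c (set vs)"
    and neg: "\<not> (\<exists>f\<in>set es - {e}. ends G f \<subseteq> set vs \<and> splits c (ends G f))"
  let ?n = "length vs"
  from cyc have n: "2 \<le> ?n" "length es = ?n" "distinct es"
    and ee: "\<And>i. i < ?n \<Longrightarrow> ends G (es ! i) = {vs ! i, vs ! (Suc i mod ?n)}"
    by (auto simp: is_cycle_def)
  obtain k where k: "k < ?n" "\<And>i. i < ?n \<Longrightarrow> i \<noteq> k \<Longrightarrow> es ! i \<noteq> e"
  proof (cases "e \<in> set es")
    case True
    then obtain k where "k < ?n" "es ! k = e" using n by (metis in_set_conv_nth)
    with n that show ?thesis by (metis nth_eq_iff_index_eq)
  next
    case False
    with n that[of 0] show ?thesis by (metis nth_mem zero_less_numeral order_less_le_trans)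
  qed
  have edge: "c (vs ! i) = c (vs ! (Suc i mod ?n))" if i: "i < ?n" "i \<noteq> k" for i
  proof -
    have "Suc i mod ?n < ?n" using n by (intro mod_less_divisor) linarith
    then have "ends G (es ! i) \<subseteq> set vs" using ee[OF i(1)] i(1) by simp
    moreover have "es ! i \<in> set es - {e}" using k(2)[OF i] i n by simp
    ultimately have "\<not> splits c (ends G (es ! i))" using neg by blast
    then show ?thesis using ee[OF i(1)] by (auto simp: splits_def)
  qed
  have walk: "c (vs ! ((Suc k + m) mod ?n)) = c (vs ! (Suc k mod ?n))" if "m < ?n" for m
    using that
  proof (induction m)
    case (Suc m)
    \<comment> \<open>The walk starts just after the missing edge and takes fewer than
      \<open>?n\<close> steps, so it never traverses position \<open>k\<close>.\<close>
    have "(Suc k + m) mod ?n \<noteq> k"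
    proof -
      have "(Suc k + m) mod ?n = (if Suc k + m < ?n then Suc k + m else Suc k + m - ?n)"
        using k(1) Suc.prems by (simp add: mod_if)
      then show ?thesis using k(1) Suc.prems by (cases "Suc k + m < ?n") auto
    qed
    moreover have "(Suc k + m) mod ?n < ?n" using n by (intro mod_less_divisor) linarith
    ultimately have "c (vs ! ((Suc k + m) mod ?n)) = c (vs ! (Suc ((Suc k + m) mod ?n) mod ?n))"
      using edge by blast
    with Suc show ?case by (simp add: mod_Suc_eq)
  qed simp
  have "c (vs ! j) = c (vs ! (Suc k mod ?n))" if j: "j < ?n" for j
  proof -
    \<comment> \<open>The number of steps from \<open>Suc k\<close> to \<open>j\<close>; adding
      \<open>?n\<close> first keeps the subtraction of natural numbers from truncating.\<close>
    let ?m = "(j + ?n - Suc k) mod ?n"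
    have "?m < ?n" using n by (intro mod_less_divisor) linarith
    moreover have "(Suc k + ?m) mod ?n = j"
    proof -
      have "(Suc k + ?m) mod ?n = (Suc k + (j + ?n - Suc k)) mod ?n" by (rule mod_add_right_eq)
      also have "Suc k + (j + ?n - Suc k) = j + ?n" using k(1) by simp
      also have "(j + ?n) mod ?n = j" using j by simp
      finally show ?thesis .
    qed
    ultimately show ?thesis using walk by metis
  qed
  with c show False unfolding splits_def by (metis in_set_conv_nth)
qed

section \<open>Structure of the plane sequence\<close>

text \<open>A potential for refinement: a proper refinement loses at least one ordered pair of
  vertices with a common class.\<close>

definition mass :: "'v set set \<Rightarrow> nat" where
  "mass P = card {(x, y). \<exists>C\<in>P. x \<in> C \<and> y \<in> C}"

lemma mass_less:
  assumes fin: "finite V" and PQ: "refines V P Q" "P \<noteq> Q"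
  shows "mass P < mass Q"
proof -
  let ?r = "\<lambda>P. {(x, y). \<exists>C\<in>P. x \<in> C \<and> y \<in> C}"
  have part: "partition_on V P" "partition_on V Q" using PQ(1) by (auto simp: refines_def)
  have "?r Q \<subseteq> V \<times> V" using partition_on_subset[OF part(2)] by blast
  then have "finite (?r Q)" by (rule finite_subset) (use fin in simp)
  moreover have "?r P \<subseteq> ?r Q"
  proof clarify
    fix x y X assume "X \<in> P" "x \<in> X" "y \<in> X"
    moreover from this obtain Y where "Y \<in> Q" "X \<subseteq> Y" using PQ(1) unfolding refines_def by blast
    ultimately show "\<exists>C\<in>Q. x \<in> C \<and> y \<in> C" by blast
  qed
  moreover have "?r P \<noteq> ?r Q"
  proof
    assume eq: "?r P = ?r Q"
    have "\<exists>X\<in>P. Y \<subseteq> X" if Y: "Y \<in> Q" for Y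
    proof -
      have "Y \<noteq> {}" using partition_onD3[OF part(2)] Y by blast
      then obtain y where y: "y \<in> Y" by blast
      then have "y \<in> V" using Y partition_on_subset[OF part(2)] by blast
      then obtain X where X: "X \<in> P" "y \<in> X" using part(1) unfolding partition_on_def by blast
      have "z \<in> X" if z: "z \<in> Y" for z
      proof -
        have "(y, z) \<in> ?r Q" using Y y z by blast
        then have "(y, z) \<in> ?r P" using eq by simp
        then obtain X' where X': "X' \<in> P" "y \<in> X'" "z \<in> X'" by blast
        have "X' = X" using partition_on_unique[OF part(1) X'(1) X(1)] X'(2) X(2) by blast
        with X' show ?thesis by simp
      qed
      with X(1) show ?thesis by blast
    qed
    then have "refines V Q P" using part unfolding refines_def by blast
    with PQ show False using refines_asym by blast
  qed
  ultimately show ?thesis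
    unfolding mass_def by (intro psubset_card_mono psubsetI)
qed

lemma refining_sequence_stabilises:
  assumes fin: "finite V" and ref: "\<And>n. refines V (f (Suc n)) (f n)"
  shows "\<exists>N. \<forall>n\<ge>N. f n = f N"
proof -
  \<comment> \<open>An index of least potential: a later change of the partition would lower it
    further.\<close>
  obtain N where N: "\<And>n. mass (f N) \<le> mass (f n)"
    using ex_has_least_nat[of "\<lambda>_. True" 0 "\<lambda>n. mass (f n)"] by auto
  have "f n = f N" if "n \<ge> N" for n
    using that
  proof (induction n rule: dec_induct)
    case (step n)
    show ?case
    proof (rule ccontr)
      assume "f (Suc n) \<noteq> f N"
      with step have "f (Suc n) \<noteq> f n" by simp
      then have "mass (f (Suc n)) < mass (f n)" using mass_less[OF fin ref] by blast
      with N[of "Suc n"] step show False by simp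
    qed
  qed simp
  then show ?thesis by blast
qed

lemma eventual_value_eq:
  assumes "\<And>n. n \<ge> N \<Longrightarrow> f n = x"
  shows "eventual_value f = x"
  unfolding eventual_value_def
proof (rule the_equality)
  show "\<exists>N. \<forall>n\<ge>N. f n = x" using assms by blast
  fix y assume "\<exists>M. \<forall>n\<ge>M. f n = y"
  then obtain M where "\<forall>n\<ge>M. f n = y" by blast
  then have "f (max M N) = y" by simp
  with assms[of "max M N"] show "y = x" by simp
qed

lemma cycle_edges_nonempty: "is_cycle G vs es \<Longrightarrow> es \<noteq> []"
  by (auto simp: is_cycle_def)

text \<open>The assumption \<open>nonempty\<close> makes the initial family \<open>{verts H}\<close>
  free of empty classes, hence a partition. The empty hypergraph is treated after the
  locale.\<close>

locale ordered_three_hypergraph =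
  fixes H :: "('v, 'e) hypergraph" and leE :: "'e rel" and leD :: "'e decision rel"
  assumes three: "three_hypergraph H"
    and leE: "linear_order_on (hedges H) leE"
    and leD: "decision_order H leE leD"
    and nonempty: "verts H \<noteq> {}"
begin

abbreviation V where "V \<equiv> verts H"
abbreviation E where "E \<equiv> hedges H"

lemma finV: "finite V" and finE: "finite E"
  using three by (simp_all add: three_hypergraph_def)

lemma ends_subset: "e \<in> E \<Longrightarrow> ends H e \<subseteq> V"
  and card_ends: "e \<in> E \<Longrightarrow> card (ends H e) = 2 \<or> card (ends H e) = 3"
  using three by (auto simp: three_hypergraph_def)

lemma fin_ends: "e \<in> E \<Longrightarrow> finite (ends H e)"
  using ends_subset finV finite_subset by blast

text \<open>The Boolean lets one argument treat both kinds of steps. In a row, the step from column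
  \<open>j\<close> to \<open>Suc j\<close> has kind \<open>even j\<close>, because odd columns hold
  components.\<close>

definition kcon :: "bool \<Rightarrow> 'e set \<Rightarrow> ('e \<Rightarrow> 'v set) \<Rightarrow> 'v set \<Rightarrow> bool" where
  "kcon b F \<pi> = (if b then con F \<pi> else acon (ends H) F \<pi>)"

lemma cluster_kcon: "cluster (kcon b F \<pi>)"
  by (simp add: kcon_def cluster_con cluster_acon)

lemma kcon_mono: "kcon b F \<pi> Y \<Longrightarrow> F \<subseteq> F' \<Longrightarrow> kcon b F' \<pi> Y"
  by (auto simp: kcon_def intro: con_mono acon_mono split: if_splits)

lemma components_step:
  "quasigraph H \<pi> \<Longrightarrow> (\<Union>X\<in>P. components_on H \<pi> X) = step (con E \<pi>) P"
  by (simp add: components_on_eq_clusters step_def)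

lemma anticomponents_step:
  assumes "partition_on V P"
  shows "(\<Union>X\<in>P. anticomponents_on H \<pi> X) = step (acon (ends H) E \<pi>) P"
    and "(\<Union>X\<in>P. anticomponents_on (delete_hedge H e) \<pi> X) = step (acon (ends H) (E - {e}) \<pi>) P"
proof -
  have fin: "finite X" if "X \<in> P" for X
    using finite_subset[OF partition_on_subset[OF assms that] finV] .
  show "(\<Union>X\<in>P. anticomponents_on H \<pi> X) = step (acon (ends H) E \<pi>) P"
    using fin by (simp add: anticomponents_on_eq_clusters step_def)
  show "(\<Union>X\<in>P. anticomponents_on (delete_hedge H e) \<pi> X) = step (acon (ends H) (E - {e}) \<pi>) P"
    using fin by (simp add: anticomponents_on_eq_clusters step_def)
qed

section \<open>Rows of the plane sequence\<close>

lemma row_fin_step: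
  assumes "quasigraph H \<pi>" "partition_on V (row_fin H \<pi> P j)"
  shows "row_fin H \<pi> P (Suc j) = step (kcon (even j) E \<pi>) (row_fin H \<pi> P j)"
proof (cases "even j")
  case True
  then have "row_fin H \<pi> P (Suc j) = (\<Union>X\<in>row_fin H \<pi> P j. components_on H \<pi> X)" by simp
  then show ?thesis using True by (simp only: components_step[OF assms(1)] kcon_def simp_thms if_True)
next
  case False
  then have "row_fin H \<pi> P (Suc j) = (\<Union>X\<in>row_fin H \<pi> P j. anticomponents_on H \<pi> X)" by simp
  then show ?thesis using False by (simp only: anticomponents_step(1)[OF assms(2)] kcon_def simp_thms if_False)
qed

lemma row_fin_partition:
  assumes "quasigraph H \<pi>" "partition_on V P"
  shows "partition_on V (row_fin H \<pi> P j)"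
proof (induction j)
  case (Suc j)
  then show ?case
    using row_fin_step[OF assms(1) Suc] step_partition[OF cluster_kcon finV Suc] by simp
qed (use assms in simp)

lemma row_fin_refines:
  assumes "quasigraph H \<pi>" "partition_on V P"
  shows "refines V (row_fin H \<pi> P (Suc j)) (row_fin H \<pi> P j)"
  using row_fin_step[OF assms(1) row_fin_partition[OF assms]]
    step_refines[OF cluster_kcon finV row_fin_partition[OF assms]] by simp

lemma row_fin_antimono:
  assumes "quasigraph H \<pi>" "partition_on V P" "j \<le> k"
  shows "refines V (row_fin H \<pi> P k) (row_fin H \<pi> P j)"
  using assms(3)
proof (induction k rule: dec_induct)
  case base
  show ?case by (rule refines_refl[OF row_fin_partition[OF assms(1,2)]])
next
  case (step n)
  show ?case using refines_trans[OF row_fin_refines[OF assms(1,2)] step(3)] .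
qed

lemma row_inf:
  assumes "quasigraph H \<pi>" "partition_on V P"
  shows "\<exists>N. \<forall>n\<ge>N. row_fin H \<pi> P n = row H \<pi> P \<infinity>"
proof -
  obtain N where N: "\<And>n. n \<ge> N \<Longrightarrow> row_fin H \<pi> P n = row_fin H \<pi> P N"
    using refining_sequence_stabilises[OF finV, of "row_fin H \<pi> P"] row_fin_refines[OF assms] by blast
  have "eventual_value (row_fin H \<pi> P) = row_fin H \<pi> P N"
    using N by (rule eventual_value_eq[of N])
  then have eq: "row_fin H \<pi> P N = row H \<pi> P \<infinity>"
    by (simp add: row_def)
  show ?thesis
    by (intro exI[of _ N] allI impI) (rule trans[OF N eq])
qed

lemma row_enat [simp]: "row H \<pi> P (enat n) = row_fin H \<pi> P n"
  by (simp add: row_def)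

lemma row_0 [simp]: "row H \<pi> P 0 = P"
  by (simp add: row_def zero_enat_def)

lemma row_partition:
  assumes "quasigraph H \<pi>" "partition_on V P"
  shows "partition_on V (row H \<pi> P j)"
proof (cases j)
  case (enat n)
  then show ?thesis using row_fin_partition[OF assms] by simp
next
  case infinity
  obtain N where "row_fin H \<pi> P N = row H \<pi> P \<infinity>" using row_inf[OF assms] by blast
  then show ?thesis using row_fin_partition[OF assms, of N] infinity by simp
qed

lemma row_antimono:
  assumes "quasigraph H \<pi>" "partition_on V P" "j \<le> k"
  shows "refines V (row H \<pi> P k) (row H \<pi> P j)"
proof -
  obtain N where N: "\<And>n. n \<ge> N \<Longrightarrow> row_fin H \<pi> P n = row H \<pi> P \<infinity>" using row_inf[OF assms(1,2)] by blast
  show ?thesis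
  proof (cases k)
    case (enat m)
    then obtain n where "j = enat n" "n \<le> m" using assms(3) by (cases j) auto
    then show ?thesis using row_fin_antimono[OF assms(1,2)] enat by simp
  next
    case infinity
    show ?thesis
    proof (cases j)
      case (enat n)
      have "row H \<pi> P \<infinity> = row_fin H \<pi> P (max N n)" using N by simp
      moreover have "n \<le> max N n" by simp
      ultimately show ?thesis using row_fin_antimono[OF assms(1,2)] infinity enat by simp
    next
      case infinity
      then show ?thesis using \<open>k = \<infinity>\<close> refines_refl[OF row_partition[OF assms(1,2)]] by simp
    qed
  qed
qed

lemma row_inf_kcon:
  assumes "quasigraph H \<pi>" "partition_on V P" "X \<in> row H \<pi> P \<infinity>"
  shows "kcon b E \<pi> X"
proof -
  obtain N where N: "\<And>n. n \<ge> N \<Longrightarrow> row_fin H \<pi> P n = row H \<pi> P \<infinity>" using row_inf[OF assms(1,2)] by blast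
  \<comment> \<open>A column past stabilisation with the required parity: the step out of it has
    kind \<open>b\<close> and changes nothing.\<close>
  define n where "n = (if even N = b then N else Suc N)"
  have n: "n \<ge> N" "even n = b" by (auto simp: n_def)
  have "row_fin H \<pi> P (Suc n) = step (kcon b E \<pi>) (row_fin H \<pi> P n)"
    unfolding n(2)[symmetric] by (rule row_fin_step[OF assms(1) row_fin_partition[OF assms(1,2)]])
  moreover have "row_fin H \<pi> P (Suc n) = row H \<pi> P \<infinity>" using N n(1) by (simp del: row_fin.simps)
  ultimately have "X \<in> step (kcon b E \<pi>) (row_fin H \<pi> P n)" using assms(3) by simp
  then show ?thesis using stepD by blast
qed

lemma row_const:
  assumes "quasigraph H \<pi>" "partition_on V P" "\<And>X b. X \<in> P \<Longrightarrow> kcon b E \<pi> X"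
  shows "row H \<pi> P j = P"
proof -
  have fin: "row_fin H \<pi> P n = P" for n
  proof (induction n)
    case (Suc n)
    then have "row_fin H \<pi> P (Suc n) = step (kcon (even n) E \<pi>) P"
      using row_fin_step[OF assms(1), of P n] assms(2) by (simp del: row_fin.simps(2))
    also have "\<dots> = P" by (rule step_eq_self[OF assms(2,3)])
    finally show ?case .
  qed simp
  show ?thesis
  proof (cases j)
    case infinity
    obtain N where "row_fin H \<pi> P N = row H \<pi> P \<infinity>" using row_inf[OF assms(1,2)] by blast
    with fin infinity show ?thesis by simp
  qed (simp add: fin)
qed

lemma next_start_Hyperedge:
  assumes "quasigraph H \<pi>" "partition_on V P"
  shows "next_start H \<pi> P (Hyperedge f) =
    step (kcon (\<not> antibridge H \<pi> P f) (E - {f}) \<pi>) P"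
proof -
  have "step (con E (\<pi>(f := {}))) P = step (con (E - {f}) \<pi>) P"
    by (rule arg_cong[of _ _ "\<lambda>C. step C P"]) (simp add: fun_eq_iff con_delete)
  then show ?thesis
    using components_step[OF quasigraph_delete[OF assms(1)]] anticomponents_step(2)[OF assms(2)]
    by (simp add: next_start_def kcon_def)
qed

lemma next_start_refines:
  assumes "quasigraph H \<pi>" "partition_on V P"
  shows "refines V (next_start H \<pi> P d) P"
proof (cases d)
  case (Hyperedge f)
  then show ?thesis
    using next_start_Hyperedge[OF assms] step_refines[OF cluster_kcon finV assms(2)] by simp
qed (simp_all add: next_start_def refines_refl[OF assms(2)])

section \<open>The whole plane of partitions\<close>

abbreviation pl where "pl \<equiv> plane H leE"
abbreviation dec where "dec \<equiv> decision_at H leE"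

lemma plane_start_partition:
  assumes "quasigraph H \<pi>"
  shows "partition_on V (pl \<pi> i 0)"
proof (induction i)
  case 0
  show ?case using partition_on_space[OF nonempty] by (simp add: plane_0)
next
  case (Suc i)
  have "pl \<pi> i = row H \<pi> (pl \<pi> i 0)" by (cases i) (simp_all add: plane_0 plane_Suc)
  then have "partition_on V (pl \<pi> i \<infinity>)" using row_partition[OF assms Suc] by metis
  then show ?case using next_start_refines[OF assms] by (simp add: plane_Suc refines_def)
qed

lemma plane_row: "pl \<pi> i = row H \<pi> (pl \<pi> i 0)"
  by (cases i) (simp_all add: plane_0 plane_Suc)

lemma plane_partition: "quasigraph H \<pi> \<Longrightarrow> partition_on V (pl \<pi> i j)"
  using row_partition[OF _ plane_start_partition] plane_row by metis

lemma plane_Suc_refines: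
  assumes "quasigraph H \<pi>"
  shows "refines V (pl \<pi> (Suc i) 0) (pl \<pi> i \<infinity>)"
  using next_start_refines[OF assms plane_partition[OF assms]] by (simp add: plane_Suc)

lemma plane_row_antimono: "quasigraph H \<pi> \<Longrightarrow> j \<le> k \<Longrightarrow> refines V (pl \<pi> i k) (pl \<pi> i j)"
  using row_antimono[OF _ plane_start_partition] plane_row by metis

lemma plane_inf_antimono:
  assumes "quasigraph H \<pi>" "i \<le> k"
  shows "refines V (pl \<pi> k \<infinity>) (pl \<pi> i \<infinity>)"
  using assms(2)
proof (induction k rule: dec_induct)
  case base
  show ?case by (rule refines_refl[OF plane_partition[OF assms(1)]])
next
  case (step n)
  have "refines V (pl \<pi> (Suc n) \<infinity>) (pl \<pi> (Suc n) 0)"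
    by (rule plane_row_antimono[OF assms(1)]) simp
  then show ?case
    using refines_trans[OF refines_trans[OF _ plane_Suc_refines[OF assms(1)]] step(3)] by blast
qed

lemma plane_antimono:
  assumes qg: "quasigraph H \<pi>" and le: "(i, j) \<le> (k, l)"
  shows "refines V (pl \<pi> k l) (pl \<pi> i j)"
proof (cases "i = k")
  case True
  with le show ?thesis using plane_row_antimono[OF qg] by simp
next
  case False
  with le obtain n where n: "k = Suc n" "i \<le> n" by (cases k) auto
  have "refines V (pl \<pi> k l) (pl \<pi> k 0)" by (rule plane_row_antimono[OF qg]) simp
  moreover have "refines V (pl \<pi> k 0) (pl \<pi> n \<infinity>)" using plane_Suc_refines[OF qg] n by simp
  moreover have "refines V (pl \<pi> n \<infinity>) (pl \<pi> i \<infinity>)" by (rule plane_inf_antimono[OF qg n(2)])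
  moreover have "refines V (pl \<pi> i \<infinity>) (pl \<pi> i j)" by (rule plane_row_antimono[OF qg]) simp
  ultimately show ?thesis using refines_trans by blast
qed

lemma plane_inf_kcon: "quasigraph H \<pi> \<Longrightarrow> X \<in> pl \<pi> i \<infinity> \<Longrightarrow> kcon b E \<pi> X"
  using row_inf_kcon[OF _ plane_start_partition] plane_row by metis

lemma plane_Suc_step:
  assumes "quasigraph H \<pi>"
  shows "pl \<pi> i (enat (Suc n)) = step (kcon (even n) E \<pi>) (pl \<pi> i (enat n))"
proof -
  have eq: "pl \<pi> i (enat m) = row_fin H \<pi> (pl \<pi> i 0) m" for m
    using plane_row[of \<pi> i] by (metis row_enat)
  show ?thesis
    unfolding eq by (rule row_fin_step[OF assms row_fin_partition[OF assms plane_start_partition[OF assms]]])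
qed

lemma history_plane: "history H leE \<pi> i s = pl \<pi> (min s i)"
proof (induction i arbitrary: s)
  case (Suc i)
  show ?case
  proof (cases "s \<le> i")
    case False
    then have "history H leE \<pi> (Suc i) s = history H leE \<pi> (Suc i) (Suc i)" by simp
    moreover have "min s (Suc i) = Suc i" using False by simp
    ultimately show ?thesis by (simp del: history.simps add: plane_def fun_eq_iff)
  qed (simp add: Suc)
qed (simp add: plane_def fun_eq_iff)

subsection \<open>Decisions\<close>

lemma used_unused_quot:
  "e \<in> used_hedges (unused_quot H \<pi> P) \<gamma> \<Longrightarrow>
    e \<in> E \<and> crossing P (ends H e) \<and> \<not> crossing P (\<pi> e)"
  by (auto simp: used_hedges_def unused_quot_def unused_part_def quot_hypergraph_def
      quot_quasigraph_def crossing_def)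

lemma finite_used: "finite (used_hedges (unused_quot H \<pi> P) \<gamma>)"
  by (rule finite_subset[OF _ finE]) (use used_unused_quot in blast)

lemma leading_hedges_crossing: "e \<in> leading_hedges H \<pi> Q P \<Longrightarrow> e \<in> E \<and> crossing P (ends H e)"
  unfolding leading_hedges_def using used_unused_quot by blast

lemma leading_hedges_nonempty:
  assumes "\<not> acyclic_hypergraph (unused_quot H \<pi> P)"
  shows "leading_hedges H \<pi> Q P \<noteq> {}"
proof -
  let ?K = "unused_quot H \<pi> P"
  obtain \<gamma> where \<gamma>: "quasicycle ?K \<gamma>" using assms unfolding acyclic_hypergraph_def by blast
  then obtain vs es where "is_cycle (multigraph_of ?K \<gamma>) vs es" "set es = used_hedges ?K \<gamma>"
    unfolding quasicycle_def by (auto simp: multigraph_of_def)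
  then have "used_hedges ?K \<gamma> \<noteq> {}" using cycle_edges_nonempty by fastforce
  then have "quasicycle_exposure_step Q ?K \<gamma> \<in> (\<lambda>e. exposure_step Q (\<gamma> e)) ` used_hedges ?K \<gamma>"
    unfolding quasicycle_exposure_step_def by (intro Min_in) (simp_all add: finite_used)
  then obtain e where "e \<in> used_hedges ?K \<gamma>" "exposure_step Q (\<gamma> e) = quasicycle_exposure_step Q ?K \<gamma>"
    by auto
  with \<gamma> show ?thesis unfolding leading_hedges_def by blast
qed

lemma order_max_in:
  assumes L: "L \<subseteq> E" "L \<noteq> {}"
  shows "order_max leE L \<in> L"
proof -
  have fin: "finite L" using L finE finite_subset by blast
  have antisym: "antisym leE" and trans: "trans leE" and refl: "refl_on E leE" and total: "total_on E leE"
    using leE by (auto simp: order_on_defs)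
  have "\<exists>e\<in>L. \<forall>f\<in>L. (f, e) \<in> leE"
    using fin L(2,1)
  proof (induction rule: finite_ne_induct)
    case (singleton x)
    then show ?case using refl by (auto simp: refl_on_def)
  next
    case (insert x A)
    then obtain m where m: "m \<in> A" "\<forall>f\<in>A. (f, m) \<in> leE" by auto
    have "(x, m) \<in> leE \<or> (m, x) \<in> leE"
      using insert.prems m(1) total refl by (cases "x = m") (auto simp: total_on_def refl_on_def)
    then show ?case
    proof
      assume "(m, x) \<in> leE"
      then have "\<forall>f\<in>insert x A. (f, x) \<in> leE"
        using m trans refl insert.prems by (auto simp: refl_on_def intro: transD)
      then show ?thesis by blast
    qed (use m in blast)
  qed
  then obtain e where e: "e \<in> L" "\<forall>f\<in>L. (f, e) \<in> leE" by blast
  have "order_max leE L = e"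
    unfolding order_max_def
  proof (rule the_equality)
    fix e' assume "e' \<in> L \<and> (\<forall>f\<in>L. (f, e') \<in> leE)"
    with e antisym show "e' = e" by (auto dest: antisymD)
  qed (use e in blast)
  with e show ?thesis by simp
qed

abbreviation lead where
  "lead \<pi> i \<equiv> leading_hedges H \<pi> (history H leE \<pi> i) (pl \<pi> i \<infinity>)"

lemma dec_Hyperedge:
  assumes "dec \<pi> i = Hyperedge f"
  shows "\<not> acyclic_hypergraph (unused_quot H \<pi> (pl \<pi> i \<infinity>))"
    "f = order_max leE (lead \<pi> i)" "f \<in> lead \<pi> i" "\<not> weakly_redundant H \<pi> (pl \<pi> i \<infinity>) f"
    "f \<in> E" "crossing (pl \<pi> i \<infinity>) (ends H f)"
proof -
  show ac: "\<not> acyclic_hypergraph (unused_quot H \<pi> (pl \<pi> i \<infinity>))" and f: "f = order_max leE (lead \<pi> i)"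
    using assms by (auto simp: decision_at_def decide_def split: if_splits)
  have "lead \<pi> i \<subseteq> E" using leading_hedges_crossing by blast
  then show fl: "f \<in> lead \<pi> i" unfolding f by (rule order_max_in) (rule leading_hedges_nonempty[OF ac])
  then show "\<not> weakly_redundant H \<pi> (pl \<pi> i \<infinity>) f"
    using assms by (auto simp: decision_at_def decide_def split: if_splits)
  show "f \<in> E" "crossing (pl \<pi> i \<infinity>) (ends H f)" using leading_hedges_crossing[OF fl] by auto
qed

lemma dec_Hyperedge_cases:
  assumes "dec \<pi> i = Hyperedge f"
  shows "antibridge H \<pi> (pl \<pi> i \<infinity>) f \<longleftrightarrow> \<pi> f = {}" "\<pi> f \<noteq> {} \<Longrightarrow> bridge H \<pi> (pl \<pi> i \<infinity>) f"
  using dec_Hyperedge(4-6)[OF assms]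
  by (auto simp: weakly_redundant_def redundant_def antibridge_def set_antibridge_def)

lemma plane_next:
  assumes "quasigraph H \<pi>" "dec \<pi> i = Hyperedge f"
  shows "pl \<pi> (Suc i) 0 = step (kcon (\<pi> f \<noteq> {}) (E - {f}) \<pi>) (pl \<pi> i \<infinity>)"
  using next_start_Hyperedge[OF assms(1) plane_partition[OF assms(1)]] dec_Hyperedge_cases(1)[OF assms(2)]
    assms(2)
  by (simp add: plane_Suc)

text \<open>A decided \<open>f\<close> is not weakly redundant, so it is an antibridge or a bridge;
  \<open>X\<close> is the class that falls apart without it.\<close>

lemma dec_Hyperedge_class:
  assumes qg: "quasigraph H \<pi>" and d: "dec \<pi> i = Hyperedge f"
  obtains X where "X \<in> pl \<pi> i \<infinity>" "card (ends H f \<inter> X) = 2" "\<pi> f \<subseteq> X"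
    "\<not> kcon (\<pi> f \<noteq> {}) (E - {f}) \<pi> X"
proof (cases "\<pi> f = {}")
  case True
  then obtain X where X: "X \<in> pl \<pi> i \<infinity>" "set_antibridge H \<pi> X f"
    using dec_Hyperedge_cases(1)[OF d] unfolding antibridge_def by blast
  then have "\<not> anticonnected_on (delete_hedge H f) \<pi> X" by (simp add: set_antibridge_def)
  moreover have "finite X" using X(1) plane_partition[OF qg] partition_on_subset finV finite_subset by metis
  ultimately have "\<not> acon (ends H) (E - {f}) \<pi> X" by (simp add: anticonnected_on_iff)
  with X True that[of X] show ?thesis by (simp add: set_antibridge_def kcon_def)
next
  case False
  then obtain X where X: "X \<in> pl \<pi> i \<infinity>" "set_bridge H \<pi> X f"
    using dec_Hyperedge_cases(2)[OF d] unfolding bridge_def by blast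
  then have "\<not> connected_on H (\<pi>(f := {})) X" by (simp add: set_bridge_def)
  then have "\<not> con (E - {f}) \<pi> X" by (simp add: connected_on_iff quasigraph_delete qg con_delete)
  with X False that[of X] show ?thesis by (simp add: set_bridge_def kcon_def)
qed

text \<open>The class \<open>X\<close> falls apart without \<open>f\<close>. If a later class
  \<open>Y\<close> still contained the two relevant vertices of \<open>f\<close>, so would the class
  \<open>Z\<close> above it at the start of row \<open>Suc i\<close>. A colouring that splits
  \<open>X\<close> would then have a witness other than \<open>f\<close>: inside \<open>Z\<close> if
  it splits \<open>Z\<close>, and otherwise because \<open>f\<close> is monochromatic there. So
  \<open>X\<close> would survive the removal of \<open>f\<close>.\<close>

lemma dec_Hyperedge_torn:
  assumes qg: "quasigraph H \<pi>" and d: "dec \<pi> i = Hyperedge f" and Y: "Y \<in> pl \<pi> k \<infinity>" and ik: "i < k"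
  shows "if \<pi> f = {} then card (ends H f \<inter> Y) \<le> 1 else \<not> \<pi> f \<subseteq> Y"
proof -
  let ?P = "pl \<pi> i \<infinity>" and ?C = "kcon (\<pi> f \<noteq> {}) (E - {f}) \<pi>"
  obtain X where X: "X \<in> ?P" "card (ends H f \<inter> X) = 2" "\<pi> f \<subseteq> X" "\<not> ?C X"
    using dec_Hyperedge_class[OF qg d] by blast
  have part: "partition_on V ?P" by (rule plane_partition[OF qg])
  have fE: "f \<in> E" using dec_Hyperedge(5)[OF d] .
  have "refines V (pl \<pi> k \<infinity>) (pl \<pi> (Suc i) 0)"
    using ik by (intro plane_antimono[OF qg]) auto
  with Y obtain Z where Z: "Z \<in> pl \<pi> (Suc i) 0" "Y \<subseteq> Z" unfolding refines_def by blast
  then have Zs: "Z \<in> step ?C ?P" using plane_next[OF qg d] by simp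
  then have CZ: "?C Z" using stepD by blast
  obtain X' where X': "X' \<in> ?P" "Z \<subseteq> X'" using Zs unfolding step_def by (auto dest: clustersD)
  have kE: "kcon b E \<pi> X" for b using plane_inf_kcon[OF qg X(1)] .
  show ?thesis
  proof (cases "\<pi> f = {}")
    case True
    have "card (ends H f \<inter> Y) \<le> 1"
    proof (rule ccontr)
      assume "\<not> card (ends H f \<inter> Y) \<le> 1"
      then have c2: "2 \<le> card (ends H f \<inter> Y)" by simp
      \<comment> \<open>Two vertices of \<open>f\<close> in each of two disjoint classes would make
        four, but \<open>f\<close> has at most three.\<close>
      have XX': "X' = X"
      proof (rule ccontr)
        assume "X' \<noteq> X"
        then have "X \<inter> X' = {}" using partition_on_unique[OF part X'(1) X(1)] by blast
        then have "(ends H f \<inter> X) \<inter> (ends H f \<inter> Y) = {}" using X'(2) Z(2) by blast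
        then have "card ((ends H f \<inter> X) \<union> (ends H f \<inter> Y)) = card (ends H f \<inter> X) + card (ends H f \<inter> Y)"
          by (intro card_Un_disjoint) (simp_all add: fin_ends[OF fE])
        moreover have "card ((ends H f \<inter> X) \<union> (ends H f \<inter> Y)) \<le> card (ends H f)"
          by (intro card_mono fin_ends[OF fE]) blast
        ultimately show False using c2 X(2) card_ends[OF fE] by auto
      qed
      then have "ends H f \<inter> Y \<subseteq> ends H f \<inter> X" using X'(2) Z(2) by blast
      then have "ends H f \<inter> Y = ends H f \<inter> X"
        using c2 X(2) by (intro card_seteq) (simp_all add: fin_ends[OF fE])
      then have sub: "ends H f \<inter> X \<subseteq> Z" using Z(2) by blast
      have "acon (ends H) (E - {f}) \<pi> X"
        unfolding acon_def
      proof (intro allI impI)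
        fix c assume c: "splits c X"
        show "\<exists>g\<in>E - {f}. \<pi> g \<subseteq> X \<and> \<not> splits c (\<pi> g) \<and> splits c (ends H g \<inter> X)"
        proof (cases "splits c Z")
          case True
          moreover have "acon (ends H) (E - {f}) \<pi> Z" using CZ \<open>\<pi> f = {}\<close> by (simp add: kcon_def)
          ultimately obtain g where "g \<in> E - {f}" "\<pi> g \<subseteq> Z" "\<not> splits c (\<pi> g)" "splits c (ends H g \<inter> Z)"
            unfolding acon_def by blast
          moreover have "Z \<subseteq> X" using X'(2) XX' by simp
          ultimately show ?thesis using splits_mono[of c "ends H g \<inter> Z" "ends H g \<inter> X"] by blast
        next
          case False
          from kE[of False] c obtain g where g: "g \<in> E" "\<pi> g \<subseteq> X" "\<not> splits c (\<pi> g)" "splits c (ends H g \<inter> X)"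
            unfolding kcon_def acon_def by auto
          have "g \<noteq> f" using g(4) False splits_mono[OF _ sub] by blast
          with g show ?thesis by blast
        qed
      qed
      with X(4) True show False by (simp add: kcon_def)
    qed
    with True show ?thesis by simp
  next
    case False
    have "\<not> \<pi> f \<subseteq> Y"
    proof
      assume "\<pi> f \<subseteq> Y"
      then have sub: "\<pi> f \<subseteq> Z" using Z(2) by blast
      then have "X \<inter> X' \<noteq> {}" using False X(3) X'(2) by blast
      then have XX': "X' = X" using partition_on_unique[OF part X(1) X'(1)] by simp
      have "con (E - {f}) \<pi> X"
        unfolding con_def
      proof (intro allI impI)
        fix c assume c: "splits c X"
        show "\<exists>g\<in>E - {f}. \<pi> g \<subseteq> X \<and> splits c (\<pi> g)"
        proof (cases "splits c Z")
          case True
          moreover have "con (E - {f}) \<pi> Z" using CZ \<open>\<pi> f \<noteq> {}\<close> by (simp add: kcon_def)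
          ultimately obtain g where "g \<in> E - {f}" "\<pi> g \<subseteq> Z" "splits c (\<pi> g)"
            unfolding con_def by blast
          moreover have "Z \<subseteq> X" using X'(2) XX' by simp
          ultimately show ?thesis by blast
        next
          case False
          from kE[of True] c obtain g where g: "g \<in> E" "\<pi> g \<subseteq> X" "splits c (\<pi> g)"
            unfolding kcon_def con_def by auto
          have "g \<noteq> f" using g(3) False splits_mono[OF _ sub] by blast
          with g show ?thesis by blast
        qed
      qed
      with X(4) False show False by (simp add: kcon_def)
    qed
    with False show ?thesis by simp
  qed
qed

text \<open>The partitions at the ends of rows stabilise, while every decided hyperedge tears a
  class that it held together.\<close>

lemma dec_eventually_stops:
  assumes qg: "quasigraph H \<pi>"
  shows "\<exists>i. dec \<pi> i \<in> {TERMINATE, STOP}"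
proof (rule ccontr)
  assume neg: "\<not> ?thesis"
  have "refines V (pl \<pi> (Suc n) \<infinity>) (pl \<pi> n \<infinity>)" for n
    by (rule plane_inf_antimono[OF qg]) simp
  then have "\<exists>N. \<forall>n\<ge>N. pl \<pi> n \<infinity> = pl \<pi> N \<infinity>"
    by (rule refining_sequence_stabilises[OF finV])
  then obtain N where N: "\<And>n. n \<ge> N \<Longrightarrow> pl \<pi> n \<infinity> = pl \<pi> N \<infinity>" by blast
  obtain f where d: "dec \<pi> N = Hyperedge f" using neg by (cases "dec \<pi> N") auto
  obtain X where X: "X \<in> pl \<pi> N \<infinity>" "card (ends H f \<inter> X) = 2" "\<pi> f \<subseteq> X"
    using dec_Hyperedge_class[OF qg d] by blast
  then have "X \<in> pl \<pi> (Suc N) \<infinity>" using N[of "Suc N"] by simp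
  from dec_Hyperedge_torn[OF qg d this] X show False by (simp split: if_splits)
qed

end

section \<open>Comparison of signatures\<close>

text \<open>Positions are mapped to triples of numbers, with the Boolean as 0 or 1. The map
  preserves the order, and a least element among the images, which live in a well-order, is pulled
  back.\<close>

lemma position_least:
  fixes S :: "nat \<times> bool \<times> enat \<Rightarrow> bool"
  assumes "S q"
  obtains p where "S p" "\<And>r. r < p \<Longrightarrow> \<not> S r" "p \<le> q"
proof -
  define S' :: "nat \<times> nat \<times> enat \<Rightarrow> bool" where "S' = (\<lambda>(i, n, j). n < 2 \<and> S (i, n = 1, j))"
  define g :: "nat \<times> bool \<times> enat \<Rightarrow> nat \<times> nat \<times> enat" where "g = (\<lambda>(i, b, j). (i, of_bool b, j))"
  have Sg: "S' (g r) = S r" for r by (cases r) (auto simp: S'_def g_def)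
  have gmono: "g r < g p \<longleftrightarrow> r < p" for r p by (cases r; cases p) (auto simp: g_def)
  define m where "m = (LEAST m. S' m)"
  have m: "S' m" unfolding m_def using assms Sg LeastI by metis
  obtain i n j where inj: "m = (i, n, j)" by (cases m)
  then have "n = 0 \<or> n = 1" using m by (auto simp: S'_def)
  then have "m = g (i, n = 1, j)" using inj by (auto simp: g_def)
  then obtain p where p: "m = g p" by blast
  have least: "\<not> S r" if "r < p" for r
    using that gmono[of r p] p not_less_Least[of "g r" S'] Sg[of r] by (simp add: m_def)
  show thesis
  proof (rule that)
    show "S p" using m p Sg by simp
    show "p \<le> q" using least[of q] assms by (meson not_le)
  qed (rule least)
qed

lemma quot_crossing_nonempty: "crossing P S \<Longrightarrow> quot P S \<noteq> {}"
  by (auto simp: crossing_def)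

lemma unused_quot_cong:
  assumes "\<And>g. g \<in> hedges H \<Longrightarrow> crossing P (\<pi> g) = crossing P (\<rho> g)"
  shows "unused_quot H \<pi> P = unused_quot H \<rho> P"
proof -
  have "quot_quasigraph \<pi> P g = {} \<longleftrightarrow> quot_quasigraph \<rho> P g = {}" if "g \<in> hedges H" for g
    using assms[OF that] quot_crossing_nonempty[of P] by (simp add: quot_quasigraph_def)
  then have "used_hedges (quot_hypergraph H P) (quot_quasigraph \<pi> P) =
      used_hedges (quot_hypergraph H P) (quot_quasigraph \<rho> P)"
    by (auto simp: used_hedges_def quot_hypergraph_def)
  then show ?thesis by (simp add: unused_quot_def unused_part_def)
qed

context ordered_three_hypergraph
begin

abbreviation len where "len \<equiv> sig_length H leE"

lemma len_stops: "quasigraph H \<pi> \<Longrightarrow> dec \<pi> (len \<pi>) \<in> {TERMINATE, STOP}"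
  unfolding sig_length_def by (rule LeastI_ex) (rule dec_eventually_stops)

lemma before_len: "i < len \<pi> \<Longrightarrow> \<exists>f. dec \<pi> i = Hyperedge f"
  unfolding sig_length_def using not_less_Least by (cases "dec \<pi> i") blast+

lemma len_le: "dec \<pi> i \<in> {TERMINATE, STOP} \<Longrightarrow> len \<pi> \<le> i"
  unfolding sig_length_def by (rule Least_le)

text \<open>\<open>stage \<pi> i j b F i' j'\<close>: the partition with index \<open>(i, j)\<close> is obtained from the one with index
  \<open>(i', j')\<close> by taking components (\<open>b\<close>) or anticomponents (\<open>\<not> b\<close>) with respect to the hyperedges
  in \<open>F\<close>.\<close>

definition stage ::
  "('e \<Rightarrow> 'v set) \<Rightarrow> nat \<Rightarrow> enat \<Rightarrow> bool \<Rightarrow> 'e set \<Rightarrow> nat \<Rightarrow> enat \<Rightarrow> bool" where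
  "stage \<pi> i j b F i' j' \<longleftrightarrow>
     (\<exists>n. j = enat (Suc n) \<and> i' = i \<and> j' = enat n \<and> F = E \<and> b = even n) \<or>
     (\<exists>f. i = Suc i' \<and> j = 0 \<and> j' = \<infinity> \<and> dec \<pi> i' = Hyperedge f \<and> F = E - {f} \<and> b = (\<pi> f \<noteq> {}))"

lemma stage_plane:
  "quasigraph H \<pi> \<Longrightarrow> stage \<pi> i j b F i' j' \<Longrightarrow> pl \<pi> i j = step (kcon b F \<pi>) (pl \<pi> i' j')"
  unfolding stage_def using plane_Suc_step plane_next by blast

lemma stage_less: "stage \<pi> i j b F i' j' \<Longrightarrow> (i', j') < (i, j)"
  unfolding stage_def by auto

lemma stage_ex:
  assumes "i \<le> len \<pi>" "j \<noteq> \<infinity>" "i \<noteq> 0 \<or> j \<noteq> 0"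
  shows "\<exists>b F i' j'. stage \<pi> i j b F i' j'"
proof (cases "j = 0")
  case True
  then obtain k where k: "i = Suc k" using assms(3) by (cases i) auto
  then obtain f where "dec \<pi> k = Hyperedge f" using before_len[of k \<pi>] assms(1) by auto
  with k True show ?thesis unfolding stage_def by blast
next
  case False
  then obtain n where "j = enat (Suc n)" using assms(2)
    by (metis enat.exhaust not0_implies_Suc zero_enat_def)
  then show ?thesis unfolding stage_def by blast
qed

lemma stage_transfer:
  assumes "stage \<pi> i j b F i' j'"
    and "\<And>f. i' < i \<Longrightarrow> dec \<pi> i' = Hyperedge f \<Longrightarrow> dec \<rho> i' = Hyperedge f \<and> (\<pi> f = {} \<longleftrightarrow> \<rho> f = {})"
  shows "stage \<rho> i j b F i' j'"
  using assms unfolding stage_def by auto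

section \<open>Reading off signatures and locating their first difference\<close>

lemma sig_simps:
  "i \<le> len \<pi> \<Longrightarrow> sig H leE \<pi> (i, False, j) = Some (Partition (pl \<pi> i j))"
  "i \<le> len \<pi> \<Longrightarrow> sig H leE \<pi> (i, True, 0) = Some (Decision (dec \<pi> i))"
  "j \<noteq> 0 \<Longrightarrow> sig H leE \<pi> (i, True, j) = None"
  "len \<pi> < i \<Longrightarrow> sig H leE \<pi> (i, b, j) = None"
  by (auto simp: sig_def)

lemma sig_eq_decD:
  assumes "i \<le> len \<pi>" "sig H leE \<pi> (i, True, 0) = sig H leE \<rho> (i, True, 0)"
  shows "i \<le> len \<rho>" "dec \<rho> i = dec \<pi> i"
  using assms by (auto simp: sig_def split: if_splits)

lemma sig_eq_planeD:
  assumes "i \<le> len \<pi>" "sig H leE \<pi> (i, False, j) = sig H leE \<rho> (i, False, j)"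
  shows "pl \<rho> i j = pl \<pi> i j"
  using assms by (auto simp: sig_def split: if_splits)

text \<open>If the signature of \<open>\<rho>\<close> ended before row \<open>i\<close>, its last
  decision would also be the decision of \<open>\<pi>\<close> there, which is a hyperedge.\<close>

lemma prefix_len:
  assumes "quasigraph H \<rho>" "i \<le> len \<pi>"
    and eq: "\<And>q. q < (i, b, j) \<Longrightarrow> sig H leE \<pi> q = sig H leE \<rho> q"
  shows "i \<le> len \<rho>"
proof (rule ccontr)
  assume "\<not> i \<le> len \<rho>"
  then have lt: "len \<rho> < i" by simp
  have "dec \<rho> (len \<rho>) = dec \<pi> (len \<rho>)"
    using lt assms(2) by (intro sig_eq_decD(2)[OF _ eq]) simp_all
  with len_stops[OF assms(1)] before_len[of "len \<rho>" \<pi>] lt assms(2) show False by auto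
qed

lemma entry_less_asym:
  assumes "entry_less V leD a b"
  shows "\<not> entry_less V leD b a"
proof -
  have "antisym leD" using leD by (auto simp: decision_order_def order_on_defs)
  with assms show ?thesis
    by (cases "(V, leD, a, b)" rule: entry_less.cases) (auto dest: refines_asym antisymD)
qed

text \<open>A comparison is required only at positions before which both signatures agree. The first
  difference lies at or before \<open>p0\<close>, and there the equality alternative is ruled
  out.\<close>

lemma sig_lessI:
  assumes le: "\<And>p. p \<le> p0 \<Longrightarrow> (\<And>q. q < p \<Longrightarrow> sig H leE \<pi> q = sig H leE \<rho> q) \<Longrightarrow>
      sig H leE \<pi> p = sig H leE \<rho> p \<or> entry_less V leD (sig H leE \<pi> p) (sig H leE \<rho> p)"
    and ne: "\<not> (\<forall>p\<le>p0. sig H leE \<pi> p = sig H leE \<rho> p)"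
  shows "sig_less H leE leD \<pi> \<rho>"
proof -
  from ne obtain p1 where p1: "p1 \<le> p0" "sig H leE \<pi> p1 \<noteq> sig H leE \<rho> p1" by blast
  obtain p where p: "sig H leE \<pi> p \<noteq> sig H leE \<rho> p"
      "\<And>r. r < p \<Longrightarrow> sig H leE \<pi> r = sig H leE \<rho> r" "p \<le> p0"
    using position_least[of "\<lambda>p. sig H leE \<pi> p \<noteq> sig H leE \<rho> p", OF p1(2)] order_trans[OF _ p1(1)]
    by metis
  have el: "entry_less V leD (sig H leE \<pi> p) (sig H leE \<rho> p)"
    using le[OF p(3) p(2)] p(1) by blast
  have "sig_le H leE leD \<pi> \<rho>" unfolding sig_le_def using p(2) el by blast
  moreover have "\<not> sig_le H leE leD \<rho> \<pi>"
  proof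
    assume "sig_le H leE leD \<rho> \<pi>"
    moreover have "sig H leE \<rho> \<noteq> sig H leE \<pi>" using p(1) by metis
    ultimately obtain p' where p': "\<And>q. q < p' \<Longrightarrow> sig H leE \<rho> q = sig H leE \<pi> q"
        "entry_less V leD (sig H leE \<rho> p') (sig H leE \<pi> p')"
      unfolding sig_le_def by blast
    have "sig H leE \<rho> p' \<noteq> sig H leE \<pi> p'" using p'(2) entry_less_asym by metis
    then have "\<not> p' < p" using p(2) by metis
    moreover have "\<not> p < p'" using p'(1) p(1) by metis
    ultimately have "p = p'" by simp
    with el p'(2) entry_less_asym show False by blast
  qed
  ultimately show ?thesis by (simp add: sig_less_def sig_equiv_def)
qed

lemma plane_inf_cong:
  assumes "\<And>n. pl \<pi> i (enat n) = pl \<rho> i (enat n)"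
  shows "pl \<pi> i \<infinity> = pl \<rho> i \<infinity>"
proof -
  have inf: "pl \<sigma> i \<infinity> = eventual_value (\<lambda>n. pl \<sigma> i (enat n))" for \<sigma>
  proof -
    have "(\<lambda>n. pl \<sigma> i (enat n)) = row_fin H \<sigma> (pl \<sigma> i 0)"
      by (subst plane_row) (simp add: fun_eq_iff)
    then show ?thesis by (subst plane_row) (simp add: row_def)
  qed
  show ?thesis unfolding inf using assms by simp
qed

text \<open>At the first difference, the signature of \<open>\<rho>\<close> is the larger one, provided that \<open>\<rho>\<close> does not
  tear apart what \<open>\<pi>\<close> keeps together and that \<open>\<pi>\<close> and \<open>\<rho>\<close> only differ inside a set \<open>U\<close> which has
  not been separated yet.\<close>

lemma entry_compare:
  assumes qg: "quasigraph H \<pi>" "quasigraph H \<rho>"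
    and D1: "\<And>b F i j i' j' Y. stage \<pi> i j b F i' j' \<Longrightarrow> i \<le> len \<pi> \<Longrightarrow> in_class (pl \<pi> i' j') U \<Longrightarrow>
        Y \<in> pl \<pi> i j \<Longrightarrow> kcon b F \<rho> Y"
    and D2: "\<And>i f. i < len \<pi> \<Longrightarrow> in_class (pl \<pi> i \<infinity>) U \<Longrightarrow> dec \<pi> i = Hyperedge f \<Longrightarrow>
        \<pi> f = {} \<longleftrightarrow> \<rho> f = {}"
    and D3: "\<And>P g. partition_on V P \<Longrightarrow> in_class P U \<Longrightarrow> g \<in> E \<Longrightarrow>
        crossing P (\<pi> g) = crossing P (\<rho> g)"
    and eq: "\<And>q. q < (i, b, j) \<Longrightarrow> sig H leE \<pi> q = sig H leE \<rho> q"
    and inU: "\<And>i' j'. i' \<le> len \<pi> \<Longrightarrow> (i', False, j') < (i, b, j) \<Longrightarrow> in_class (pl \<pi> i' j') U"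
    and nostop: "i \<le> len \<pi> \<Longrightarrow> b \<Longrightarrow> dec \<pi> i \<noteq> STOP"
  shows "sig H leE \<pi> (i, b, j) = sig H leE \<rho> (i, b, j) \<or>
    entry_less V leD (sig H leE \<pi> (i, b, j)) (sig H leE \<rho> (i, b, j))"
proof (cases "i \<le> len \<pi>")
  case False
  then have "(len \<pi>, True, 0) < (i, b, j)" by simp
  from sig_eq_decD[OF order_refl eq[OF this]] have "dec \<rho> (len \<pi>) = dec \<pi> (len \<pi>)" by simp
  then have "len \<rho> \<le> len \<pi>" using len_stops[OF qg(1)] len_le by metis
  with False show ?thesis by (simp add: sig_simps(4))
next
  case ilen: True
  have ilen': "i \<le> len \<rho>" using prefix_len[OF qg(2) ilen eq] .
  have plane_eq: "pl \<rho> i' j' = pl \<pi> i' j'" if "(i', False, j') < (i, b, j)" for i' j'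
    using that ilen by (intro sig_eq_planeD[OF _ eq[OF that]]) auto
  have dec_eq: "dec \<rho> i' = dec \<pi> i'" if "i' < i" for i'
    using that ilen by (intro sig_eq_decD(2)[OF _ eq]) simp_all
  show ?thesis
  proof (cases b)
    case False
    have "refines V (pl \<pi> i j) (pl \<rho> i j)"
    proof (cases "j = \<infinity>")
      case True
      have "pl \<pi> i \<infinity> = pl \<rho> i \<infinity>"
        by (rule plane_inf_cong) (use plane_eq True False in simp)
      with True show ?thesis using refines_refl[OF plane_partition[OF qg(1)]] by metis
    next
      case jfin: False
      show ?thesis
      proof (cases "i = 0 \<and> j = 0")
        case True
        then have "pl \<rho> i j = pl \<pi> i j" by (simp add: plane_0)
        then show ?thesis using refines_refl[OF plane_partition[OF qg(1)]] by metis
      next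
        case start: False
        obtain b' F i' j' where st: "stage \<pi> i j b' F i' j'"
          using stage_ex[OF ilen jfin] start by auto
        have lt: "(i', False, j') < (i, b, j)" using stage_less[OF st] False by auto
        then have i': "i' \<le> len \<pi>" using ilen by auto
        have U: "in_class (pl \<pi> i' j') U" by (rule inU[OF i' lt])
        have j': "j' = \<infinity>" if "i' < i" using st that unfolding stage_def by auto
        have "stage \<rho> i j b' F i' j'"
        proof (rule stage_transfer[OF st])
          fix f assume f: "i' < i" "dec \<pi> i' = Hyperedge f"
          have "in_class (pl \<pi> i' \<infinity>) U" using U j'[OF f(1)] by simp
          moreover have "i' < len \<pi>" using f(1) ilen by simp
          ultimately show "dec \<rho> i' = Hyperedge f \<and> (\<pi> f = {} \<longleftrightarrow> \<rho> f = {})"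
            using D2 f dec_eq[OF f(1)] by simp
        qed
        then have "pl \<rho> i j = step (kcon b' F \<rho>) (pl \<pi> i' j')"
          using stage_plane[OF qg(2)] plane_eq[OF lt] by metis
        moreover have p\<pi>: "pl \<pi> i j = step (kcon b' F \<pi>) (pl \<pi> i' j')"
          by (rule stage_plane[OF qg(1) st])
        ultimately show ?thesis
          using step_coarser[OF cluster_kcon cluster_kcon finV plane_partition[OF qg(1)], of b' F \<pi> i' j' b' F \<rho>]
            D1[OF st ilen U] by metis
      qed
    qed
    with False ilen ilen' show ?thesis by (auto simp: sig_simps(1))
  next
    case True
    show ?thesis
    proof (cases "j = 0")
      case False
      with True show ?thesis by (simp add: sig_simps(3))
    next
      case j0: True
      have pe: "pl \<rho> k l = pl \<pi> k l" if "k \<le> i" for k l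
        using that True j0 by (intro plane_eq) auto
      have hist: "history H leE \<rho> i = history H leE \<pi> i"
        by (simp add: fun_eq_iff history_plane pe)
      have P: "pl \<rho> i \<infinity> = pl \<pi> i \<infinity>" by (simp add: pe)
      have "in_class (pl \<pi> i \<infinity>) U" using inU[OF ilen] True by simp
      then have K: "unused_quot H \<rho> (pl \<pi> i \<infinity>) = unused_quot H \<pi> (pl \<pi> i \<infinity>)"
        using D3[OF plane_partition[OF qg(1)]] by (intro unused_quot_cong) metis
      have L: "leading_hedges H \<rho> (history H leE \<pi> i) (pl \<pi> i \<infinity>) = lead \<pi> i"
        unfolding leading_hedges_def K ..
      have "dec \<pi> i = dec \<rho> i \<or> (dec \<pi> i, dec \<rho> i) \<in> leD"
      proof (cases "dec \<pi> i")
        case TERMINATE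
        then have "acyclic_hypergraph (unused_quot H \<pi> (pl \<pi> i \<infinity>))"
          by (auto simp: decision_at_def decide_def split: if_splits)
        then have "dec \<rho> i = TERMINATE" by (simp add: decision_at_def decide_def P K)
        with TERMINATE show ?thesis by simp
      next
        case STOP
        \<comment> \<open>From \<open>STOP\<close> the entry could drop to a hyperedge, hence the
          assumption \<open>nostop\<close>.\<close>
        with nostop[OF ilen True] show ?thesis by simp
      next
        case (Hyperedge f)
        note f = dec_Hyperedge[OF Hyperedge]
        \<comment> \<open>The leading hyperedges are the same for both quasigraphs, and so is their
          maximum; only weak redundancy may appear.\<close>
        have "dec \<rho> i = STOP \<or> dec \<rho> i = Hyperedge f"
          unfolding decision_at_def decide_def hist P K L using f(1,2) by simp
        moreover have "(Hyperedge f, STOP) \<in> leD" using leD f(5) by (simp add: decision_order_def)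
        ultimately show ?thesis using Hyperedge by auto
      qed
      with True j0 ilen ilen' show ?thesis by (auto simp: sig_simps(2))
    qed
  qed
qed

lemma plane_inf_eq_enat:
  assumes "quasigraph H \<pi>"
  shows "\<exists>n. pl \<pi> i \<infinity> = pl \<pi> i (enat n)"
proof -
  obtain N where "row_fin H \<pi> (pl \<pi> i 0) N = row H \<pi> (pl \<pi> i 0) \<infinity>"
    using row_inf[OF assms plane_start_partition[OF assms]] by blast
  then have "row H \<pi> (pl \<pi> i 0) \<infinity> = row H \<pi> (pl \<pi> i 0) (enat N)" by simp
  then have "pl \<pi> i \<infinity> = pl \<pi> i (enat N)" using plane_row[of \<pi> i] by metis
  then show ?thesis by blast
qed

text \<open>While \<open>U\<close> is unseparated, \<open>D1\<close> says that \<open>\<rho>\<close>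
  still holds together every class produced by \<open>\<pi>\<close>, \<open>D2\<close> that decided
  hyperedges keep their kind, and \<open>D3\<close> that quotients are unaffected. So the first
  difference up to \<open>(s, t)\<close>, if any, is an increase. There is one, because
  \<open>merge\<close> keeps \<open>S\<close> together for \<open>\<rho>\<close> where
  \<open>\<pi>\<close> separates it.\<close>

lemma sig_less_at:
  assumes qg: "quasigraph H \<pi>" "quasigraph H \<rho>"
    and D1: "\<And>b F i j i' j' Y. stage \<pi> i j b F i' j' \<Longrightarrow> i \<le> len \<pi> \<Longrightarrow> in_class (pl \<pi> i' j') U \<Longrightarrow>
        Y \<in> pl \<pi> i j \<Longrightarrow> kcon b F \<rho> Y"
    and D2: "\<And>i f. i < len \<pi> \<Longrightarrow> in_class (pl \<pi> i \<infinity>) U \<Longrightarrow> dec \<pi> i = Hyperedge f \<Longrightarrow>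
        \<pi> f = {} \<longleftrightarrow> \<rho> f = {}"
    and D3: "\<And>P g. partition_on V P \<Longrightarrow> in_class P U \<Longrightarrow> g \<in> E \<Longrightarrow>
        crossing P (\<pi> g) = crossing P (\<rho> g)"
    and s: "s \<le> len \<pi>"
    and inU: "\<And>i j. (i, j) < (s, t) \<Longrightarrow> in_class (pl \<pi> i j) U"
    and S: "S \<subseteq> U" "S \<subseteq> V" "\<not> in_class (pl \<pi> s t) S"
    and merge: "\<And>b F i' j'. stage \<pi> s t b F i' j' \<Longrightarrow> in_class (pl \<pi> i' j') U \<Longrightarrow>
        in_class (step (kcon b F \<rho>) (pl \<pi> i' j')) S"
  shows "sig_less H leE leD \<pi> \<rho>"
proof (rule sig_lessI[of "(s, False, t)"])
  fix p assume p: "p \<le> (s, False, t)" and eq: "\<And>q. q < p \<Longrightarrow> sig H leE \<pi> q = sig H leE \<rho> q"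
  obtain i b j where pij: "p = (i, b, j)" by (cases p)
  show "sig H leE \<pi> p = sig H leE \<rho> p \<or> entry_less V leD (sig H leE \<pi> p) (sig H leE \<rho> p)"
    unfolding pij
  proof (rule entry_compare[OF qg D1 D2 D3])
    show "sig H leE \<pi> q = sig H leE \<rho> q" if "q < (i, b, j)" for q using eq that pij by simp
    show "in_class (pl \<pi> i' j') U" if "(i', False, j') < (i, b, j)" for i' j'
    proof (rule inU)
      have "(i', False, j') < (s, False, t)" using that p pij by (metis less_le_trans)
      then show "(i', j') < (s, t)" by auto
    qed
    show "dec \<pi> i \<noteq> STOP" if b
    proof -
      have "i < len \<pi>" using p pij that s by auto
      then show ?thesis using before_len by fastforce
    qed
  qed
next
  show "\<not> (\<forall>p\<le>(s, False, t). sig H leE \<pi> p = sig H leE \<rho> p)"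
  proof
    assume eq: "\<forall>p\<le>(s, False, t). sig H leE \<pi> p = sig H leE \<rho> p"
    have pe: "pl \<rho> i j = pl \<pi> i j" if "(i, j) \<le> (s, t)" for i j
      using that s by (intro sig_eq_planeD eq[rule_format]) auto
    have de: "dec \<rho> i = dec \<pi> i" if "i < s" for i
      using that s by (intro sig_eq_decD(2) eq[rule_format]) auto
    \<comment> \<open>The value at infinity already occurs in a finite column, where
      \<open>U\<close> is still unseparated.\<close>
    have "t \<noteq> \<infinity>"
    proof
      assume t: "t = \<infinity>"
      obtain n where n: "pl \<pi> s \<infinity> = pl \<pi> s (enat n)" using plane_inf_eq_enat[OF qg(1)] by blast
      have "in_class (pl \<pi> s (enat n)) U" by (rule inU) (simp add: t)
      then show False using n t S(1,3) in_class_mono by metis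
    qed
    moreover have "s \<noteq> 0 \<or> t \<noteq> 0" using S(2,3) by (auto simp: plane_0 in_class_def)
    ultimately obtain b F i' j' where st: "stage \<pi> s t b F i' j'" using stage_ex[OF s] by blast
    have lt: "(i', j') < (s, t)" by (rule stage_less[OF st])
    have U: "in_class (pl \<pi> i' j') U" by (rule inU[OF lt])
    have "stage \<rho> s t b F i' j'"
    proof (rule stage_transfer[OF st])
      fix f assume f: "i' < s" "dec \<pi> i' = Hyperedge f"
      have "j' = \<infinity>" using st f(1) unfolding stage_def by auto
      then show "dec \<rho> i' = Hyperedge f \<and> (\<pi> f = {} \<longleftrightarrow> \<rho> f = {})"
        using D2[OF _ _ f(2)] U f s de[OF f(1)] by simp
    qed
    then have "pl \<rho> s t = step (kcon b F \<rho>) (pl \<rho> i' j')" by (rule stage_plane[OF qg(2)])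
    then have "pl \<pi> s t = step (kcon b F \<rho>) (pl \<pi> i' j')" using pe[OF order_refl] pe[OF less_imp_le[OF lt]] by simp
    with merge[OF st U] S(3) show False by simp
  qed
qed

end

section \<open>Rerouting\<close>

text \<open>A colouring split by a lost pair also splits \<open>U\<close>, and then a pair of
  \<open>F'\<close> inside \<open>U\<close> takes over.\<close>

lemma con_reroute:
  assumes "con F \<pi> Y" "con F' \<pi> U" "U \<subseteq> Y" "\<And>g. g \<in> F \<Longrightarrow> g \<notin> F' \<Longrightarrow> \<pi> g \<subseteq> Y \<Longrightarrow> \<pi> g \<subseteq> U"
  shows "con F' \<pi> Y"
  unfolding con_def
proof (intro allI impI)
  fix c assume "splits c Y"
  with assms(1) obtain g where g: "g \<in> F" "\<pi> g \<subseteq> Y" "splits c (\<pi> g)" unfolding con_def by blast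
  show "\<exists>f\<in>F'. \<pi> f \<subseteq> Y \<and> splits c (\<pi> f)"
  proof (cases "g \<in> F'")
    case True
    with g show ?thesis by blast
  next
    case False
    then have "splits c U" using assms(4) g splits_mono by blast
    then obtain f where "f \<in> F'" "\<pi> f \<subseteq> U" "splits c (\<pi> f)" using assms(2) unfolding con_def by blast
    with assms(3) show ?thesis by blast
  qed
qed

text \<open>An emptied value lies in every set and is never split, so each witness remains
  one.\<close>

lemma acon_delete:
  assumes "acon N F \<pi> Y"
  shows "acon N F (\<pi>(e := {})) Y"
  unfolding acon_def
proof (intro allI impI)
  fix c assume "splits c Y"
  with assms obtain g where "g \<in> F" "\<pi> g \<subseteq> Y" "\<not> splits c (\<pi> g)" "splits c (N g \<inter> Y)"
    unfolding acon_def by blast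
  then show "\<exists>f\<in>F. (\<pi>(e := {})) f \<subseteq> Y \<and> \<not> splits c ((\<pi>(e := {})) f) \<and> splits c (N f \<inter> Y)"
    by (intro bexI[of _ g]) auto
qed

lemma in_class_not_crossing:
  assumes "partition_on V P" "in_class P S"
  shows "\<not> crossing P S"
proof -
  obtain X where X: "X \<in> P" "S \<subseteq> X" using assms(2) unfolding in_class_def by blast
  have "C = X" if "C \<in> P" "C \<inter> S \<noteq> {}" for C
    using partition_on_unique[OF assms(1) that(1) X(1)] that(2) X(2) by blast
  then have "quot P S \<subseteq> {X}" unfolding quot_def by blast
  then have "card (quot P S) \<le> card {X}" by (intro card_mono) simp_all
  then show ?thesis by (simp add: crossing_def)
qed

lemma not_crossing_in_class:
  assumes "finite V" "partition_on V P" "S \<subseteq> V" "S \<noteq> {}" "\<not> crossing P S"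
  shows "in_class P S"
proof -
  have finP: "finite P" using assms(1,2) finite_elements by blast
  have cl: "\<exists>X\<in>P. x \<in> X" if "x \<in> S" for x
    using that assms(2,3) unfolding partition_on_def by blast
  obtain x where x: "x \<in> S" using assms(4) by blast
  then obtain X where X: "X \<in> P" "x \<in> X" using cl by blast
  have "y \<in> X" if y: "y \<in> S" for y
  proof -
    obtain Y where Y: "Y \<in> P" "y \<in> Y" using cl y by blast
    then have "Y = X" using assms(5) X x y unfolding crossing_iff[OF finP] by blast
    with Y show ?thesis by simp
  qed
  with X(1) show ?thesis unfolding in_class_def by blast
qed

text \<open>Colouring vertices by their classes is constant on every pair, hence on the connected
  set \<open>U\<close>.\<close>

lemma in_class_con:
  assumes P: "partition_on V P" and U: "U \<subseteq> V" "U \<noteq> {}" and con: "con F \<pi> U"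
    and edges: "\<And>g. g \<in> F \<Longrightarrow> in_class P (\<pi> g)"
  shows "in_class P U"
proof -
  define c where "c x = \<Union> {C \<in> P. x \<in> C}" for x
  have cC: "c x = C" if "C \<in> P" "x \<in> C" for x C
  proof -
    have "D = C" if "D \<in> P" "x \<in> D" for D
      using partition_on_unique[OF P that(1) \<open>C \<in> P\<close>] that(2) \<open>x \<in> C\<close> by blast
    then have "{D \<in> P. x \<in> D} = {C}" using that by blast
    then show ?thesis by (simp add: c_def)
  qed
  have cl: "c x \<in> P \<and> x \<in> c x" if x: "x \<in> U" for x
  proof -
    from x U(1) P obtain C where C: "C \<in> P" "x \<in> C" unfolding partition_on_def by blast
    then show ?thesis using cC[OF C] by simp
  qed
  have "\<not> splits c (\<pi> g)" if g: "g \<in> F" for g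
  proof -
    obtain X where "X \<in> P" "\<pi> g \<subseteq> X" using edges[OF g] unfolding in_class_def by blast
    then have "c x = X" if "x \<in> \<pi> g" for x using cC that by blast
    then show ?thesis unfolding splits_def by simp
  qed
  then have ns: "\<not> splits c U" using con unfolding con_def by blast
  obtain u where u: "u \<in> U" using U(2) by blast
  have "x \<in> c u" if "x \<in> U" for x
    using ns u that cl[OF that] unfolding splits_def by metis
  with cl[OF u] show ?thesis unfolding in_class_def by blast
qed

context ordered_three_hypergraph
begin

section \<open>The plane sequence terminates at an acyclic partition\<close>

text \<open>After \<open>TERMINATE\<close> the next row starts at the same partition, whose classes
  are already connected and anticonnected. So nothing changes any more and this partition is the
  limit.\<close>

lemma terminate_skeletal:
  assumes qg: "quasigraph H \<pi>" and fin: "dec \<pi> (len \<pi>) = TERMINATE"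
  shows "skeletal H \<pi> (plane_limit H leE \<pi>)"
proof -
  let ?P = "pl \<pi> (len \<pi>) \<infinity>"
  have part: "partition_on V ?P" by (rule plane_partition[OF qg])
  have acyc: "acyclic_hypergraph (unused_quot H \<pi> ?P)"
    using fin by (auto simp: decision_at_def decide_def split: if_splits)
  have const: "pl \<pi> (len \<pi> + k) \<infinity> = ?P" for k
  proof (induction k)
    case (Suc k)
    then have "dec \<pi> (len \<pi> + k) = TERMINATE" using acyc by (simp add: decision_at_def decide_def)
    then have "pl \<pi> (len \<pi> + Suc k) = row H \<pi> ?P" using Suc by (simp add: plane_Suc next_start_def)
    then show ?case using row_const[OF qg part plane_inf_kcon[OF qg]] by simp
  qed simp
  have "plane_limit H leE \<pi> = ?P"
    unfolding plane_limit_def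
  proof (rule eventual_value_eq)
    show "pl \<pi> n \<infinity> = ?P" if "len \<pi> \<le> n" for n using const[of "n - len \<pi>"] that by simp
  qed
  moreover have "connected_on H \<pi> X \<and> anticonnected_on H \<pi> X" if X: "X \<in> ?P" for X
  proof -
    have "finite X" using partition_on_subset[OF part X] finV by (rule finite_subset)
    with plane_inf_kcon[OF qg X, of True] plane_inf_kcon[OF qg X, of False] show ?thesis
      by (simp add: kcon_def connected_on_iff[OF qg] anticonnected_on_iff)
  qed
  ultimately show ?thesis using part acyc by (simp add: skeletal_def solid_def)
qed

section \<open>Removing an edge of a cycle\<close>

lemma improve_cycle:
  assumes qg: "quasigraph H \<pi>" and fin: "dec \<pi> (len \<pi>) = TERMINATE"
    and cyc: "is_cycle (multigraph_of H \<pi>) vs es"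
  shows "\<exists>\<rho>. quasigraph H \<rho> \<and>
    (sig_less H leE leD \<pi> \<rho> \<or> sig_equiv H leE leD \<rho> \<pi> \<and> qsize H \<rho> < qsize H \<pi>)"
proof -
  define U where "U = set vs"
  have es: "es \<noteq> []" by (rule cycle_edges_nonempty[OF cyc])
  have esE: "g \<in> E \<and> \<pi> g \<noteq> {}" if "g \<in> set es" for g
    using cyc that by (auto simp: is_cycle_def multigraph_of_def used_hedges_def)
  have UV: "U \<subseteq> V" using cyc by (simp add: is_cycle_def multigraph_of_def U_def)
  have U0: "U \<noteq> {}" using cyc by (auto simp: is_cycle_def U_def)
  have esU: "\<pi> g \<subseteq> U" if g: "g \<in> set es" for g
  proof -
    obtain i where i: "i < length vs" "g = es ! i"
      using g cyc by (metis in_set_conv_nth is_cycle_def)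
    have "Suc i mod length vs < length vs" using i by (intro mod_less_divisor) linarith
    then show ?thesis using i cyc by (simp add: is_cycle_def multigraph_of_def U_def)
  qed
  have conU: "con (set es - {e}) \<pi> U" for e
    using cycle_con[OF cyc, of e] by (simp add: multigraph_of_def U_def)
  have conU': "con F \<pi> U" if "set es - {e} \<subseteq> F" for F e
    using con_mono[OF conU that] .
  \<comment> \<open>A cycle edge deleted by a decision would be a bridge of the class containing
    \<open>U\<close>, yet the rest of the cycle replaces it.\<close>
  have esF: "set es \<subseteq> F" if st: "stage \<pi> i j b F i' j'" and i: "i \<le> len \<pi>" and inU: "in_class (pl \<pi> i' j') U"
    for i j b F i' j'
  proof (cases "F = E")
    case True
    then show ?thesis using esE by blast
  next
    case False
    then obtain f where f: "dec \<pi> i' = Hyperedge f" "F = E - {f}" "j' = \<infinity>"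
      using st unfolding stage_def by blast
    have "f \<notin> set es"
    proof
      assume fes: "f \<in> set es"
      obtain X where X: "X \<in> pl \<pi> i' \<infinity>" "\<pi> f \<subseteq> X" "\<not> kcon (\<pi> f \<noteq> {}) (E - {f}) \<pi> X"
        using dec_Hyperedge_class[OF qg f(1)] by metis
      obtain X' where X': "X' \<in> pl \<pi> i' \<infinity>" "U \<subseteq> X'" using inU f(3) unfolding in_class_def by blast
      have "X \<inter> X' \<noteq> {}" using X(2) X'(2) esU[OF fes] esE[OF fes] by blast
      then have XU: "U \<subseteq> X" using partition_on_unique[OF plane_partition[OF qg] X(1) X'(1)] X'(2) by simp
      have "con E \<pi> X" using plane_inf_kcon[OF qg X(1), of True] by (simp add: kcon_def)
      then have "con (E - {f}) \<pi> X"
      proof (rule con_reroute[OF _ conU'[of f] XU])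
        show "set es - {f} \<subseteq> E - {f}" using esE by blast
        show "\<pi> g \<subseteq> U" if "g \<in> E" "g \<notin> E - {f}" for g using that esU[OF fes] by simp
      qed
      with X(3) esE[OF fes] show False by (simp add: kcon_def)
    qed
    with f(2) esE show ?thesis by blast
  qed
  \<comment> \<open>A component misses \<open>U\<close>, and then the pair of \<open>e\<close> is
    not inside it, or contains \<open>U\<close>, and then the rest of the cycle replaces
    \<open>e\<close>. Anticonnectedness survives any emptied value.\<close>
  have D1: "kcon b F (\<pi>(e := {})) Y"
    if e: "e \<in> set es" and st: "stage \<pi> i j b F i' j'" and i: "i \<le> len \<pi>"
      and inU: "in_class (pl \<pi> i' j') U" and Y: "Y \<in> pl \<pi> i j"
    for e b F i j i' j' Y
  proof -
    have Ys: "Y \<in> step (kcon b F \<pi>) (pl \<pi> i' j')" using Y stage_plane[OF qg st] by simp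
    have kY: "kcon b F \<pi> Y" using Ys stepD by blast
    have F: "set es \<subseteq> F" by (rule esF[OF st i inU])
    show ?thesis
    proof (cases b)
      case True
      have cY: "con F \<pi> Y" using kY True by (simp add: kcon_def)
      have "con (F - {e}) \<pi> Y"
      proof (cases "U \<inter> Y = {}")
        case True
        show ?thesis unfolding con_def
        proof (intro allI impI)
          fix c assume "splits c Y"
          then obtain g where g: "g \<in> F" "\<pi> g \<subseteq> Y" "splits c (\<pi> g)" using cY unfolding con_def by blast
          have "\<pi> g \<noteq> {}" using g(3) by auto
          then have "g \<noteq> e" using esU[OF e] g(2) True by blast
          with g show "\<exists>f\<in>F - {e}. \<pi> f \<subseteq> Y \<and> splits c (\<pi> f)" by blast
        qed
      next
        case False
        have "kcon b F \<pi> U" using conU'[of e F] F \<open>b\<close> by (auto simp: kcon_def)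
        then have UY: "U \<subseteq> Y"
          by (rule step_absorb[OF cluster_kcon plane_partition[OF qg] Ys _ inU False])
        show ?thesis
        proof (rule con_reroute[OF cY conU'[of e] UY])
          show "set es - {e} \<subseteq> F - {e}" using F by blast
          show "\<pi> g \<subseteq> U" if "g \<in> F" "g \<notin> F - {e}" for g using that esU[OF e] by simp
        qed
      qed
      with True show ?thesis by (simp add: kcon_def con_delete)
    next
      case False
      with kY show ?thesis by (simp add: kcon_def acon_delete)
    qed
  qed
  have D2: "\<pi> f = {} \<longleftrightarrow> (\<pi>(e := {})) f = {}"
    if e: "e \<in> set es" and i: "i < len \<pi>" "in_class (pl \<pi> i \<infinity>) U" "dec \<pi> i = Hyperedge f" for e i f
  proof -
    have "stage \<pi> (Suc i) 0 (\<pi> f \<noteq> {}) (E - {f}) i \<infinity>" using i(3) by (auto simp: stage_def)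
    then have "set es \<subseteq> E - {f}" using i by (intro esF) auto
    with e show ?thesis by auto
  qed
  have D3: "crossing P (\<pi> g) = crossing P ((\<pi>(e := {})) g)"
    if e: "e \<in> set es" and P: "partition_on V P" "in_class P U" for e P g
  proof (cases "g = e")
    case True
    have "\<not> crossing P (\<pi> e)" "\<not> crossing P {}"
      using in_class_not_crossing[OF P(1)] in_class_mono[OF P(2)] esU[OF e] by auto
    with True show ?thesis by simp
  qed simp
  show ?thesis
  proof (cases "\<exists>p. fst p \<le> len \<pi> \<and> \<not> in_class (pl \<pi> (fst p) (snd p)) U")
    case True
    \<comment> \<open>The first index at which \<open>U\<close> is separated, among the rows that
      occur in the signature.\<close>
    define p where "p = (LEAST p. fst p \<le> len \<pi> \<and> \<not> in_class (pl \<pi> (fst p) (snd p)) U)"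
    obtain s t where st: "p = (s, t)" by (cases p)
    have out: "s \<le> len \<pi>" "\<not> in_class (pl \<pi> s t) U"
      using LeastI_ex[OF True] st unfolding p_def[symmetric] by auto
    have inU: "in_class (pl \<pi> i j) U" if "(i, j) < (s, t)" for i j
    proof -
      have "i \<le> len \<pi>" using that out(1) by auto
      then show ?thesis 
        using not_less_Least[of "(i, j)" "\<lambda>p. fst p \<le> len \<pi> \<and> \<not> in_class (pl \<pi> (fst p) (snd p)) U"]
          that st unfolding p_def by simp
    qed
    \<comment> \<open>If every edge stayed within a class, connectedness of the cycle would keep
      \<open>U\<close> in one class.\<close>
    have "\<exists>e\<in>set es. \<not> in_class (pl \<pi> s t) (\<pi> e)"
    proof (rule ccontr)
      assume "\<not> ?thesis"
      then have "in_class (pl \<pi> s t) U"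
        by (intro in_class_con[OF plane_partition[OF qg] UV U0 conU]) auto
      with out(2) show False by simp
    qed
    then obtain e where e: "e \<in> set es" "\<not> in_class (pl \<pi> s t) (\<pi> e)" by blast
    let ?\<rho> = "\<pi>(e := {})"
    have "sig_less H leE leD \<pi> ?\<rho>"
    proof (rule sig_less_at[OF qg quasigraph_delete[OF qg] D1[OF e(1)] D2[OF e(1)] D3[OF e(1)] out(1) inU
          esU[OF e(1)] subset_trans[OF esU[OF e(1)] UV] e(2)])
      fix b F i' j' assume st: "stage \<pi> s t b F i' j'" and U: "in_class (pl \<pi> i' j') U"
      have F: "set es \<subseteq> F" by (rule esF[OF st out(1) U])
      have ps: "pl \<pi> s t = step (kcon b F \<pi>) (pl \<pi> i' j')" by (rule stage_plane[OF qg st])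
      have nb: "\<not> b"
      proof
        assume b
        then have "kcon b F \<pi> U" using conU'[of e F] F by (auto simp: kcon_def)
        then have "in_class (pl \<pi> s t) U"
          using step_in_class[OF finV plane_partition[OF qg] _ U] U0 unfolding ps by blast
        with out(2) show False ..
      qed
      have "card (\<pi> e) = 2" using qg esE[OF e(1)] unfolding quasigraph_def by blast
      then obtain x y where xy: "\<pi> e = {x, y}" by (auto simp: card_2_iff)
      have xyU: "x \<in> U" "y \<in> U" using esU[OF e(1)] xy by auto
      have "\<exists>Y\<in>pl \<pi> s t. z \<in> Y" if "z \<in> U" for z
        using plane_partition[OF qg, of s t] that UV unfolding partition_on_def by blast
      then obtain Y1 Y2 where Y: "Y1 \<in> pl \<pi> s t" "x \<in> Y1" "Y2 \<in> pl \<pi> s t" "y \<in> Y2"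
        using xyU by metis
      have aY: "acon (ends H) F ?\<rho> Z" if "Z \<in> pl \<pi> s t" for Z
      proof -
        have "kcon b F \<pi> Z" using that stepD unfolding ps by blast
        then show ?thesis using nb by (simp add: kcon_def acon_delete)
      qed
      \<comment> \<open>A colouring that is constant on \<open>Y1\<close> and on \<open>Y2\<close>
        but not on their union gives \<open>x\<close> and \<open>y\<close> different colours. Then
        \<open>e\<close> is the witness: it contains both, and its new value is empty.\<close>
      have "acon (ends H) F ?\<rho> (Y1 \<union> Y2)"
        unfolding acon_def
      proof (intro allI impI)
        fix c assume c: "splits c (Y1 \<union> Y2)"
        show "\<exists>f\<in>F. ?\<rho> f \<subseteq> Y1 \<union> Y2 \<and> \<not> splits c (?\<rho> f) \<and> splits c (ends H f \<inter> (Y1 \<union> Y2))"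
        proof (cases "splits c Y1 \<or> splits c Y2")
          case True
          then obtain Z where Z: "Z = Y1 \<or> Z = Y2" "splits c Z" by blast
          then have "acon (ends H) F ?\<rho> Z" using aY Y by blast
          then obtain f where f: "f \<in> F" "?\<rho> f \<subseteq> Z" "\<not> splits c (?\<rho> f)" "splits c (ends H f \<inter> Z)"
            using Z(2) unfolding acon_def by blast
          have "Z \<subseteq> Y1 \<union> Y2" using Z(1) by blast
          then have "splits c (ends H f \<inter> (Y1 \<union> Y2))" "?\<rho> f \<subseteq> Y1 \<union> Y2"
            using f(2) splits_mono[OF f(4)] by blast+
          with f show ?thesis by blast
        next
          case False
          then have c1: "c z = c x" if "z \<in> Y1" for z using that Y(2) unfolding splits_def by blast
          from False have c2: "c z = c y" if "z \<in> Y2" for z using that Y(4) unfolding splits_def by blast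
          have "c x \<noteq> c y"
          proof
            assume "c x = c y"
            then have "c z = c y" if "z \<in> Y1 \<union> Y2" for z using that c1 c2 by auto
            with c show False unfolding splits_def by simp
          qed
          moreover have "x \<in> ends H e" "y \<in> ends H e"
            using xy qg esE[OF e(1)] unfolding quasigraph_def by auto
          ultimately have "splits c (ends H e \<inter> (Y1 \<union> Y2))"
            using Y unfolding splits_def by blast
          moreover have "e \<in> F" using F e(1) by blast
          ultimately show ?thesis by (intro bexI[of _ e]) auto
        qed
      qed
      moreover have "in_class (pl \<pi> i' j') (Y1 \<union> Y2)"
      proof -
        obtain X where X: "X \<in> pl \<pi> i' j'" "U \<subseteq> X" using U unfolding in_class_def by blast
        have "Z \<subseteq> X" if Z: "Z \<in> pl \<pi> s t" "Z \<inter> U \<noteq> {}" for Z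
        proof -
          obtain X' where X': "X' \<in> pl \<pi> i' j'" "Z \<subseteq> X'"
            using Z(1) unfolding ps step_def by (auto dest: clustersD)
          have "X' \<inter> X \<noteq> {}" using Z(2) X'(2) X(2) by blast
          then have "X' = X" using partition_on_unique[OF plane_partition[OF qg] X'(1) X(1)] by simp
          with X'(2) show ?thesis by simp
        qed
        then have "Y1 \<union> Y2 \<subseteq> X" using Y xyU by blast
        with X(1) show ?thesis unfolding in_class_def by blast
      qed
      ultimately have "in_class (step (kcon b F ?\<rho>) (pl \<pi> i' j')) (Y1 \<union> Y2)"
        using step_in_class[OF finV plane_partition[OF qg], of "kcon b F ?\<rho>" "Y1 \<union> Y2" i' j'] nb Y(2)
        by (auto simp: kcon_def)
      then show "in_class (step (kcon b F ?\<rho>) (pl \<pi> i' j')) (\<pi> e)"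
        by (rule in_class_mono) (use xy Y in auto)
    qed
    then show ?thesis using quasigraph_delete[OF qg] by blast
  next
    case False
    then have inU: "in_class (pl \<pi> i j) U" if "i \<le> len \<pi>" for i j using that by fastforce
    obtain e where e: "e \<in> set es" using es by (cases es) auto
    let ?\<rho> = "\<pi>(e := {})"
    have "sig H leE \<pi> = sig H leE ?\<rho> \<or> sig_less H leE leD \<pi> ?\<rho>"
    proof (cases "sig H leE \<pi> = sig H leE ?\<rho>")
      case False
      then obtain p0 where p0: "sig H leE \<pi> p0 \<noteq> sig H leE ?\<rho> p0" by blast
      have "sig_less H leE leD \<pi> ?\<rho>"
      proof (rule sig_lessI[of p0])
        fix p assume p: "p \<le> p0" and eq: "\<And>q. q < p \<Longrightarrow> sig H leE \<pi> q = sig H leE ?\<rho> q"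
        obtain i b j where pij: "p = (i, b, j)" by (cases p)
        show "sig H leE \<pi> p = sig H leE ?\<rho> p \<or> entry_less V leD (sig H leE \<pi> p) (sig H leE ?\<rho> p)"
          unfolding pij
        proof (rule entry_compare[OF qg quasigraph_delete[OF qg], where U = U])
          show "kcon b' F ?\<rho> Y" if "stage \<pi> k l b' F i' j'" "k \<le> len \<pi>" "in_class (pl \<pi> i' j') U"
            "Y \<in> pl \<pi> k l" for b' F k l i' j' Y
            by (rule D1[OF e that])
          show "\<pi> f = {} \<longleftrightarrow> ?\<rho> f = {}"
            if "k < len \<pi>" "in_class (pl \<pi> k \<infinity>) U" "dec \<pi> k = Hyperedge f" for k f
            by (rule D2[OF e that])
          show "crossing P (\<pi> g) = crossing P (?\<rho> g)"
            if "partition_on V P" "in_class P U" for P g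
            by (rule D3[OF e that])
          show "sig H leE \<pi> q = sig H leE ?\<rho> q" if "q < (i, b, j)" for q using eq that pij by simp
          \<comment> \<open>Decisions before the last one are hyperedges, and the last one is
            \<open>TERMINATE\<close>.\<close>
          show "dec \<pi> i \<noteq> STOP" if "i \<le> len \<pi>"
            using that before_len[of i \<pi>] fin by (cases "i = len \<pi>") auto
        qed (rule inU)
      qed (use p0 in blast)
      then show ?thesis ..
    qed simp
    moreover have "sig_equiv H leE leD ?\<rho> \<pi> \<and> qsize H ?\<rho> < qsize H \<pi>" if "sig H leE \<pi> = sig H leE ?\<rho>"
    proof -
      have "used_hedges H ?\<rho> \<subset> used_hedges H \<pi>" using esE[OF e] by (auto simp: used_hedges_def)
      moreover have "finite (used_hedges H \<pi>)" using finE by (simp add: used_hedges_def)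
      ultimately have "qsize H ?\<rho> < qsize H \<pi>" unfolding qsize_def by (intro psubset_card_mono)
      then show ?thesis using that by (simp add: sig_equiv_def sig_le_def)
    qed
    ultimately show ?thesis using quasigraph_delete[OF qg] by blast
  qed
qed

section \<open>Using a weakly redundant leading hyperedge\<close>

text \<open>The hyperedge would have four vertices, one more than allowed.\<close>

lemma card_ends_disjoint:
  assumes "e \<in> E" "X \<inter> Y = {}" "2 \<le> card (ends H e \<inter> X)" "2 \<le> card (ends H e \<inter> Y)"
  shows False
proof -
  have "card ((ends H e \<inter> X) \<union> (ends H e \<inter> Y)) = card (ends H e \<inter> X) + card (ends H e \<inter> Y)"
    by (rule card_Un_disjoint) (use assms(2) fin_ends[OF assms(1)] in auto)
  moreover have "card ((ends H e \<inter> X) \<union> (ends H e \<inter> Y)) \<le> card (ends H e)"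
    by (intro card_mono fin_ends[OF assms(1)]) blast
  ultimately show False using assms(3,4) card_ends[OF assms(1)] by auto
qed

lemma two_le_cardI: "finite S \<Longrightarrow> x \<in> S \<Longrightarrow> y \<in> S \<Longrightarrow> x \<noteq> y \<Longrightarrow> 2 \<le> card S"
  by (auto simp: two_le_card_iff)

lemma weakly_redundant_deletable:
  assumes qg: "quasigraph H \<pi>" and wr: "weakly_redundant H \<pi> (pl \<pi> i \<infinity>) e" and X: "X \<in> pl \<pi> i \<infinity>"
  shows "kcon b (E - {e}) \<pi> X"
proof -
  let ?P = "pl \<pi> i \<infinity>"
  have part: "partition_on V ?P" by (rule plane_partition[OF qg])
  have e: "e \<in> E" "crossing ?P (ends H e)"
    using wr by (auto simp: weakly_redundant_def redundant_def)
  have con: "con E \<pi> X" and acon: "acon (ends H) E \<pi> X"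
    using plane_inf_kcon[OF qg X, of True] plane_inf_kcon[OF qg X, of False] by (simp_all add: kcon_def)
  have finX: "finite X" using partition_on_subset[OF part X] finV by (rule finite_subset)
  have two: "card (ends H e \<inter> X) = 2" if "2 \<le> card (ends H e \<inter> X)"
  proof (rule ccontr)
    assume "card (ends H e \<inter> X) \<noteq> 2"
    with that have "3 \<le> card (ends H e \<inter> X)" by simp
    then have "card (ends H e) \<le> card (ends H e \<inter> X)" using card_ends[OF e(1)] by auto
    then have "ends H e \<inter> X = ends H e" by (intro card_seteq fin_ends[OF e(1)]) auto
    then have "in_class ?P (ends H e)" using X unfolding in_class_def by blast
    with e(2) in_class_not_crossing[OF part] show False by blast
  qed
  have sub: "\<pi> e \<subseteq> ends H e" using qg e(1) unfolding quasigraph_def by blast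
  have conn: "connected_on H \<pi> X" "anticonnected_on H \<pi> X"
    using con acon by (simp_all add: connected_on_iff[OF qg] anticonnected_on_iff[OF finX])
  show ?thesis
  proof (cases b)
    case True
    have "con (E - {e}) \<pi> X"
    proof (cases "\<pi> e \<noteq> {} \<and> \<pi> e \<subseteq> X")
      case True
      then have "card (\<pi> e) = 2" using qg e(1) unfolding quasigraph_def by blast
      moreover have "card (\<pi> e) \<le> card (ends H e \<inter> X)"
        using sub True fin_ends[OF e(1)] by (intro card_mono) auto
      ultimately have "card (ends H e \<inter> X) = 2" using two by simp
      moreover have "\<not> set_bridge H \<pi> X e"
        using wr True X unfolding weakly_redundant_def redundant_def bridge_def by blast
      ultimately have "connected_on H (\<pi>(e := {})) X"
        using True conn e(1) unfolding set_bridge_def by blast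
      then show ?thesis by (simp add: connected_on_iff[OF quasigraph_delete[OF qg]] con_delete)
    next
      case False
      then show ?thesis
        using con unfolding con_def by (metis DiffI empty_iff insert_iff splits_empty)
    qed
    with True show ?thesis by (simp add: kcon_def)
  next
    case False
    have "acon (ends H) (E - {e}) \<pi> X"
    proof (cases "\<pi> e = {} \<and> 2 \<le> card (ends H e \<inter> X)")
      case True
      then have "redundant H \<pi> ?P e" using wr unfolding weakly_redundant_def by blast
      then have "\<not> set_antibridge H \<pi> X e" using X unfolding redundant_def antibridge_def by blast
      then have "anticonnected_on (delete_hedge H e) \<pi> X"
        using True two conn e(1) unfolding set_antibridge_def by blast
      then show ?thesis by (simp add: anticonnected_on_iff[OF finX])
    next
      case False
      show ?thesis
        unfolding acon_def
      proof (intro allI impI)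
        fix c assume "splits c X"
        then obtain g where g: "g \<in> E" "\<pi> g \<subseteq> X" "\<not> splits c (\<pi> g)" "splits c (ends H g \<inter> X)"
          using acon unfolding acon_def by blast
        \<comment> \<open>If \<open>e\<close> is used with its pair inside \<open>X\<close>, the
          pair consists of both vertices of \<open>e\<close> in \<open>X\<close>, so these cannot be
          split while the pair is monochromatic.\<close>
        have "g \<noteq> e"
        proof
          assume ge: "g = e"
          have fin: "finite (ends H e \<inter> X)" using finX by simp
          then have c2: "2 \<le> card (ends H e \<inter> X)" using g(4) ge splits_card_ge_2 by blast
          with False have "\<pi> e \<noteq> {}" by blast
          then have "card (\<pi> e) = 2" using qg e(1) unfolding quasigraph_def by blast
          then have "\<pi> e = ends H e \<inter> X"
            using two[OF c2] sub g(2) ge fin by (intro card_seteq) auto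
          with g(3,4) ge show False by simp
        qed
        with g show "\<exists>f\<in>E - {e}. \<pi> f \<subseteq> X \<and> \<not> splits c (\<pi> f) \<and> splits c (ends H f \<inter> X)" by blast
      qed
    qed
    with False show ?thesis by (simp add: kcon_def)
  qed
qed

text \<open>The index \<open>(l, \<infinity>)\<close> already separates \<open>A\<close> from
  \<open>B\<close>, so the least such index exists and does not exceed it.\<close>

lemma exposure_step_bounded:
  assumes qg: "quasigraph H \<pi>" and AB: "A \<in> pl \<pi> l \<infinity>" "B \<in> pl \<pi> l \<infinity>" "A \<noteq> B"
    and p: "exposure_step (history H leE \<pi> l) {A, B} = (s, t)"
  shows "s \<le> l" "in_different_classes (pl \<pi> s t) A B \<or> in_different_classes (pl \<pi> s t) B A"
proof -
  let ?S = "\<lambda>p. \<exists>A' B'. {A, B} = {A', B'} \<and>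
    in_different_classes (history H leE \<pi> l (fst p) (snd p)) A' B'"
  have "in_different_classes (pl \<pi> l \<infinity>) A B" using AB unfolding in_different_classes_def by blast
  then have S: "?S (l, \<infinity>)" by (auto simp: history_plane)
  have "(s, t) \<le> (l, \<infinity>)" using Least_le[of ?S, OF S] p by (simp add: exposure_step_def)
  then show s: "s \<le> l" by auto
  have "?S (s, t)" using LeastI[of ?S, OF S] p by (simp add: exposure_step_def)
  then show "in_different_classes (pl \<pi> s t) A B \<or> in_different_classes (pl \<pi> s t) B A"
    using s by (auto simp: history_plane min_def doubleton_eq_iff)
qed

lemma before_exposure_step:
  assumes "(i, j) < exposure_step (history H leE \<pi> l) {A, B}" "i \<le> l"
  shows "\<not> in_different_classes (pl \<pi> i j) A B"
proof
  assume "in_different_classes (pl \<pi> i j) A B"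
  then have "\<exists>A' B'. {A, B} = {A', B'} \<and>
      in_different_classes (history H leE \<pi> l (fst (i, j)) (snd (i, j))) A' B'"
    using assms(2) by (auto simp: history_plane min_def)
  then have "exposure_step (history H leE \<pi> l) {A, B} \<le> (i, j)"
    unfolding exposure_step_def by (rule Least_le)
  with assms(1) show False by simp
qed

lemma improve_stop:
  assumes qg: "quasigraph H \<pi>" and stop: "dec \<pi> (len \<pi>) = STOP"
  shows "\<exists>\<rho>. quasigraph H \<rho> \<and> sig_less H leE leD \<pi> \<rho>"
proof -
  define l where "l = len \<pi>"
  define P where "P = pl \<pi> l \<infinity>"
  define K where "K = unused_quot H \<pi> P"
  define Q where "Q = history H leE \<pi> l"
  have part: "partition_on V P" unfolding P_def by (rule plane_partition[OF qg])
  have "\<exists>e\<in>leading_hedges H \<pi> Q P. weakly_redundant H \<pi> P e"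
    using stop unfolding decision_at_def decide_def Q_def P_def l_def by (auto split: if_splits)
  then obtain e \<gamma> where wr: "weakly_redundant H \<pi> P e" and qc: "quasicycle K \<gamma>"
      and eu: "e \<in> used_hedges K \<gamma>" and eQ: "exposure_step Q (\<gamma> e) = quasicycle_exposure_step Q K \<gamma>"
    unfolding leading_hedges_def K_def by blast
  obtain vs es where cyc: "is_cycle (multigraph_of K \<gamma>) vs es" and es: "set es = used_hedges K \<gamma>"
    using qc unfolding quasicycle_def by (auto simp: multigraph_of_def)
  have qgK: "quasigraph K \<gamma>" using qc by (simp add: quasicycle_def)
  have vsP: "set vs \<subseteq> P"
    using cyc by (simp add: is_cycle_def multigraph_of_def K_def unused_quot_def unused_part_def quot_hypergraph_def)
  have edge: "\<exists>A B. \<gamma> g = {A, B} \<and> A \<noteq> B \<and> A \<in> set vs \<and> B \<in> set vs \<and>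
      A \<inter> ends H g \<noteq> {} \<and> B \<inter> ends H g \<noteq> {}" if g: "g \<in> set es" for g
  proof -
    have gK: "g \<in> hedges K" "\<gamma> g \<noteq> {}" using g es by (auto simp: used_hedges_def)
    then have sub: "\<gamma> g \<subseteq> ends K g" and "card (\<gamma> g) = 2" using qgK unfolding quasigraph_def by auto
    then obtain A B where AB: "\<gamma> g = {A, B}" "A \<noteq> B" by (auto simp: card_2_iff)
    have "ends K g = quot P (ends H g)"
      by (simp add: K_def unused_quot_def unused_part_def quot_hypergraph_def)
    with sub AB(1) have "A \<inter> ends H g \<noteq> {}" "B \<inter> ends H g \<noteq> {}" by (auto simp: quot_def)
    moreover have "\<gamma> g \<subseteq> set vs"
    proof -
      obtain i where i: "i < length vs" "g = es ! i"
        using g cyc by (metis in_set_conv_nth is_cycle_def)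
      have "Suc i mod length vs < length vs" using i by (intro mod_less_divisor) linarith
      then show ?thesis using i cyc by (simp add: is_cycle_def multigraph_of_def)
    qed
    ultimately show ?thesis using AB by blast
  qed
  have edge_vs: "\<gamma> g \<subseteq> set vs" if g: "g \<in> set es" for g
  proof -
    obtain A B where "\<gamma> g = {A, B}" "A \<in> set vs" "B \<in> set vs" using edge[OF g] by metis
    then show ?thesis by simp
  qed
  have esE: "g \<in> E \<and> \<not> crossing P (\<pi> g)" if "g \<in> set es" for g
    using used_unused_quot[of g \<pi> P \<gamma>] that es K_def by blast
  define U where "U = \<Union> (set vs)"
  have UV: "U \<subseteq> V" using vsP partition_on_subset[OF part] unfolding U_def by blast
  have classU: "C \<subseteq> U" if "C \<in> set vs" for C using that unfolding U_def by blast
  have disj: "C = D" if "C \<in> P" "D \<in> P" "C \<inter> D \<noteq> {}" for C D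
    using partition_on_unique[OF part that] .
  \<comment> \<open>A pair in a third class would take two vertices of \<open>g\<close> besides one
    in each of the two classes of \<open>\<gamma> g\<close>, four in all.\<close>
  have \<pi>_class: "\<exists>C\<in>\<gamma> g. \<pi> g \<subseteq> C" if g: "g \<in> set es" and ne: "\<pi> g \<noteq> {}" for g
  proof -
    have gE: "g \<in> E" using esE[OF g] by simp
    have \<pi>g: "\<pi> g \<subseteq> ends H g" "card (\<pi> g) = 2" using qg gE ne unfolding quasigraph_def by auto
    have "in_class P (\<pi> g)"
      by (rule not_crossing_in_class[OF finV part _ ne])
        (use \<pi>g(1) ends_subset[OF gE] esE[OF g] in auto)
    then obtain C where C: "C \<in> P" "\<pi> g \<subseteq> C" unfolding in_class_def by blast
    obtain A B where AB: "\<gamma> g = {A, B}" "A \<noteq> B" "A \<in> set vs" "B \<in> set vs"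
        "A \<inter> ends H g \<noteq> {}" "B \<inter> ends H g \<noteq> {}" using edge[OF g] by blast
    have "C = A \<or> C = B"
    proof (rule ccontr)
      assume neg: "\<not> (C = A \<or> C = B)"
      have ABP: "A \<in> P" "B \<in> P" using AB vsP by auto
      have d: "C \<inter> A = {}" "C \<inter> B = {}" "A \<inter> B = {}"
        using disj C(1) ABP neg AB(2) by blast+
      obtain a b where ab: "a \<in> A" "a \<in> ends H g" "b \<in> B" "b \<in> ends H g" using AB by blast
      have "a \<noteq> b" using ab d(3) by blast
      then have "2 \<le> card (ends H g \<inter> (A \<union> B))"
        using ab by (intro two_le_cardI[of _ a b]) (auto simp: fin_ends[OF gE])
      moreover have "2 \<le> card (ends H g \<inter> C)"
        using card_mono[of "ends H g \<inter> C" "\<pi> g"] \<pi>g C(2) fin_ends[OF gE] by simp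
      moreover have "(A \<union> B) \<inter> C = {}" using d by blast
      ultimately show False by (metis card_ends_disjoint[OF gE])
    qed
    with C AB(1) show ?thesis by blast
  qed
  have \<pi>U: "\<pi> g \<subseteq> U" if g: "g \<in> set es" for g
  proof (cases "\<pi> g = {}")
    case False
    then obtain C where "C \<in> \<gamma> g" "\<pi> g \<subseteq> C" using \<pi>_class[OF g] by blast
    moreover have "\<gamma> g \<subseteq> set vs" by (rule edge_vs[OF g])
    ultimately show ?thesis using classU by blast
  qed simp
  \<comment> \<open>\<open>h\<close> is the one hyperedge of the quasicycle that may be absent from
    \<open>F\<close>. Colourings that split a class are handled by \<open>cl\<close>; the others
    become colourings of the cycle in the quotient.\<close>
  have aconU: "acon (ends H) F \<pi> U"
    if cl: "\<And>X. X \<in> P \<Longrightarrow> acon (ends H) F \<pi> X" and F: "set es - {h} \<subseteq> F" for F h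
    unfolding acon_def
  proof (intro allI impI)
    fix c assume c: "splits c U"
    show "\<exists>g\<in>F. \<pi> g \<subseteq> U \<and> \<not> splits c (\<pi> g) \<and> splits c (ends H g \<inter> U)"
    proof (cases "\<exists>X\<in>set vs. splits c X")
      case True
      then obtain X where X: "X \<in> set vs" "splits c X" by blast
      then obtain g where g: "g \<in> F" "\<pi> g \<subseteq> X" "\<not> splits c (\<pi> g)" "splits c (ends H g \<inter> X)"
        using cl[of X] vsP unfolding acon_def by blast
      have "splits c (ends H g \<inter> U)" by (rule splits_mono[OF g(4)]) (use classU[OF X(1)] in blast)
      with g classU[OF X(1)] show ?thesis by blast
    next
      case False
      \<comment> \<open>Each class on the cycle is monochromatic here, so its image is a singleton
        and \<open>c'\<close> colours the classes as vertices of the cycle.\<close>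
      define c' where "c' X = c ` X" for X
      have const: "c' X = {c x}" if "X \<in> set vs" "x \<in> X" for X x
        using False that unfolding c'_def splits_def by blast
      obtain x y where xy: "x \<in> U" "y \<in> U" "c x \<noteq> c y" using c unfolding splits_def by blast
      then obtain X Y where XY: "X \<in> set vs" "x \<in> X" "Y \<in> set vs" "y \<in> Y" unfolding U_def by blast
      then have "splits c' (set vs)" using const[OF XY(1,2)] const[OF XY(3,4)] xy(3)
        unfolding splits_def by (metis singleton_inject)
      then obtain g where g: "g \<in> set es - {h}" "splits c' (\<gamma> g)"
        using cycle_con[OF cyc, of h] unfolding con_def by (auto simp: multigraph_of_def)
      then have ges: "g \<in> set es" by blast
      obtain A B where AB: "\<gamma> g = {A, B}" "A \<noteq> B" "A \<in> set vs" "B \<in> set vs"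
          "A \<inter> ends H g \<noteq> {}" "B \<inter> ends H g \<noteq> {}" using edge[OF ges] by blast
      obtain a b where ab: "a \<in> A" "a \<in> ends H g" "b \<in> B" "b \<in> ends H g" using AB by blast
      have "c' A \<noteq> c' B" using g(2) AB(1) by (auto simp: splits_def)
      then have "c a \<noteq> c b" using const[OF AB(3) ab(1)] const[OF AB(4) ab(3)] by simp
      then have "splits c (ends H g \<inter> U)"
        unfolding splits_def using ab classU[OF AB(3)] classU[OF AB(4)] by blast
      moreover have "\<not> splits c (\<pi> g)"
      proof (cases "\<pi> g = {}")
        case ne: False
        obtain C where C: "C \<in> \<gamma> g" "\<pi> g \<subseteq> C" using \<pi>_class[OF ges ne] by blast
        then have "C \<in> set vs" using AB by auto
        with False C(2) show ?thesis using splits_mono by blast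
      qed simp
      ultimately show ?thesis using g(1) F \<pi>U[OF ges] by blast
    qed
  qed
  have e: "e \<in> set es" using eu es by simp
  have eE: "e \<in> E" using esE[OF e] by simp
  obtain A B where AB: "\<gamma> e = {A, B}" "A \<noteq> B" "A \<in> set vs" "B \<in> set vs"
      "A \<inter> ends H e \<noteq> {}" "B \<inter> ends H e \<noteq> {}" using edge[OF e] by blast
  obtain u v where uv: "u \<in> A" "u \<in> ends H e" "v \<in> B" "v \<in> ends H e" using AB by blast
  have ABP: "A \<in> P" "B \<in> P" using AB vsP by auto
  have "u \<noteq> v" using uv disj[OF ABP] AB(2) by blast
  have uvU: "{u, v} \<subseteq> U" using uv classU[OF AB(3)] classU[OF AB(4)] by blast
  \<comment> \<open>The new pair takes one vertex of \<open>e\<close> in each of the two classes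
    joined by \<open>\<gamma> e\<close>. A pair already carried by \<open>e\<close> lies inside a
    class and is given up.\<close>
  define \<rho> where "\<rho> = \<pi>(e := {u, v})"
  have \<rho>e: "\<rho> e = {u, v}" and \<rho>o: "\<And>g. g \<noteq> e \<Longrightarrow> \<rho> g = \<pi> g" by (simp_all add: \<rho>_def)
  have qg\<rho>: "quasigraph H \<rho>"
    using qg uv \<open>u \<noteq> v\<close> by (auto simp: quasigraph_def \<rho>_def)
  have clE: "kcon b (E - {e}) \<pi> X" if "X \<in> P" for b X
    using weakly_redundant_deletable[OF qg _ that[unfolded P_def]] wr unfolding P_def .

  obtain s t where st: "exposure_step Q (\<gamma> e) = (s, t)" by (cases "exposure_step Q (\<gamma> e)")
  have st': "exposure_step (history H leE \<pi> l) {A, B} = (s, t)" using st AB(1) by (simp add: Q_def)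
  have sl: "s \<le> l"
    by (rule exposure_step_bounded(1)[OF qg ABP[unfolded P_def] AB(2) st'])
  have out: "\<not> in_class (pl \<pi> s t) (A \<union> B)"
  proof
    assume "in_class (pl \<pi> s t) (A \<union> B)"
    then obtain X where X: "X \<in> pl \<pi> s t" "A \<union> B \<subseteq> X" unfolding in_class_def by blast
    have "A \<noteq> {}" "B \<noteq> {}" using uv by auto
    moreover have "X' = X" if "X' \<in> pl \<pi> s t" "X' \<inter> X \<noteq> {}" for X'
      using partition_on_unique[OF plane_partition[OF qg] that(1) X(1) that(2)] .
    ultimately show False
      using exposure_step_bounded(2)[OF qg ABP[unfolded P_def] AB(2) st'] X(2)
      unfolding in_different_classes_def by blast
  qed
  \<comment> \<open>As \<open>e\<close> is leading, no hyperedge of the quasicycle is exposed before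
    \<open>(s, t)\<close>; so consecutive classes on it, and hence all of them, lie in a common
    class until then.\<close>
  have inU: "in_class (pl \<pi> i j) U" if ij: "(i, j) < (s, t)" for i j
  proof -
    have il: "i \<le> l" using ij sl by auto
    then have "(i, j) \<le> (l, \<infinity>)" by auto
    then have ref: "refines V P (pl \<pi> i j)" unfolding P_def by (rule plane_antimono[OF qg])
    \<comment> \<open>The set of current classes above \<open>C\<close>, a singleton for classes on
      the quasicycle: again a colouring of the cycle.\<close>
    define c where "c C = {X \<in> pl \<pi> i j. C \<subseteq> X}" for C
    have "\<not> splits c (\<gamma> g)" if g: "g \<in> set es" for g
    proof -
      obtain C D where CD: "\<gamma> g = {C, D}" "C \<in> set vs" "D \<in> set vs" using edge[OF g] by metis
      have fin: "finite ((\<lambda>e. exposure_step Q (\<gamma> e)) ` used_hedges K \<gamma>)"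
        using finite_used unfolding K_def by blast
      have "quasicycle_exposure_step Q K \<gamma> \<le> exposure_step Q (\<gamma> g)"
        unfolding quasicycle_exposure_step_def by (rule Min_le[OF fin]) (use g es in auto)
      then have le: "(s, t) \<le> exposure_step Q (\<gamma> g)" using eQ st by simp
      have lt: "(i, j) < exposure_step Q (\<gamma> g)" by (rule less_le_trans[OF ij le])
      then have nd: "\<not> in_different_classes (pl \<pi> i j) C D"
        using before_exposure_step[of i j \<pi> l C D] CD(1) il by (simp add: Q_def)
      have CDP: "C \<in> P" "D \<in> P" using CD vsP by auto
      obtain X Y where X: "X \<in> pl \<pi> i j" "C \<subseteq> X" and Y: "Y \<in> pl \<pi> i j" "D \<subseteq> Y"
        using ref CDP unfolding refines_def by metis
      have "X = Y" using nd X Y unfolding in_different_classes_def by blast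
      have ne: "C \<noteq> {}" "D \<noteq> {}" using CDP partition_onD3[OF part] by auto
      have only: "c Z = {X}" if Z: "Z = C \<or> Z = D" for Z
      proof -
        have ZX: "Z \<subseteq> X" "Z \<noteq> {}" using Z X Y \<open>X = Y\<close> ne by auto
        have "W = X" if "W \<in> pl \<pi> i j" "Z \<subseteq> W" for W
          using partition_on_unique[OF plane_partition[OF qg] that(1) X(1)] that(2) ZX by blast
        then show ?thesis using X(1) ZX(1) unfolding c_def by blast
      qed
      show ?thesis unfolding CD(1) splits_def using only by simp
    qed
    then have ns: "\<not> splits c (set vs)"
      using cycle_con[OF cyc, of e] unfolding con_def by (auto simp: multigraph_of_def)
    obtain X where X: "X \<in> pl \<pi> i j" "A \<subseteq> X" using ref ABP unfolding refines_def by blast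
    have "C \<subseteq> X" if C: "C \<in> set vs" for C
    proof -
      have "c C = c A" using ns C AB(3) unfolding splits_def by blast
      then have "X \<in> c C" using X unfolding c_def by simp
      then show ?thesis unfolding c_def by simp
    qed
    then have "U \<subseteq> X" unfolding U_def by blast
    with X(1) show ?thesis unfolding in_class_def by blast
  qed

  \<comment> \<open>What stays together when \<open>e\<close> is deleted on top of a hyperedge
    deleted by a decision: each class of \<open>P\<close> for components, all of \<open>U\<close>
    for anticomponents. These are the detours around \<open>e\<close>.\<close>
  have stF: "e \<in> F \<and> (if b then \<forall>X\<in>P. con (F - {e}) \<pi> X else acon (ends H) (F - {e}) \<pi> U)"
    if sta: "stage \<pi> i j b F i' j'" and i: "i \<le> l" and U: "in_class (pl \<pi> i' j') U"
    for i j b F i' j'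
  proof (cases "F = E")
    case True
    have "con (E - {e}) \<pi> X" "acon (ends H) (E - {e}) \<pi> X" if "X \<in> P" for X
      using clE[OF that, of True] clE[OF that, of False] by (simp_all add: kcon_def)
    moreover have "set es - {e} \<subseteq> E - {e}" using esE by blast
    ultimately show ?thesis using True eE aconU[of "E - {e}" e] by simp
  next
    case False
    then obtain f where f: "dec \<pi> i' = Hyperedge f" "F = E - {f}" "j' = \<infinity>" "i = Suc i'" "b = (\<pi> f \<noteq> {})"
      using sta unfolding stage_def by blast
    have fE: "f \<in> E" by (rule dec_Hyperedge(5)[OF f(1)])
    have i'l: "i' < l" using f(4) i by simp
    have torn: "if \<pi> f = {} then card (ends H f \<inter> X) \<le> 1 else \<not> \<pi> f \<subseteq> X" if "X \<in> P" for X
      using dec_Hyperedge_torn[OF qg f(1) _ i'l] that unfolding P_def by blast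
    have not_f: "acon (ends H) (G - {f}) \<pi> X"
      if f0: "\<pi> f = {}" and X: "X \<in> P" and aX: "acon (ends H) G \<pi> X" for G X
      unfolding acon_def
    proof (intro allI impI)
      fix c assume "splits c X"
      then obtain g where g: "g \<in> G" "\<pi> g \<subseteq> X" "\<not> splits c (\<pi> g)" "splits c (ends H g \<inter> X)"
        using aX unfolding acon_def by blast
      have "g \<noteq> f"
        using splits_card_ge_2[OF g(4)] torn[OF X] f0 fin_ends[OF fE] by auto
      with g show "\<exists>g\<in>G - {f}. \<pi> g \<subseteq> X \<and> \<not> splits c (\<pi> g) \<and> splits c (ends H g \<inter> X)" by blast
    qed
    have fes: "f \<notin> set es"
    proof
      assume f_es: "f \<in> set es"
      show False
      proof (cases "\<pi> f = {}")
        case True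
        obtain X where X: "X \<in> pl \<pi> i' \<infinity>" "card (ends H f \<inter> X) = 2" "\<not> kcon (\<pi> f \<noteq> {}) (E - {f}) \<pi> X"
          using dec_Hyperedge_class[OF qg f(1)] by metis
        obtain X' where X': "X' \<in> pl \<pi> i' \<infinity>" "U \<subseteq> X'" using U f(3) unfolding in_class_def by blast
        obtain C D where CD: "C \<noteq> D" "C \<in> set vs" "D \<in> set vs"
          "C \<inter> ends H f \<noteq> {}" "D \<inter> ends H f \<noteq> {}" using edge[OF f_es] by blast
        obtain x y where xy: "x \<in> C" "x \<in> ends H f" "y \<in> D" "y \<in> ends H f" using CD by blast
        have "x \<noteq> y" using xy disj[of C D] CD vsP by blast
        then have c2: "2 \<le> card (ends H f \<inter> U)"
          using xy classU[OF CD(2)] classU[OF CD(3)] fin_ends[OF fE] by (intro two_le_cardI[of _ x y]) auto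
        have "card (ends H f \<inter> U) \<le> card (ends H f \<inter> X')"
          using X'(2) fin_ends[OF fE] by (intro card_mono) auto
        then have "X \<inter> X' \<noteq> {}" using card_ends_disjoint[OF fE, of X X'] X(2) c2 by auto
        then have UX: "U \<subseteq> X" using partition_on_unique[OF plane_partition[OF qg] X(1) X'(1)] X'(2) by simp
        then have "ends H f \<inter> U \<subseteq> ends H f \<inter> X" by blast
        \<comment> \<open>\<open>f\<close> has exactly two vertices in \<open>X\<close> and at least
          two in \<open>U\<close>, which lies in \<open>X\<close>; so they are the same two.\<close>
        then have endsU: "ends H f \<inter> X \<subseteq> U"
          using card_seteq[of "ends H f \<inter> X" "ends H f \<inter> U"] c2 X(2) fin_ends[OF fE] by auto
        have aU: "acon (ends H) (E - {f}) \<pi> U"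
        proof (rule aconU[of _ f])
          show "acon (ends H) (E - {f}) \<pi> Z" if "Z \<in> P" for Z
            using not_f[OF True that] plane_inf_kcon[OF qg that[unfolded P_def], of False]
            by (simp add: kcon_def)
          show "set es - {f} \<subseteq> E - {f}" using esE by blast
        qed
        have "acon (ends H) (E - {f}) \<pi> X"
          unfolding acon_def
        proof (intro allI impI)
          fix c assume c: "splits c X"
          show "\<exists>g\<in>E - {f}. \<pi> g \<subseteq> X \<and> \<not> splits c (\<pi> g) \<and> splits c (ends H g \<inter> X)"
          proof (cases "splits c U")
            case True
            then obtain g where g: "g \<in> E - {f}" "\<pi> g \<subseteq> U" "\<not> splits c (\<pi> g)" "splits c (ends H g \<inter> U)"
              using aU unfolding acon_def by blast
            have "splits c (ends H g \<inter> X)" by (rule splits_mono[OF g(4)]) (use UX in blast)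
            with g UX show ?thesis by blast
          next
            case False
            have "acon (ends H) E \<pi> X" using plane_inf_kcon[OF qg X(1), of False] by (simp add: kcon_def)
            then obtain g where g: "g \<in> E" "\<pi> g \<subseteq> X" "\<not> splits c (\<pi> g)" "splits c (ends H g \<inter> X)"
              using c unfolding acon_def by blast
            have "g \<noteq> f" using g(4) False splits_mono[OF _ endsU] by blast
            with g show ?thesis by blast
          qed
        qed
        with X(3) True show False by (simp add: kcon_def)
      next
        case False
        then obtain C where "C \<in> \<gamma> f" "\<pi> f \<subseteq> C" using \<pi>_class[OF f_es] by blast
        moreover have "\<gamma> f \<subseteq> P" using edge_vs[OF f_es] vsP by blast
        ultimately show False using torn False by auto
      qed
    qed
    have eF: "e \<in> F" using e fes f(2) eE by blast
    have eq: "F - {e} = (E - {e}) - {f}" using f(2) by blast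
    show ?thesis
    proof (cases "\<pi> f = {}")
      case True
      have "acon (ends H) (F - {e}) \<pi> U"
      proof (rule aconU[of _ e])
        show "acon (ends H) (F - {e}) \<pi> X" if "X \<in> P" for X
          unfolding eq using not_f[OF True that] clE[OF that, of False] by (simp add: kcon_def)
        show "set es - {e} \<subseteq> F - {e}" using esE fes f(2) by blast
      qed
      with eF f(5) True show ?thesis by simp
    next
      case False
      have "con (F - {e}) \<pi> X" if X: "X \<in> P" for X
        unfolding con_def
      proof (intro allI impI)
        fix c assume "splits c X"
        moreover have "con (E - {e}) \<pi> X" using clE[OF X, of True] by (simp add: kcon_def)
        ultimately obtain g where g: "g \<in> E - {e}" "\<pi> g \<subseteq> X" "splits c (\<pi> g)" unfolding con_def by blast
        have "g \<noteq> f" using torn[OF X] False g(2) by auto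
        with g eq show "\<exists>f\<in>F - {e}. \<pi> f \<subseteq> X \<and> splits c (\<pi> f)" by blast
      qed
      with eF f(5) False show ?thesis by simp
    qed
  qed

  have "sig_less H leE leD \<pi> \<rho>"
  proof (rule sig_less_at[OF qg qg\<rho>, where U = U and S = "A \<union> B" and s = s and t = t])
    show "s \<le> len \<pi>" using sl by (simp add: l_def)
    show "A \<union> B \<subseteq> U" using classU[OF AB(3)] classU[OF AB(4)] by blast
    then show "A \<union> B \<subseteq> V" using UV by blast
    show "\<not> in_class (pl \<pi> s t) (A \<union> B)" by (rule out)
    show "in_class (pl \<pi> i j) U" if "(i, j) < (s, t)" for i j by (rule inU[OF that])
    show "\<pi> f = {} \<longleftrightarrow> \<rho> f = {}"
      if i: "i < len \<pi>" and U: "in_class (pl \<pi> i \<infinity>) U" and f: "dec \<pi> i = Hyperedge f" for i f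
    proof -
      have sta: "stage \<pi> (Suc i) 0 (\<pi> f \<noteq> {}) (E - {f}) i \<infinity>" using f by (auto simp: stage_def)
      have "e \<in> E - {f}" using stF[OF sta _ U] i by (simp add: l_def)
      then show ?thesis using \<rho>o by auto
    qed
    show "crossing P' (\<pi> g) = crossing P' (\<rho> g)" if P': "partition_on V P'" "in_class P' U" for P' g
    proof (cases "g = e")
      case True
      have "\<not> crossing P' (\<pi> e)" "\<not> crossing P' (\<rho> e)"
        using in_class_not_crossing[OF P'(1)] in_class_mono[OF P'(2)] \<pi>U[OF e] uvU \<rho>e by auto
      with True show ?thesis by simp
    qed (simp add: \<rho>o)
    show "kcon b F \<rho> Y"
      if sta: "stage \<pi> i j b F i' j'" and i: "i \<le> len \<pi>" and U: "in_class (pl \<pi> i' j') U"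
        and Y: "Y \<in> pl \<pi> i j" for b F i j i' j' Y
    proof -
      have Ys: "Y \<in> step (kcon b F \<pi>) (pl \<pi> i' j')" using Y stage_plane[OF qg sta] by simp
      have kY: "kcon b F \<pi> Y" using Ys stepD by blast
      have F: "e \<in> F" "if b then \<forall>X\<in>P. con (F - {e}) \<pi> X else acon (ends H) (F - {e}) \<pi> U"
        using stF[OF sta _ U] i by (simp_all add: l_def)
      have absorb: "S \<subseteq> Y" if "kcon b (F - {e}) \<pi> S" "S \<subseteq> U" "S \<inter> Y \<noteq> {}" for S
        by (rule step_absorb[OF cluster_kcon plane_partition[OF qg] Ys kcon_mono[OF that(1)] in_class_mono[OF U that(2)] that(3)])
          blast
      show ?thesis
      proof (cases b)
        case True
        have "con F \<rho> Y"
          unfolding con_def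
        proof (intro allI impI)
          fix c assume "splits c Y"
          moreover have "con F \<pi> Y" using kY True by (simp add: kcon_def)
          ultimately obtain g where g: "g \<in> F" "\<pi> g \<subseteq> Y" "splits c (\<pi> g)" unfolding con_def by blast
          show "\<exists>f\<in>F. \<rho> f \<subseteq> Y \<and> splits c (\<rho> f)"
          proof (cases "g = e")
            case False
            with g \<rho>o[OF False] show ?thesis by (intro bexI[of _ g]) simp_all
          next
            case ge: True
            \<comment> \<open>The old pair of \<open>e\<close> was the witness. The class
              \<open>C\<close> containing it is connected without \<open>e\<close>, hence lies in
              \<open>Y\<close> and supplies another pair.\<close>
            have ne: "\<pi> e \<noteq> {}" using g(3) ge by auto
            then obtain C where C: "C \<in> \<gamma> e" "\<pi> e \<subseteq> C" using \<pi>_class[OF e] by blast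
            have Cvs: "C \<in> set vs" using C(1) AB by auto
            have conC: "con (F - {e}) \<pi> C" using F(2) True Cvs vsP by auto
            have "C \<subseteq> Y"
              by (rule absorb) (use conC True classU[OF Cvs] C(2) g(2) ge ne in \<open>auto simp: kcon_def\<close>)
            moreover have "splits c C" using splits_mono[OF g(3)] C(2) ge by simp
            then obtain g' where g': "g' \<in> F - {e}" "\<pi> g' \<subseteq> C" "splits c (\<pi> g')"
              using conC unfolding con_def by blast
            moreover have "\<rho> g' = \<pi> g'" using g'(1) \<rho>o by blast
            ultimately show ?thesis by (intro bexI[of _ g']) auto
          qed
        qed
        with True show ?thesis by (simp add: kcon_def)
      next
        case False
        have aU: "acon (ends H) (F - {e}) \<pi> U" using F(2) False by simp
        have "acon (ends H) F \<rho> Y"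
          unfolding acon_def
        proof (intro allI impI)
          fix c assume "splits c Y"
          moreover have "acon (ends H) F \<pi> Y" using kY False by (simp add: kcon_def)
          ultimately obtain g where g: "g \<in> F" "\<pi> g \<subseteq> Y" "\<not> splits c (\<pi> g)" "splits c (ends H g \<inter> Y)"
            unfolding acon_def by blast
          show "\<exists>f\<in>F. \<rho> f \<subseteq> Y \<and> \<not> splits c (\<rho> f) \<and> splits c (ends H f \<inter> Y)"
          proof (cases "g = e")
            case False
            with g \<rho>o[OF False] show ?thesis by (intro bexI[of _ g]) simp_all
          next
            case ge: True
            \<comment> \<open>Both \<open>Y\<close> and \<open>U\<close> contain two vertices of
              \<open>e\<close>, so they meet; as \<open>U\<close> is anticonnected without
              \<open>e\<close>, it lies in \<open>Y\<close>.\<close>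
            have "2 \<le> card (ends H e \<inter> Y)"
              using splits_card_ge_2[OF g(4)] fin_ends[OF eE] ge by simp
            moreover have "2 \<le> card (ends H e \<inter> U)"
              using uv uvU \<open>u \<noteq> v\<close> fin_ends[OF eE] by (intro two_le_cardI[of _ u v]) auto
            ultimately have "U \<inter> Y \<noteq> {}" using card_ends_disjoint[OF eE, of U Y] by blast
            then have UY: "U \<subseteq> Y" using absorb[of U] aU False by (simp add: kcon_def)
            show ?thesis
            proof (cases "splits c U")
              case True
              then obtain g' where g': "g' \<in> F - {e}" "\<pi> g' \<subseteq> U" "\<not> splits c (\<pi> g')" "splits c (ends H g' \<inter> U)"
                using aU unfolding acon_def by blast
              have "splits c (ends H g' \<inter> Y)" by (rule splits_mono[OF g'(4)]) (use UY in blast)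
              moreover have "\<rho> g' = \<pi> g'" using g'(1) \<rho>o by blast
              ultimately show ?thesis using g' UY by (intro bexI[of _ g']) auto
            next
              case False
              \<comment> \<open>A colouring constant on \<open>U\<close> is constant on the new
                pair, so \<open>e\<close> itself remains a witness.\<close>
              then have "\<not> splits c (\<rho> e)" using splits_mono[OF _ uvU] \<rho>e by auto
              then show ?thesis using F(1) g(4) ge UY uvU \<rho>e by (intro bexI[of _ e]) auto
            qed
          qed
        qed
        with False show ?thesis by (simp add: kcon_def)
      qed
    qed
    show "in_class (step (kcon b F \<rho>) (pl \<pi> i' j')) (A \<union> B)"
      if sta: "stage \<pi> s t b F i' j'" and U: "in_class (pl \<pi> i' j') U" for b F i' j'
    proof -
      have F: "e \<in> F" "if b then \<forall>X\<in>P. con (F - {e}) \<pi> X else acon (ends H) (F - {e}) \<pi> U"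
        using stF[OF sta sl U] by simp_all
      have ps: "pl \<pi> s t = step (kcon b F \<pi>) (pl \<pi> i' j')" by (rule stage_plane[OF qg sta])
      have ABU: "A \<union> B \<subseteq> U" using classU[OF AB(3)] classU[OF AB(4)] by blast
      \<comment> \<open>An anticomponent step would keep \<open>U\<close> in one class, contrary to
        the exposure of \<open>A\<close> and \<open>B\<close>.\<close>
      have b: b
      proof (rule ccontr)
        assume nb: "\<not> b"
        then have "kcon b (F - {e}) \<pi> U" using F(2) by (simp add: kcon_def)
        then have "kcon b F \<pi> U" by (rule kcon_mono) blast
        then have "in_class (pl \<pi> s t) U"
          using step_in_class[OF finV plane_partition[OF qg] _ U] uvU unfolding ps by blast
        then show False using out in_class_mono[OF _ ABU] by blast
      qed
      have cl: "con F \<rho> X" if "X \<in> P" for X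
        unfolding con_def
      proof (intro allI impI)
        fix c assume "splits c X"
        moreover have "con (F - {e}) \<pi> X" using F(2) b that by simp
        ultimately obtain g where g: "g \<in> F - {e}" "\<pi> g \<subseteq> X" "splits c (\<pi> g)" unfolding con_def by blast
        moreover have "\<rho> g = \<pi> g" using g(1) \<rho>o by blast
        ultimately show "\<exists>f\<in>F. \<rho> f \<subseteq> X \<and> splits c (\<rho> f)" by (intro bexI[of _ g]) auto
      qed
      \<comment> \<open>The new pair is a connected set meeting both \<open>A\<close> and
        \<open>B\<close>, and overlapping connected sets unite.\<close>
      have "con F \<rho> {u, v}"
        unfolding con_def using F(1) \<rho>e by auto
      then have "con F \<rho> (A \<union> {u, v})"
        using cl[OF ABP(1)] uv(1) cluster_con[of F \<rho>] unfolding cluster_def by blast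
      then have "con F \<rho> (A \<union> {u, v} \<union> B)"
        using cl[OF ABP(2)] uv(3) cluster_con[of F \<rho>] unfolding cluster_def by blast
      moreover have "A \<union> {u, v} \<union> B = A \<union> B" using uv by blast
      ultimately have "kcon b F \<rho> (A \<union> B)" using b by (simp add: kcon_def)
      then show ?thesis
        using step_in_class[OF finV plane_partition[OF qg] _ in_class_mono[OF U ABU]] uv by blast
    qed
  qed
  with qg\<rho> show ?thesis by blast
qed

end

section \<open>The empty hypergraph\<close>

lemma no_hedges_acyclic: "hedges G = {} \<Longrightarrow> acyclic_hypergraph G"
  unfolding acyclic_hypergraph_def quasicycle_def
  by (auto simp: multigraph_of_def used_hedges_def dest: cycle_edges_nonempty)

lemma empty_components [simp]: "components_on H \<pi> {} = {}"
  by (simp add: components_on_def multigraph_components_def induced_def)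

lemma empty_anticomponents [simp]: "anticomponents_on H \<pi> {} = {}"
  by (auto simp: anticomponents_on_def)

text \<open>The empty set has no components and no anticomponents, so the improper class
  \<open>{}\<close> is gone after one step.\<close>

lemma empty_row_inf:
  assumes "P \<subseteq> {{}}"
  shows "row H \<pi> P \<infinity> = {}"
proof -
  have sub: "row_fin H \<pi> P n \<subseteq> {{}} \<and> row_fin H \<pi> P (Suc n) = {}" for n
  proof (induction n)
    case 0
    then show ?case using assms by auto
  next
    case (Suc n)
    then show ?case by auto
  qed
  have "eventual_value (row_fin H \<pi> P) = {}"
  proof (rule eventual_value_eq[of 1])
    show "row_fin H \<pi> P n = {}" if "1 \<le> n" for n using sub[of "n - 1"] that by (cases n) simp_all
  qed
  then show ?thesis by (simp add: row_def)
qed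

lemma empty_skeletal:
  assumes H: "verts H = {}" "hedges H = {}"
  shows "skeletal H \<pi> (plane_limit H leE \<pi>)" "acyclic_quasigraph H \<pi>"
proof -
  have acyc: "acyclic_hypergraph (unused_quot H \<pi> P)" for P
    by (rule no_hedges_acyclic) (simp add: unused_quot_def unused_part_def quot_hypergraph_def H)
  have inf: "plane H leE \<pi> i \<infinity> = {}" for i
  proof (induction i)
    case 0
    show ?case unfolding plane_0 by (rule empty_row_inf) (simp add: H)
  next
    case (Suc i)
    have "decision_at H leE \<pi> i = TERMINATE" using acyc by (simp add: decision_at_def decide_def)
    then show ?case unfolding plane_Suc by (intro empty_row_inf) (simp add: next_start_def Suc)
  qed
  have "plane_limit H leE \<pi> = {}" unfolding plane_limit_def by (rule eventual_value_eq) (rule inf)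
  then show "skeletal H \<pi> (plane_limit H leE \<pi>)"
    using acyc by (simp add: skeletal_def solid_def H partition_on_def)
  show "acyclic_quasigraph H \<pi>"
    unfolding acyclic_quasigraph_def forest_def
  proof clarify
    fix vs es assume "is_cycle (multigraph_of H \<pi>) vs es"
    then show False using H(2) cycle_edges_nonempty
      by (fastforce simp: is_cycle_def multigraph_of_def used_hedges_def)
  qed
qed

section \<open>Case distinction on the last decision\<close>

theorem theorem6:
  fixes H :: "('v, 'e) hypergraph"
    and leE :: "'e rel"
    and leD :: "'e decision rel"
    and \<pi> :: "'e \<Rightarrow> 'v set"
  assumes "three_hypergraph H"
    and "linear_order_on (hedges H) leE"
    and "decision_order H leE leD"
    and "quasigraph H \<pi>"
    and "\<not> skeletal H \<pi> (plane_limit H leE \<pi>) \<or> \<not> acyclic_quasigraph H \<pi>"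
  shows "\<exists>\<rho>. quasigraph H \<rho> \<and>
     (sig_less H leE leD \<pi> \<rho> \<or>
      sig_equiv H leE leD \<rho> \<pi> \<and> qsize H \<rho> < qsize H \<pi>)"
proof -
  have "verts H \<noteq> {}"
  proof
    assume V: "verts H = {}"
    then have "hedges H = {}" using assms(1) by (force simp: three_hypergraph_def)
    with V assms(5) empty_skeletal show False by blast
  qed
  then interpret ordered_three_hypergraph H leE leD
    using assms by unfold_locales
  show ?thesis
  proof (cases "dec \<pi> (len \<pi>) = STOP")
    case True
    then show ?thesis using improve_stop[OF assms(4)] by blast
  next
    case False
    then have fin: "dec \<pi> (len \<pi>) = TERMINATE" using len_stops[OF assms(4)] by blast
    then have "\<not> acyclic_quasigraph H \<pi>" using assms(5) terminate_skeletal[OF assms(4)] by blast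
    then obtain vs es where "is_cycle (multigraph_of H \<pi>) vs es"
      unfolding acyclic_quasigraph_def forest_def by blast
    then show ?thesis by (rule improve_cycle[OF assms(4) fin])
  qed
qed

end
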